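(* Let $u^*(x):=(-x_2x_3,\;x_1x_3,\;x_1x_2)^T$ for $x\in\Omega=(-1,1)^3$. Then the following holds. (i) The function $u^*$ minimizes the relaxed problem $$\min\{E_{\mathrm{el}}^{\mathrm{rel}}[u]: u\in\mathcal A_{TB}\}.$$ Any other minimizer has the form $u^*(x)+ce_1$ for some $c\in\mathbb R$. (ii) For any $\alpha\in[-1,1]$, the function $\alpha u^*$ minimizes the problem $$\min\{E_{\mathrm{el}}^{\mathrm{rel}}[u]: u\in\mathcal A_{LR}^\alpha\}.$$ Any other minimizer has the form $$u(x)=\alpha u^*(x)+\begin{pmatrix} dx_2+c\\ -dx_1+\psi(x_3)\\ 0\end{pmatrix}$$ for some $c,d\in\mathbb R$ and some Lipschitz function $\psi:(-1,1)\to\mathbb R$ with Lipschitz constant $\mathrm{Lip}(\psi)\le 2(1-|\alpha|)$.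
   Context: Let $\Omega:=(-1,1)^3$. For $u\in W^{1,2}(\Omega;\mathbb R^3)$ let $e(u):=\frac12(Du+Du^T)$ with entries $e_{ij}(u)=\frac12(\partial_{x_j}u_i+\partial_{x_i}u_j)$. The relaxed elastic energy is $$E_{\mathrm{el}}^{\mathrm{rel}}[u]:=\int_\Omega W^{\mathrm{qc}}(e(u))\,dx,$$ where for symmetric $\xi\in\mathbb R^{3\times3}$ $$W^{\mathrm{qc}}(\xi):=\begin{cases}\xi_{11}^2+\xi_{22}^2+\xi_{33}^2+2\xi_{12}^2+2\xi_{13}^2 & \text{if }|\xi_{23}|\le1,\\ \infty&\text{otherwise.}\end{cases}$$ $\mathcal A_{TB}$ is the set of $u\in W^{1,2}(\Omega;\mathbb R^3)$ such that (in the sense of traces) $u_2(\pm1,x_2,x_3)=\pm x_3$ and $u_3(\pm1,x_2,x_3)=\pm x_2$ (no condition on $u_1$). For $\alpha\in[-1,1]$, $\mathcal A_{LR}^\alpha$ is the set of $u\in W^{1,2}(\Omega;\mathbb R^3)$ such that (in the sense of traces) $u_3(x_1,x_2,\pm1)=\alpha x_1x_2$ (on both faces $x_3=1$ and $x_3=-1$). $e_1=(1,0,0)^T$. *)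

theory Defs
  imports "HOL-Analysis.Analysis"
begin

subsection \<open>Smooth functions and Sobolev spaces\<close>

definition partial_deriv :: "'n \<Rightarrow> ((real, 'n::finite) vec \<Rightarrow> real) \<Rightarrow> (real, 'n) vec \<Rightarrow> real" where
  "partial_deriv j f x = frechet_derivative f (at x) (axis j 1)"

fun C_k :: "nat \<Rightarrow> ((real, 'n::finite) vec \<Rightarrow> real) \<Rightarrow> bool" where
  "C_k 0 f \<longleftrightarrow> continuous_on UNIV f"
| "C_k (Suc k) f \<longleftrightarrow> (\<forall>x. f differentiable (at x)) \<and> (\<forall>j. C_k k (partial_deriv j f))"

definition C_infinity :: "((real, 'n::finite) vec \<Rightarrow> real) set" where
  "C_infinity = {f. \<forall>k. C_k k f}"

definition test_functions :: "(real, 'n::finite) vec set \<Rightarrow> ((real, 'n) vec \<Rightarrow> real) set" where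
  "test_functions S = {\<phi> \<in> C_infinity.
     compact (closure {x. \<phi> x \<noteq> 0}) \<and> closure {x. \<phi> x \<noteq> 0} \<subseteq> S}"

definition L2 :: "'a measure \<Rightarrow> ('a \<Rightarrow> real) set" where
  "L2 M = {f \<in> borel_measurable M. integrable M (\<lambda>x. (f x)\<^sup>2)}"

definition L2_converges :: "'a measure \<Rightarrow> (nat \<Rightarrow> 'a \<Rightarrow> real) \<Rightarrow> ('a \<Rightarrow> real) \<Rightarrow> bool" where
  "L2_converges M F f \<longleftrightarrow> (\<forall>n. F n \<in> L2 M) \<and> f \<in> L2 M \<and>
     (\<lambda>n. LINT x|M. (F n x - f x)\<^sup>2) \<longlonglongrightarrow> 0"

text \<open>
  Elements of Sobolev spaces are represented by functions on the whole space, of which only the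
  values almost everywhere in \<open>S\<close> matter.
\<close>

definition has_weak_partial ::
    "(real, 'n::finite) vec set \<Rightarrow> 'n \<Rightarrow> ((real, 'n) vec \<Rightarrow> real) \<Rightarrow> ((real, 'n) vec \<Rightarrow> real) \<Rightarrow> bool" where
  "has_weak_partial S j f g \<longleftrightarrow>
     f \<in> L2 (lebesgue_on S) \<and> g \<in> L2 (lebesgue_on S) \<and>
     (\<forall>\<phi>\<in>test_functions S.
        (LINT x|lebesgue_on S. f x * partial_deriv j \<phi> x) = - (LINT x|lebesgue_on S. g x * \<phi> x))"

text \<open>
  For open \<open>S\<close> the weak derivative is unique up to null sets; a representative is chosen.
\<close>

definition weak_partial ::
    "(real, 'n::finite) vec set \<Rightarrow> 'n \<Rightarrow> ((real, 'n) vec \<Rightarrow> real) \<Rightarrow> (real, 'n) vec \<Rightarrow> real" where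
  "weak_partial S j f = (SOME g. has_weak_partial S j f g)"

definition W12 :: "(real, 'n::finite) vec set \<Rightarrow> ((real, 'n) vec \<Rightarrow> real) set" where
  "W12 S = {f \<in> L2 (lebesgue_on S). \<forall>j. \<exists>g. has_weak_partial S j f g}"

definition W12_vec :: "(real, 'n::finite) vec set \<Rightarrow> ((real, 'n) vec \<Rightarrow> (real, 'm::finite) vec) set" where
  "W12_vec S = {u. \<forall>i. (\<lambda>x. u x $ i) \<in> W12 S}"

definition W12_converges ::
    "(real, 'n::finite) vec set \<Rightarrow> (nat \<Rightarrow> (real, 'n) vec \<Rightarrow> real) \<Rightarrow> ((real, 'n) vec \<Rightarrow> real) \<Rightarrow> bool" where
  "W12_converges S F f \<longleftrightarrow> (\<forall>n. F n \<in> W12 S) \<and> f \<in> W12 S \<and>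
     L2_converges (lebesgue_on S) F f \<and>
     (\<forall>j. L2_converges (lebesgue_on S) (\<lambda>n. weak_partial S j (F n)) (weak_partial S j f))"


subsection \<open>The cube and traces on its faces\<close>

definition Omega :: "(real^3) set" where
  "Omega = {x. \<forall>i. x $ i \<in> {-1<..<1}}"

text \<open>
  The trace operator on \<open>W\<^sup>1\<^sup>,\<^sup>2\<close> is the continuous extension, with values in
  \<open>L\<^sup>2\<close> of the boundary, of the restriction map on functions that are smooth up to the boundary
  (these are dense, and extend to smooth functions on the whole space).
  Here a face is parametrised isometrically by \<open>P\<close> over the square \<open>(-1,1)\<^sup>2\<close>, so
  that \<open>P\<close> transports the Lebesgue measure to the surface measure, and \<open>g\<close> is the
  trace of \<open>f\<close> on that face in these coordinates.
\<close>

definition has_face_trace ::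
    "(real \<times> real \<Rightarrow> real^3) \<Rightarrow> (real^3 \<Rightarrow> real) \<Rightarrow> (real \<times> real \<Rightarrow> real) \<Rightarrow> bool" where
  "has_face_trace P f g \<longleftrightarrow>
     (\<exists>\<phi>. (\<forall>n. \<phi> n \<in> C_infinity) \<and> W12_converges Omega \<phi> f \<and>
          L2_converges (lebesgue_on ({-1<..<1} \<times> {-1<..<1})) (\<lambda>n. \<phi> n \<circ> P) g)"

definition face1 :: "real \<Rightarrow> real \<times> real \<Rightarrow> real^3" where
  "face1 s = (\<lambda>(x2, x3). vector [s, x2, x3])"

definition face3 :: "real \<Rightarrow> real \<times> real \<Rightarrow> real^3" where
  "face3 s = (\<lambda>(x1, x2). vector [x1, x2, s])"


subsection \<open>The relaxed variational problem\<close>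

definition sym_grad :: "(real^3 \<Rightarrow> real^3) \<Rightarrow> real^3 \<Rightarrow> real^3^3" where
  "sym_grad u x = (\<chi> i j. (weak_partial Omega j (\<lambda>y. u y $ i) x
                         + weak_partial Omega i (\<lambda>y. u y $ j) x) / 2)"

text \<open>Only the values on symmetric matrices are relevant.\<close>

definition W_qc :: "real^3^3 \<Rightarrow> ennreal" where
  "W_qc \<xi> = (if \<bar>\<xi>$2$3\<bar> \<le> 1
     then ennreal ((\<xi>$1$1)\<^sup>2 + (\<xi>$2$2)\<^sup>2 + (\<xi>$3$3)\<^sup>2 + 2 * (\<xi>$1$2)\<^sup>2 + 2 * (\<xi>$1$3)\<^sup>2)
     else \<infinity>)"

definition E_rel :: "(real^3 \<Rightarrow> real^3) \<Rightarrow> ennreal" where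
  "E_rel u = (\<integral>\<^sup>+ x. W_qc (sym_grad u x) \<partial>lebesgue_on Omega)"

definition A_TB :: "(real^3 \<Rightarrow> real^3) set" where
  "A_TB = {u \<in> W12_vec Omega. \<forall>s\<in>{-1, 1}.
     has_face_trace (face1 s) (\<lambda>x. u x $ 2) (\<lambda>(x2, x3). s * x3) \<and>
     has_face_trace (face1 s) (\<lambda>x. u x $ 3) (\<lambda>(x2, x3). s * x2)}"

definition A_LR :: "real \<Rightarrow> (real^3 \<Rightarrow> real^3) set" where
  "A_LR \<alpha> = {u \<in> W12_vec Omega. \<forall>s\<in>{-1, 1}.
     has_face_trace (face3 s) (\<lambda>x. u x $ 3) (\<lambda>(x1, x2). \<alpha> * x1 * x2)}"

definition u_star :: "real^3 \<Rightarrow> real^3" where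
  "u_star x = vector [- (x$2 * x$3), x$1 * x$3, x$1 * x$2]"

end

theory Submission
  imports Defs
begin

text \<open>
  Both minimal energies vanish, since \<open>\<alpha> u\<^sup>*\<close> has the single strain component
  \<open>e\<^sub>2\<^sub>3 = \<alpha> x\<^sub>1\<close>. So the minimisers are the admissible fields with
  \<open>e\<^sub>1\<^sub>1 = e\<^sub>2\<^sub>2 = e\<^sub>3\<^sub>3 = e\<^sub>1\<^sub>2 = e\<^sub>1\<^sub>3 = 0\<close> and \<open>\<bar>e\<^sub>2\<^sub>3\<bar> \<le> 1\<close>.

  For such a field \<open>\<partial>\<^sub>1 u\<^sub>2 = - \<partial>\<^sub>2 u\<^sub>1\<close> and \<open>\<partial>\<^sub>1 u\<^sub>3 = - \<partial>\<^sub>3 u\<^sub>1\<close> do not depend on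
  \<open>x\<^sub>1\<close>, so \<open>u\<^sub>2\<close> and \<open>u\<^sub>3\<close> are affine in \<open>x\<^sub>1\<close> and the traces on
  \<open>x\<^sub>1 = \<plusminus>1\<close> determine them; in (ii) the traces on \<open>x\<^sub>3 = \<plusminus>1\<close> determine \<open>u\<^sub>3\<close> because
  \<open>\<partial>\<^sub>3 u\<^sub>3 = 0\<close>. In (i) the difference \<open>u\<^sub>1 - u\<^sup>*\<^sub>1\<close> then has zero gradient. In (ii) the function
  \<open>\<partial>\<^sub>2 (u\<^sub>1 - \<alpha> u\<^sup>*\<^sub>1) = - \<partial>\<^sub>1 (u\<^sub>2 - \<alpha> u\<^sup>*\<^sub>2)\<close> has zero gradient, hence is a constant \<open>d\<close>;
  what remains of \<open>u\<^sub>2\<close> is a function \<open>\<psi>(x\<^sub>3)\<close> with \<open>\<psi>' = 2 (e\<^sub>2\<^sub>3 - \<alpha> x\<^sub>1)\<close>, and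
  \<open>\<bar>e\<^sub>2\<^sub>3\<bar> \<le> 1\<close> near \<open>x\<^sub>1 = \<plusminus>1\<close> gives \<open>\<bar>\<psi>'\<bar> \<le> 2 (1 - \<bar>\<alpha>\<bar>)\<close>.

  All this is done with weak derivatives. Products of one-dimensional bumps are enough test functions.
\<close>

subsection \<open>Smooth bumps on the line\<close>

text \<open>The obstacle is that independence of a coordinate is known only in the weak sense,
  without slices of Sobolev functions. It is replaced by a statement on integrals: if the weak
  derivative in direction \<open>j\<close> vanishes, the pairing with a product of one-variable
  factors sees the \<open>j\<close>-th factor only through its integral
  (\<open>pweak_zero_average\<close>). In all three directions together this gives constancy; with a
  factor concentrated near a face it gives the sharp Lipschitz constant. Such uses need constants
  and indicators of intervals as factors, hence the passage to bounded pointwise limits of bumps.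
  Traces are given by smooth approximation, so they enter only through a divergence identity with
  the weight \<open>(1 + s * t) / 2\<close>, which is 1 on the face \<open>s\<close> and 0 on the
  opposite one. The two choices of \<open>s\<close> separate the derivative of a function from the
  function itself. The one object that has to be built pointwise is \<psi>, because a Lipschitz
  bound cannot be read off a function known only up to null sets. It is obtained as a primitive of
  its derivative.\<close>

fun smooth_k :: "nat \<Rightarrow> (real \<Rightarrow> real) \<Rightarrow> bool" where
  "smooth_k 0 g \<longleftrightarrow> continuous_on UNIV g"
| "smooth_k (Suc k) g \<longleftrightarrow> (\<forall>t. (g has_real_derivative deriv g t) (at t)) \<and> smooth_k k (deriv g)"

text \<open>A pointwise derivative determines \<open>deriv g\<close>, so an explicit formula may
  stand in for it in the recursion. The closure properties below go through this rule.\<close>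

lemma smooth_k_SucI:
  assumes "\<And>t. (g has_real_derivative g' t) (at t)" "smooth_k k g'"
  shows "smooth_k (Suc k) g"
proof -
  have "deriv g = g'" using assms(1) by (auto intro: DERIV_imp_deriv)
  then show ?thesis using assms by simp
qed

lemma DERIV_imp_continuous_on:
  fixes g :: "real \<Rightarrow> real"
  assumes "\<And>t. (g has_real_derivative g' t) (at t)" shows "continuous_on S g"
  using assms by (blast intro: DERIV_isCont continuous_at_imp_continuous_on)

lemma smooth_k_Suc_imp: "smooth_k (Suc k) g \<Longrightarrow> smooth_k k g"
proof (induction k arbitrary: g)
  case 0
  then show ?case using DERIV_imp_continuous_on[of g "deriv g"] by simp
qed simp

lemma smooth_k_add: "smooth_k k f \<Longrightarrow> smooth_k k g \<Longrightarrow> smooth_k k (\<lambda>t. f t + g t)"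
proof (induction k arbitrary: f g)
  case 0
  then show ?case by (simp add: continuous_on_add)
next
  case (Suc k)
  show ?case
  proof (rule smooth_k_SucI)
    show "((\<lambda>t. f t + g t) has_real_derivative deriv f t + deriv g t) (at t)" for t
      using Suc.prems by (simp add: DERIV_add)
    show "smooth_k k (\<lambda>t. deriv f t + deriv g t)"
      using Suc.prems by (simp add: Suc.IH)
  qed
qed

lemma smooth_k_mult: "smooth_k k f \<Longrightarrow> smooth_k k g \<Longrightarrow> smooth_k k (\<lambda>t. f t * g t)"
proof (induction k arbitrary: f g)
  case 0
  then show ?case by (simp add: continuous_on_mult)
next
  case (Suc k)
  show ?case
  proof (rule smooth_k_SucI)
    show "((\<lambda>t. f t * g t) has_real_derivative deriv f t * g t + deriv g t * f t) (at t)" for t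
      using Suc.prems by (simp add: DERIV_mult)
    show "smooth_k k (\<lambda>t. deriv f t * g t + deriv g t * f t)"
      using Suc.prems smooth_k_Suc_imp[OF Suc.prems(1)] smooth_k_Suc_imp[OF Suc.prems(2)]
      by (simp add: Suc.IH smooth_k_add)
  qed
qed

lemma smooth_k_const: "smooth_k k (\<lambda>t. c)"
proof (induction k arbitrary: c)
  case (Suc k)
  show ?case by (rule smooth_k_SucI[OF DERIV_const Suc])
qed simp

lemma smooth_k_ident: "smooth_k k (\<lambda>t. t)"
proof (cases k)
  case (Suc k')
  show ?thesis unfolding Suc by (rule smooth_k_SucI[OF DERIV_ident smooth_k_const])
qed simp

lemma smooth_k_affine: "smooth_k k g \<Longrightarrow> smooth_k k (\<lambda>t. g (a * t + b))"
proof (induction k arbitrary: g)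
  case 0
  then have "continuous_on UNIV g" by simp
  then have "continuous_on UNIV (\<lambda>t. g (a * t + b))"
    by (rule continuous_on_compose2) (auto intro: continuous_intros)
  then show ?case by simp
next
  case (Suc k)
  show ?case
  proof (rule smooth_k_SucI)
    have "((\<lambda>t. a * t + b) has_real_derivative a) (at t)" for t
      by (auto intro!: derivative_eq_intros)
    then show "((\<lambda>t. g (a * t + b)) has_real_derivative deriv g (a * t + b) * a) (at t)" for t
      using Suc.prems by (intro DERIV_chain2[where f=g]) auto
    show "smooth_k k (\<lambda>t. deriv g (a * t + b) * a)"
      using Suc by (simp add: smooth_k_mult smooth_k_const)
  qed
qed

section \<open>Flat functions and their derivatives\<close>

text \<open>The case \<open>m = 0\<close> is the usual exp(-1/t) extended by zero. The power of 1/t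
  is carried along so that derivatives are linear combinations of members of the family.\<close>

definition flat_fun :: "nat \<Rightarrow> real \<Rightarrow> real" where
  "flat_fun m t = (if t > 0 then inverse t ^ m * exp (- inverse t) else 0)"

text \<open>With y = 1/t and n = m + 2, the inequality (1 + y/n)^n \<le> exp y gives y^n * exp(-y)
  \<le> n^n; two of the powers of y are then traded for t^2. The quadratic decay is what makes the
  derivative at 0 exist and vanish.\<close>

lemma flat_fun_bound: "\<bar>flat_fun m t\<bar> \<le> real (m + 2) ^ (m + 2) * t\<^sup>2"
proof (cases "t > 0")
  case True
  define y where "y = inverse t"
  have y: "y > 0" using True by (simp add: y_def)
  have "(y / real (m+2)) ^ (m+2) \<le> (1 + y / real (m+2)) ^ (m+2)"
    using y by (intro power_mono) auto
  also have "\<dots> \<le> exp y"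
    using y by (intro exp_ge_one_plus_x_over_n_power_n) auto
  finally have "y ^ (m+2) / real (m+2) ^ (m+2) \<le> exp y" by (simp add: power_divide)
  then have "y ^ (m+2) \<le> exp y * real (m+2) ^ (m+2)"
    by (subst (asm) pos_divide_le_eq) auto
  then have "y ^ (m+2) * exp (- y) \<le> real (m+2) ^ (m+2)"
    by (simp add: exp_minus field_simps)
  then have "(y ^ (m+2) * exp (- y)) * t\<^sup>2 \<le> real (m+2) ^ (m+2) * t\<^sup>2"
    by (intro mult_right_mono) auto
  moreover have "(y ^ (m+2) * exp (- y)) * t\<^sup>2 = flat_fun m t"
    using True by (simp add: flat_fun_def y_def power_add power2_eq_square field_simps)
  moreover have "flat_fun m t \<ge> 0" using True by (simp add: flat_fun_def)
  ultimately show ?thesis by simp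
qed (simp add: flat_fun_def)

lemma flat_fun_deriv:
  "(flat_fun m has_real_derivative - real m * flat_fun (Suc m) t + flat_fun (m + 2) t) (at t)"
proof -
  consider "t > 0" | "t < 0" | "t = 0" by linarith
  then show ?thesis
  proof cases
    case 1
    have inv: "(inverse has_real_derivative - (inverse t ^ 2)) (at t)"
      using DERIV_inverse[of t UNIV] 1 by (simp add: power2_eq_square)
    have "((\<lambda>t. inverse t ^ m) has_real_derivative - real m * inverse t ^ Suc m) (at t)"
      using DERIV_power[OF inv, of m] by (cases m) (simp_all add: power2_eq_square algebra_simps)
    moreover have "((\<lambda>t. exp (- inverse t)) has_real_derivative exp (- inverse t) * - (- (inverse t ^ 2))) (at t)"
      by (rule DERIV_fun_exp[OF DERIV_minus[OF inv]])
    ultimately have "((\<lambda>t. inverse t ^ m * exp (- inverse t)) has_real_derivative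
        - real m * inverse t ^ Suc m * exp (- inverse t) + exp (- inverse t) * - (- (inverse t ^ 2)) * inverse t ^ m) (at t)"
      by (rule DERIV_mult)
    moreover have "- real m * inverse t ^ Suc m * exp (- inverse t) + exp (- inverse t) * - (- (inverse t ^ 2)) * inverse t ^ m
        = - real m * flat_fun (Suc m) t + flat_fun (m + 2) t"
      using 1 by (simp only: flat_fun_def if_True power_add mult_ac minus_minus)
    ultimately have "((\<lambda>t. inverse t ^ m * exp (- inverse t)) has_real_derivative
        - real m * flat_fun (Suc m) t + flat_fun (m + 2) t) (at t)"
      by simp
    then show ?thesis
      by (rule has_field_derivative_transform_within_open[of _ _ _ "{0<..}"]) (use 1 in \<open>auto simp: flat_fun_def\<close>)
  next
    case 2
    have "((\<lambda>t. 0) has_real_derivative - real m * flat_fun (Suc m) t + flat_fun (m + 2) t) (at t)"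
      using 2 by (simp add: flat_fun_def)
    then show ?thesis
      by (rule has_field_derivative_transform_within_open[of _ _ _ "{..<0}"]) (use 2 in \<open>auto simp: flat_fun_def\<close>)
  next
    case 3
    \<comment> \<open>By the quadratic bound the difference quotient at the origin is at most a
      constant times |h|.\<close>
    have "((\<lambda>h. (flat_fun m (0 + h) - flat_fun m 0) / h) \<longlongrightarrow> 0) (at 0)"
    proof (rule Lim_null_comparison[where g="\<lambda>h. real (m + 2) ^ (m + 2) * \<bar>h\<bar>"])
      show "\<forall>\<^sub>F h in at 0. norm ((flat_fun m (0 + h) - flat_fun m 0) / h) \<le> real (m + 2) ^ (m + 2) * \<bar>h\<bar>"
      proof (rule eventually_mono[OF eventually_neq_at_within[of 0]])
        fix h :: real assume "h \<noteq> 0"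
        then show "norm ((flat_fun m (0 + h) - flat_fun m 0) / h) \<le> real (m + 2) ^ (m + 2) * \<bar>h\<bar>"
          using flat_fun_bound[of m h]
          by (simp add: flat_fun_def[of m 0] divide_simps power2_eq_square mult.assoc)
      qed
      show "((\<lambda>h. real (m + 2) ^ (m + 2) * \<bar>h\<bar>) \<longlongrightarrow> 0) (at 0)"
        by (auto intro!: tendsto_eq_intros)
    qed
    then have "(flat_fun m has_real_derivative 0) (at 0)"
      by (simp add: DERIV_def)
    then show ?thesis using 3 by (simp add: flat_fun_def)
  qed
qed

lemma smooth_k_flat_fun: "smooth_k k (flat_fun m)"
proof (induction k arbitrary: m)
  case 0
  show ?case using DERIV_imp_continuous_on[OF flat_fun_deriv] by simp
next
  case (Suc k)
  show ?case
    by (rule smooth_k_SucI[OF flat_fun_deriv]) (intro smooth_k_add smooth_k_mult smooth_k_const Suc)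
qed

definition smooth :: "(real \<Rightarrow> real) set" where
  "smooth = {g. \<forall>k. smooth_k k g}"

lemma smoothI:
  assumes "\<And>t. (g has_real_derivative g' t) (at t)" "g' \<in> smooth"
  shows "g \<in> smooth"
proof -
  have "smooth_k k g" for k
    using smooth_k_SucI[OF assms(1)] assms(2) smooth_k_Suc_imp by (auto simp: smooth_def)
  then show ?thesis by (simp add: smooth_def)
qed

lemma smooth_DERIV: "g \<in> smooth \<Longrightarrow> (g has_real_derivative deriv g t) (at t)"
  and smooth_deriv: "g \<in> smooth \<Longrightarrow> deriv g \<in> smooth"
  using smooth_k.simps(2) unfolding smooth_def by blast+

lemma smooth_continuous: "g \<in> smooth \<Longrightarrow> continuous_on S g"
  unfolding smooth_def using smooth_k.simps(1)[of g] continuous_on_subset by blast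

lemma smooth_measurable [measurable_dest]: "g \<in> smooth \<Longrightarrow> g \<in> borel_measurable borel"
  using smooth_continuous by (rule borel_measurable_continuous_onI)

lemma smooth_const [simp]: "(\<lambda>t. c) \<in> smooth"
  and smooth_ident [simp]: "(\<lambda>t. t) \<in> smooth"
  and smooth_add: "f \<in> smooth \<Longrightarrow> g \<in> smooth \<Longrightarrow> (\<lambda>t. f t + g t) \<in> smooth"
  and smooth_mult: "f \<in> smooth \<Longrightarrow> g \<in> smooth \<Longrightarrow> (\<lambda>t. f t * g t) \<in> smooth"
  by (simp_all add: smooth_def smooth_k_const smooth_k_ident smooth_k_add smooth_k_mult)

section \<open>Compactly supported smooth functions on (-1,1)\<close>

text \<open>Compact support is expressed by a radius, so that sums are handled by a maximum. A
  negative \<open>r\<close> is allowed and forces \<open>g\<close> to vanish identically.\<close>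

definition bumps :: "(real \<Rightarrow> real) set" where
  "bumps = {g \<in> smooth. \<exists>r<1. \<forall>t. r < \<bar>t\<bar> \<longrightarrow> g t = 0}"

lemma bumps_smooth: "g \<in> bumps \<Longrightarrow> g \<in> smooth" by (simp add: bumps_def)

lemma bumps_bounded:
  assumes "g \<in> bumps" obtains B where "\<And>t. \<bar>g t\<bar> \<le> B"
proof -
  from assms obtain r where g: "g \<in> smooth" and r: "r < 1" "\<And>t. r < \<bar>t\<bar> \<Longrightarrow> g t = 0" by (auto simp: bumps_def)
  have "compact (g ` {-1..1})"
    by (intro compact_continuous_image smooth_continuous g compact_Icc)
  then obtain B where B: "\<And>t. t \<in> {-1..1} \<Longrightarrow> \<bar>g t\<bar> \<le> B"
    by (force dest!: compact_imp_bounded simp: bounded_iff)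
  have "\<bar>g t\<bar> \<le> B" for t
    using B[of t] r(2)[of t] B[of 0] r(1) by (cases "t \<in> {-1..1}") auto
  then show ?thesis by (rule that)
qed

lemma bumps_deriv: assumes "g \<in> bumps" shows "deriv g \<in> bumps"
proof -
  from assms obtain r where g: "g \<in> smooth" and r: "r < 1" "\<And>t. r < \<bar>t\<bar> \<Longrightarrow> g t = 0" by (auto simp: bumps_def)
  have "deriv g t = 0" if "r < \<bar>t\<bar>" for t
  proof -
    have "((\<lambda>t. 0) has_real_derivative 0) (at t)" by simp
    moreover have "open {t. r < \<bar>t\<bar>}" by (intro open_Collect_less continuous_intros)
    ultimately have "(g has_real_derivative 0) (at t)"
      by (rule has_field_derivative_transform_within_open) (use that r in auto)
    then show ?thesis by (rule DERIV_imp_deriv)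
  qed
  then show ?thesis using smooth_deriv[OF g] r(1) by (auto simp: bumps_def)
qed

lemma bumps_mult:
  assumes "h \<in> smooth" "g \<in> bumps" shows "(\<lambda>t. h t * g t) \<in> bumps"
proof -
  from assms(2) obtain r where r: "g \<in> smooth" "r < 1" "\<And>t. r < \<bar>t\<bar> \<Longrightarrow> g t = 0"
    unfolding bumps_def by blast
  then have "\<forall>t. r < \<bar>t\<bar> \<longrightarrow> h t * g t = 0" by simp
  then show ?thesis using smooth_mult[OF assms(1) r(1)] r(2) unfolding bumps_def by blast
qed

lemma bumps_add:
  assumes "g \<in> bumps" "h \<in> bumps" shows "(\<lambda>t. g t + h t) \<in> bumps"
proof -
  from assms(1) obtain r where r: "g \<in> smooth" "r < 1" "\<And>t. r < \<bar>t\<bar> \<Longrightarrow> g t = 0"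
    unfolding bumps_def by blast
  from assms(2) obtain s where s: "h \<in> smooth" "s < 1" "\<And>t. s < \<bar>t\<bar> \<Longrightarrow> h t = 0"
    unfolding bumps_def by blast
  have "max r s < 1" "\<forall>t. max r s < \<bar>t\<bar> \<longrightarrow> g t + h t = 0" using r s by simp_all
  then show ?thesis using smooth_add[OF r(1) s(1)] unfolding bumps_def by blast
qed

text \<open>To the left of the support of \<open>g\<close> the primitive normalised at -1 is zero;
  to the right it equals the whole integral, which is zero again. Mean-zero bumps are thus
  derivatives of bumps, and \<open>pweak_zero_average\<close> rests on this.\<close>

lemma bumps_primitive:
  assumes "g \<in> bumps" "integral {-1..1} g = 0"
  obtains G where "G \<in> bumps" "deriv G = g"
proof -
  from assms obtain r where g: "g \<in> smooth" and r: "r < 1" "\<And>t. r < \<bar>t\<bar> \<Longrightarrow> g t = 0" by (auto simp: bumps_def)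
  have "isCont g x" for x using smooth_continuous[OF g, of UNIV] by (simp add: continuous_on_eq_continuous_at)
  then obtain F where F: "\<And>x. (F has_vector_derivative g x) (at x)"
    using einterval_antiderivative[of "-\<infinity>" "\<infinity>" g] by auto
  define G where "G t = F t - F (-1)" for t
  have G: "(G has_real_derivative g t) (at t)" for t
    using DERIV_diff[OF F[unfolded has_real_derivative_iff_has_vector_derivative[symmetric]] DERIV_const[of "F (-1)"], of t]
    by (simp add: G_def[abs_def])
  have "(g has_integral (G 1 - G (-1))) {-1..1}"
    using G by (intro fundamental_theorem_of_calculus)
      (simp_all add: has_field_derivative_at_within flip: has_real_derivative_iff_has_vector_derivative)
  then have G1: "G 1 = 0" using assms(2) by (simp add: integral_unique G_def)
  have const: "G x = G y" if "x < y" "\<forall>t\<in>{x<..<y}. r < \<bar>t\<bar>" for x y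
  proof -
    have "(G has_real_derivative 0) (at t)" if "x < t" "t < y" for t
      using G[of t] r(2)[of t] \<open>\<forall>t\<in>{x<..<y}. r < \<bar>t\<bar>\<close> that by simp
    with \<open>x < y\<close> show ?thesis
      by (intro DERIV_isconst_end[symmetric, of x y] DERIV_imp_continuous_on[OF G])
  qed
  \<comment> \<open>The maximum with 0 excludes t = 0, so t has a sign and can be joined to -1 or 1
    without meeting the support.\<close>
  have "G t = 0" if "max r 0 < \<bar>t\<bar>" for t
  proof -
    have "t \<noteq> 0" using that by auto
    then consider "t > 0" "t < 1" | "t = 1" | "t > 1" | "t < 0" "t > -1" | "t = -1" | "t < -1" by linarith
    then show ?thesis
    proof cases
      case 1 then show ?thesis using const[of t 1] that G1 by simp
    next
      case 3 then show ?thesis using const[of 1 t] r(1) G1 by simp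
    next
      case 4 then show ?thesis using const[of "-1" t] that by (simp add: G_def)
    next
      case 6 then show ?thesis using const[of t "-1"] r(1) by (simp add: G_def)
    next
      case 2 then show ?thesis using G1 by simp
    next
      case 5 then show ?thesis by (simp add: G_def)
    qed
  qed
  moreover have "G \<in> smooth" by (rule smoothI[OF G g])
  ultimately have "G \<in> bumps"
    using r(1) unfolding bumps_def by (intro CollectI conjI exI[of _ "max r 0"]) simp_all
  moreover have "deriv G = g" using G by (auto intro: DERIV_imp_deriv)
  ultimately show ?thesis by (rule that)
qed

text \<open>The shift by 1 makes the factors vanish up to distance 1/(n+1) inside \<open>p\<close>
  and \<open>q\<close>. The support is therefore compact in the open interval, whose indicator is
  the limit in \<open>n\<close>.\<close>

definition bump_seq :: "real \<Rightarrow> real \<Rightarrow> nat \<Rightarrow> real \<Rightarrow> real" where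
  "bump_seq p q n t = flat_fun 0 (real (Suc n) * (t - p) - 1) * flat_fun 0 (real (Suc n) * (q - t) - 1)"

lemma flat_fun_0_bounds: "0 \<le> flat_fun 0 t" "flat_fun 0 t \<le> 1"
  by (auto simp: flat_fun_def)

lemma bump_seq_bounds: "0 \<le> bump_seq p q n t" "bump_seq p q n t \<le> 1"
  using flat_fun_0_bounds by (auto simp: bump_seq_def mult_le_one)

lemma bump_seq_bumps:
  assumes "-1 \<le> p" "q \<le> 1" shows "bump_seq p q n \<in> bumps"
proof -
  define m where "m = real (Suc n)"
  have m: "m > 0" by (simp add: m_def)
  have "smooth_k k (\<lambda>t. flat_fun 0 (m * t + (- m * p - 1)) * flat_fun 0 ((- m) * t + (m * q - 1)))" for k
    by (intro smooth_k_mult smooth_k_affine smooth_k_flat_fun)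
  moreover have "(\<lambda>t. flat_fun 0 (m * t + (- m * p - 1)) * flat_fun 0 ((- m) * t + (m * q - 1))) = bump_seq p q n"
    by (auto simp: bump_seq_def m_def algebra_simps)
  ultimately have "bump_seq p q n \<in> smooth" by (simp add: smooth_def)
  \<comment> \<open>The radius is \<open>1 - 1/m\<close>: for larger |t| one of the two arguments of
    \<open>flat_fun\<close> is at most 0.\<close>
  moreover have "bump_seq p q n t = 0" if "1 - 1/m < \<bar>t\<bar>" for t
  proof -
    have *: "m - 1 < m * \<bar>t\<bar>" using that m by (simp add: field_simps)
    have "m * (t - p) \<le> m * (t + 1)" "m * (q - t) \<le> m * (1 - t)"
      using m assms by (auto intro!: mult_left_mono)
    then have "m * (t - p) - 1 \<le> 0 \<or> m * (q - t) - 1 \<le> 0" using * by (cases "t \<ge> 0") (auto simp: algebra_simps)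
    then show ?thesis unfolding bump_seq_def m_def[symmetric] by (auto simp: flat_fun_def)
  qed
  moreover have "1 - 1 / m < 1" using m by simp
  ultimately show ?thesis unfolding bumps_def by blast
qed

lemma bump_seq_tendsto: "(\<lambda>n. bump_seq p q n t) \<longlonglongrightarrow> indicator {p<..<q} t"
proof -
  have 1: "(\<lambda>n. flat_fun 0 (real (Suc n) * s - 1)) \<longlonglongrightarrow> 1" if "s > 0" for s
  proof -
    have lim: "filterlim (\<lambda>n. real (Suc n) * s - 1) at_top sequentially"
      unfolding filterlim_at_top_dense
    proof
      fix Z :: real
      obtain N where N: "(Z + 1) / s < real N" using reals_Archimedean2 by blast
      show "\<forall>\<^sub>F n in sequentially. Z < real (Suc n) * s - 1"
      proof (rule eventually_sequentiallyI[of N])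
        fix n assume "N \<le> n"
        then have "(Z + 1) / s < real (Suc n)" using N by linarith
        then show "Z < real (Suc n) * s - 1" using that by (simp add: pos_divide_less_eq)
      qed
    qed
    have "((\<lambda>x::real. exp (- inverse x)) \<longlongrightarrow> exp (-0)) at_top"
      by (intro tendsto_exp tendsto_minus tendsto_inverse_0_at_top filterlim_ident)
    from filterlim_compose[OF this lim] have "(\<lambda>n. exp (- inverse (real (Suc n) * s - 1))) \<longlonglongrightarrow> 1" by simp
    moreover have "\<forall>\<^sub>F n in sequentially. exp (- inverse (real (Suc n) * s - 1)) = flat_fun 0 (real (Suc n) * s - 1)"
      using lim[unfolded filterlim_at_top_dense, rule_format, of 0]
      by eventually_elim (simp add: flat_fun_def)
    ultimately show ?thesis by (rule Lim_transform_eventually)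
  qed
  show ?thesis
  proof (cases "t \<in> {p<..<q}")
    case True
    then show ?thesis unfolding bump_seq_def using tendsto_mult[OF 1[of "t-p"] 1[of "q-t"]] by auto
  next
    case False
    have "bump_seq p q n t = 0" for n
    proof -
      have "t - p \<le> 0 \<or> q - t \<le> 0" using False by auto
      then have "real (Suc n) * (t - p) \<le> 0 \<or> real (Suc n) * (q - t) \<le> 0" by (simp only: mult_le_0_iff) auto
      then show ?thesis by (auto simp: bump_seq_def flat_fun_def)
    qed
    then show ?thesis using False by simp
  qed
qed

subsection \<open>Products of functions of one coordinate\<close>

text \<open>Indexing the factors by the coordinates lets a partial derivative be written as the
  update \<open>g(j := deriv (g j))\<close> of one factor, so the products of smooth factors are
  closed under differentiation.\<close>

definition tprod :: "('n \<Rightarrow> real \<Rightarrow> real) \<Rightarrow> (real, 'n::finite) vec \<Rightarrow> real" where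
  "tprod g x = (\<Prod>i\<in>UNIV. g i (x $ i))"

lemma tprod_measurable [measurable (raw)]:
  fixes g :: "'n::finite \<Rightarrow> real \<Rightarrow> real"
  assumes "\<And>i. g i \<in> borel_measurable borel"
  shows "tprod g \<in> borel_measurable borel"
proof -
  have [measurable]: "(\<lambda>x. g i (x $ i)) \<in> borel_measurable borel" for i
    by (rule measurable_compose[OF _ assms]) (intro borel_measurable_continuous_onI continuous_intros)
  show ?thesis unfolding tprod_def[abs_def] by measurable
qed

lemma tprod_upd: "tprod (g(j := h)) x = h (x $ j) * (\<Prod>i\<in>UNIV - {j}. g i (x $ i))"
  unfolding tprod_def by (subst prod.remove[of UNIV j]) auto

lemma tprod_split: "tprod g x = g j (x $ j) * (\<Prod>i\<in>UNIV - {j}. g i (x $ i))"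
  using tprod_upd[of g j "g j" x] by simp

lemma tprod_has_derivative:
  assumes "\<And>i t. (g i has_real_derivative g' i t) (at t)"
  shows "(tprod g has_derivative (\<lambda>h. \<Sum>i\<in>UNIV. h $ i * tprod (g(i := g' i)) x)) (at x)"
proof -
  have "((\<lambda>x. g i (x $ i)) has_derivative (\<lambda>h. h $ i * g' i (x $ i))) (at x)" for i
  proof -
    have "((\<lambda>x. x $ i) has_derivative (\<lambda>h. h $ i)) (at x)"
      by (intro bounded_linear_imp_has_derivative bounded_linear_vec_nth)
    from DERIV_compose_FDERIV[OF assms this] show ?thesis .
  qed
  then have "((\<lambda>x. \<Prod>i\<in>UNIV. g i (x $ i)) has_derivative
      (\<lambda>h. \<Sum>i\<in>UNIV. h $ i * g' i (x $ i) * (\<Prod>j\<in>UNIV - {i}. g j (x $ j)))) (at x)"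
    by (intro has_derivative_prod)
  then show ?thesis
    unfolding tprod_upd by (simp add: tprod_def[abs_def] mult.assoc)
qed

lemma tprod_partial_deriv:
  assumes "\<And>i. g i \<in> smooth"
  shows "partial_deriv j (tprod g) = tprod (g(j := deriv (g j)))"
proof
  fix x
  have "(tprod g has_derivative (\<lambda>h. \<Sum>i\<in>UNIV. h $ i * tprod (g(i := deriv (g i))) x)) (at x)"
    by (intro tprod_has_derivative smooth_DERIV assms)
  from frechet_derivative_at[OF this, symmetric]
  show "partial_deriv j (tprod g) x = tprod (g(j := deriv (g j))) x"
    by (simp add: partial_deriv_def axis_def if_distrib[of "\<lambda>x. x * _"] cong: if_cong)
qed

lemma tprod_differentiable:
  assumes "\<And>i. g i \<in> smooth" shows "tprod g differentiable (at x)"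
  unfolding differentiable_def by (rule exI, rule tprod_has_derivative[OF smooth_DERIV[OF assms]])

lemma tprod_C_k:
  assumes "\<And>i. g i \<in> smooth" shows "C_k k (tprod g)"
  using assms
proof (induction k arbitrary: g)
  case 0
  then show ?case
    by (auto intro!: differentiable_imp_continuous_on simp: differentiable_on_def
        differentiable_at_withinI tprod_differentiable)
next
  case (Suc k)
  have "C_k k (tprod (g(j := deriv (g j))))" for j
    using Suc.prems by (intro Suc.IH) (simp add: smooth_deriv)
  then show ?case using Suc.prems by (simp add: tprod_partial_deriv tprod_differentiable)
qed

lemma tprod_C_infinity: "(\<And>i. g i \<in> smooth) \<Longrightarrow> tprod g \<in> C_infinity"
  by (simp add: C_infinity_def tprod_C_k)

lemma C_infinity_differentiable: "f \<in> C_infinity \<Longrightarrow> f differentiable (at x)"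
  using C_k.simps(2)[of 0 f] unfolding C_infinity_def by blast

lemma C_infinity_partial_deriv: "f \<in> C_infinity \<Longrightarrow> partial_deriv j f \<in> C_infinity"
  using C_k.simps(2)[of _ f] unfolding C_infinity_def by blast

lemma C_infinity_continuous: "f \<in> C_infinity \<Longrightarrow> continuous_on S f"
  using C_k.simps(1)[of f] continuous_on_subset unfolding C_infinity_def by blast

lemma C_infinity_measurable: "f \<in> C_infinity \<Longrightarrow> f \<in> borel_measurable borel"
  using C_infinity_continuous by (rule borel_measurable_continuous_onI)

section \<open>Test functions, integrability and weak limits on the cube\<close>

lemma Omega_eq: "Omega = box (-1) 1"
  by (auto simp: Omega_def mem_box_cart)

lemma Omega_borel [measurable]: "Omega \<in> sets borel"
  by (simp add: Omega_eq)

lemma Omega_lmeasurable [simp]: "Omega \<in> lmeasurable"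
  by (simp add: Omega_eq)

lemma tprod_test_function:
  assumes "\<And>i. g i \<in> bumps"
  shows "tprod g \<in> test_functions Omega"
proof -
  have "\<forall>i. \<exists>r<1. \<forall>t. r < \<bar>t\<bar> \<longrightarrow> g i t = 0" using assms by (simp add: bumps_def)
  then obtain r where r: "\<And>i. r i < 1" "\<And>i t. r i < \<bar>t\<bar> \<Longrightarrow> g i t = 0" by metis
  let ?K = "cbox (\<chi> i. - r i) (\<chi> i. r i)"
  have "{x. tprod g x \<noteq> 0} \<subseteq> ?K"
  proof
    fix x assume "x \<in> {x. tprod g x \<noteq> 0}"
    then have "g i (x $ i) \<noteq> 0" for i
      unfolding tprod_def by simp
    then have "\<bar>x $ i\<bar> \<le> r i" for i using r(2) not_less by blast
    then show "x \<in> ?K" by (simp add: mem_box_cart abs_le_iff minus_le_iff)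
  qed
  then have "closure {x. tprod g x \<noteq> 0} \<subseteq> ?K" by (rule closure_minimal) (rule closed_cbox)
  moreover have "?K \<subseteq> Omega"
  proof
    fix x assume "x \<in> ?K"
    then have "- r i \<le> x $ i" "x $ i \<le> r i" for i by (simp_all add: mem_box_cart)
    then have "-1 < x $ i" "x $ i < 1" for i using r(1)[of i] by (smt (verit))+
    then show "x \<in> Omega" by (simp add: Omega_def)
  qed
  moreover have "compact (closure {x. tprod g x \<noteq> 0})"
    using calculation(1) by (meson bounded_cbox bounded_subset closed_closure compact_eq_bounded_closed)
  ultimately show ?thesis
    using tprod_C_infinity[of g] assms by (auto simp: test_functions_def bumps_smooth)
qed

lemma finite_measure_Omega: "finite_measure (lebesgue_on Omega)"
  by (rule finite_measure_lebesgue_on) simp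

lemma borel_measurable_lebesgue_onI: "f \<in> borel_measurable borel \<Longrightarrow> f \<in> borel_measurable (lebesgue_on S)"
  by (intro measurable_restrict_space1 measurable_completion) simp

text \<open>For Borel functions this moves between the completed measure on a set, in which the
  problem is posed, and \<open>lborel\<close>, where translation, Fubini and the fundamental theorem
  of calculus are applied.\<close>

lemma integrable_lebesgue_on_borel:
  fixes f :: "'a::euclidean_space \<Rightarrow> real"
  assumes "f \<in> borel_measurable borel" "S \<in> sets borel"
  shows "integrable (lebesgue_on S) f \<longleftrightarrow> integrable lborel (\<lambda>x. indicator S x * f x)"
  using assms by (simp add: integrable_restrict_space integrable_completion)

lemma integral_lebesgue_on_borel:
  fixes f :: "'a::euclidean_space \<Rightarrow> real"
  assumes "f \<in> borel_measurable borel" "S \<in> sets borel"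
  shows "(LINT x|lebesgue_on S. f x) = (LINT x|lborel. indicator S x * f x)"
  using assms by (simp add: integral_restrict_space integral_completion)

lemma integrable_mult_bounded:
  fixes f g :: "'a \<Rightarrow> real"
  assumes "integrable M f" "g \<in> borel_measurable M" "\<And>x. x \<in> space M \<Longrightarrow> \<bar>g x\<bar> \<le> B"
  shows "integrable M (\<lambda>x. f x * g x)"
proof (rule Bochner_Integration.integrable_bound[where f="\<lambda>x. B * f x"])
  show "AE x in M. norm (f x * g x) \<le> norm (B * f x)"
  proof (rule AE_I2)
    fix x assume "x \<in> space M"
    then have "\<bar>f x\<bar> * \<bar>g x\<bar> \<le> \<bar>f x\<bar> * \<bar>B\<bar>" using assms(3)[of x] by (intro mult_left_mono) auto
    then show "norm (f x * g x) \<le> norm (B * f x)" by (simp add: abs_mult mult.commute)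
  qed
qed (use assms in auto)

lemma continuous_bounded_Omega:
  fixes f :: "real^3 \<Rightarrow> real"
  assumes "continuous_on UNIV f" obtains B where "\<And>x. x \<in> Omega \<Longrightarrow> \<bar>f x\<bar> \<le> B"
proof -
  have "compact (f ` cbox (-1) 1)"
    using assms by (intro compact_continuous_image compact_cbox) (auto intro: continuous_on_subset)
  then obtain B where "\<And>x. x \<in> cbox (-1) 1 \<Longrightarrow> \<bar>f x\<bar> \<le> B"
    by (force dest!: compact_imp_bounded simp: bounded_iff)
  then show ?thesis using that[of B] box_subset_cbox[of "-1" "1"] by (auto simp: Omega_eq)
qed

lemma continuous_integrable_Omega:
  fixes f :: "real^3 \<Rightarrow> real"
  assumes "continuous_on UNIV f" shows "integrable (lebesgue_on Omega) f"
proof -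
  obtain B where B: "\<And>x. x \<in> Omega \<Longrightarrow> \<bar>f x\<bar> \<le> B" using continuous_bounded_Omega[OF assms] by blast
  have "f \<in> borel_measurable (lebesgue_on Omega)"
    using assms by (intro borel_measurable_lebesgue_onI borel_measurable_continuous_onI)
  then show ?thesis
    using B by (intro finite_measure.integrable_const_bound[OF finite_measure_Omega, where B=B] AE_I2) auto
qed

lemma C_infinity_L2:
  assumes "f \<in> C_infinity" shows "f \<in> L2 (lebesgue_on Omega)"
proof -
  have "continuous_on UNIV (\<lambda>x. (f x)\<^sup>2)"
    by (intro continuous_on_power C_infinity_continuous assms)
  then show ?thesis
    using borel_measurable_lebesgue_onI[OF C_infinity_measurable[OF assms]]
    by (simp add: L2_def continuous_integrable_Omega)
qed

lemma L2_integrable: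
  assumes "finite_measure M" "f \<in> L2 M" shows "integrable M f"
proof (rule Bochner_Integration.integrable_bound[where f="\<lambda>x. 1 + (f x)\<^sup>2"])
  interpret finite_measure M by fact
  show "integrable M (\<lambda>x. 1 + (f x)\<^sup>2)" using assms(2) by (simp add: L2_def)
  have "\<bar>y\<bar> \<le> 1 + y\<^sup>2" for y :: real
  proof -
    have "0 \<le> (\<bar>y\<bar> - 1/2)\<^sup>2" by simp
    then show ?thesis by (simp add: power2_diff) (simp add: power2_eq_square)
  qed
  then show "AE x in M. norm (f x) \<le> norm (1 + (f x)\<^sup>2)" by simp
qed (use assms in \<open>simp add: L2_def\<close>)

text \<open>A weighted Young inequality plays the role of Cauchy-Schwarz: in |a b| \<le> t b^2 + a^2
  / t a weight \<open>t n\<close> close to the L2 distance makes the integrals of both terms small.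
  The approximations that define traces are passed to the limit in this form.\<close>

lemma L2_converges_integral:
  assumes M: "finite_measure M" and conv: "L2_converges M F f"
    and g: "g \<in> borel_measurable M" "\<And>x. x \<in> space M \<Longrightarrow> \<bar>g x\<bar> \<le> B"
  shows "(\<lambda>n. LINT x|M. F n x * g x) \<longlonglongrightarrow> (LINT x|M. f x * g x)"
proof -
  interpret finite_measure M by fact
  have F: "F n \<in> L2 M" and f: "f \<in> L2 M" for n using conv by (auto simp: L2_converges_def)
  note [measurable] = g(1)
  have [measurable]: "F n \<in> borel_measurable M" "f \<in> borel_measurable M" for n
    using F f by (auto simp: L2_def)
  note [simp] = L2_integrable[OF M F] L2_integrable[OF M f]
  have sq: "integrable M (\<lambda>x. (F n x - f x)\<^sup>2)" for n
  proof (rule Bochner_Integration.integrable_bound[where f="\<lambda>x. 2 * (F n x)\<^sup>2 + 2 * (f x)\<^sup>2"])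
    show "integrable M (\<lambda>x. 2 * (F n x)\<^sup>2 + 2 * (f x)\<^sup>2)" using F[of n] f by (auto simp: L2_def)
    have "(a - b)\<^sup>2 \<le> 2 * a\<^sup>2 + 2 * b\<^sup>2" for a b :: real
      using sum_squares_bound[of a "-b"] by (simp add: power2_diff)
    then show "AE x in M. norm ((F n x - f x)\<^sup>2) \<le> norm (2 * (F n x)\<^sup>2 + 2 * (f x)\<^sup>2)" by simp
  qed simp
  have gsq: "integrable M (\<lambda>x. (g x)\<^sup>2)"
  proof (rule integrable_const_bound[where B="B\<^sup>2"])
    show "AE x in M. norm ((g x)\<^sup>2) \<le> B\<^sup>2"
      using g(2) by (intro AE_I2) (simp add: abs_le_square_iff[symmetric] order_trans[OF _ abs_ge_self])
  qed simp
  have Fg: "integrable M (\<lambda>x. F n x * g x)" and fg: "integrable M (\<lambda>x. f x * g x)" for n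
    using g by (intro integrable_mult_bounded[where B=B]; simp)+
  define d where "d n = (LINT x|M. (F n x - f x)\<^sup>2)" for n
  define C where "C = (LINT x|M. (g x)\<^sup>2)"
  have d0: "d n \<ge> 0" for n by (simp add: d_def)
  \<comment> \<open>The second summand keeps the weight positive when \<open>d n\<close> is
    zero.\<close>
  define t where "t n = sqrt (d n) + inverse (real (Suc n))" for n
  have t: "t n > 0" "sqrt (d n) \<le> t n" for n using d0[of n] by (auto simp: t_def add_nonneg_pos)
  have bound: "\<bar>(LINT x|M. F n x * g x) - (LINT x|M. f x * g x)\<bar> \<le> t n * C + sqrt (d n)" for n
  proof -
    have young: "\<bar>a * b\<bar> \<le> t n * b\<^sup>2 + a\<^sup>2 / t n" for a b :: real
    proof -
      have "0 \<le> \<bar>a\<bar> * (t n * \<bar>b\<bar>)" using t(1)[of n] by simp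
      with sum_squares_bound[of "\<bar>a\<bar>" "t n * \<bar>b\<bar>"]
      have "\<bar>a\<bar> * (t n * \<bar>b\<bar>) \<le> \<bar>a\<bar>\<^sup>2 + (t n * \<bar>b\<bar>)\<^sup>2" by linarith
      then show ?thesis using t(1)[of n] by (simp add: field_simps abs_mult power2_eq_square)
    qed
    have int: "integrable M (\<lambda>x. (F n x - f x) * g x)" using Fg fg by (simp add: left_diff_distrib)
    have "\<bar>LINT x|M. (F n x - f x) * g x\<bar> \<le> (LINT x|M. \<bar>(F n x - f x) * g x\<bar>)"
      using integral_norm_bound[of M "\<lambda>x. (F n x - f x) * g x"] by simp
    also have "\<dots> \<le> (LINT x|M. t n * (g x)\<^sup>2 + (F n x - f x)\<^sup>2 / t n)"
      using int sq gsq young by (intro integral_mono) auto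
    also have "\<dots> = t n * C + d n / t n"
      using sq gsq by (simp add: C_def d_def)
    also have "d n / t n \<le> sqrt (d n)"
      using t[of n] d0[of n] mult_left_mono[OF t(2)[of n], of "sqrt (d n)"] by (simp add: pos_divide_le_eq)
    finally show ?thesis using Fg fg by (simp add: left_diff_distrib)
  qed
  have "d \<longlonglongrightarrow> 0" using conv by (simp add: L2_converges_def d_def[abs_def])
  then have "(\<lambda>n. sqrt (d n)) \<longlonglongrightarrow> 0" using tendsto_real_sqrt by fastforce
  then have "(\<lambda>n. t n * C + sqrt (d n)) \<longlonglongrightarrow> (0 + 0) * C + 0"
    unfolding t_def by (intro tendsto_intros LIMSEQ_inverse_real_of_nat)
  then have "(\<lambda>n. t n * C + sqrt (d n)) \<longlonglongrightarrow> 0" by simp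
  then have "(\<lambda>n. (LINT x|M. F n x * g x) - (LINT x|M. f x * g x)) \<longlonglongrightarrow> 0"
    by (rule Lim_null_comparison[rotated]) (use bound in \<open>simp add: always_eventually\<close>)
  then show ?thesis by (simp add: LIM_zero_iff)
qed

subsection \<open>The fundamental lemma of the calculus of variations on the cube\<close>

abbreviation "MO \<equiv> lebesgue_on Omega"

interpretation MO: finite_measure MO by (rule finite_measure_Omega)

lemma tprod_indicator:
  "tprod (\<lambda>i. indicator (A i)) x = indicator {x. \<forall>i. x $ i \<in> A i} x"
proof (cases "\<forall>i. x $ i \<in> A i")
  case False
  then obtain i where "x $ i \<notin> A i" by blast
  then have "(\<Prod>i\<in>UNIV. indicator (A i) (x $ i) :: real) = 0"
    by (intro prod_zero bexI[of _ i]) simp_all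
  then show ?thesis using False by (simp add: tprod_def)
qed (simp add: tprod_def)

lemma tprod_bound:
  fixes g :: "'n::finite \<Rightarrow> real \<Rightarrow> real"
  assumes "\<And>i. \<bar>g i (x $ i)\<bar> \<le> B" shows "\<bar>tprod g x\<bar> \<le> B ^ CARD('n)"
proof -
  have "\<bar>tprod g x\<bar> = (\<Prod>i\<in>UNIV. \<bar>g i (x $ i)\<bar>)" by (simp add: tprod_def abs_prod)
  also have "\<dots> \<le> (\<Prod>i\<in>(UNIV::'n set). B)" using assms by (intro prod_mono) simp
  finally show ?thesis by simp
qed

lemma integrable_mult_tprod:
  assumes "integrable MO w" "\<And>i. g i \<in> borel_measurable borel"
    and "\<And>i t. t \<in> {-1<..<1} \<Longrightarrow> \<bar>g i t\<bar> \<le> B"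
  shows "integrable MO (\<lambda>x. w x * tprod g x)"
  using assms
  by (intro integrable_mult_bounded[where B="B ^ CARD(3)"] borel_measurable_lebesgue_onI tprod_measurable tprod_bound)
     (simp_all add: Omega_def)

lemma tprod_limit:
  fixes g :: "nat \<Rightarrow> 3 \<Rightarrow> real \<Rightarrow> real"
  assumes w: "integrable MO w"
    and g: "\<And>n i. g n i \<in> borel_measurable borel" "\<And>i. h i \<in> borel_measurable borel"
    and bound: "\<And>n i t. t \<in> {-1<..<1} \<Longrightarrow> \<bar>g n i t\<bar> \<le> B"
    and lim: "\<And>i t. t \<in> {-1<..<1} \<Longrightarrow> (\<lambda>n. g n i t) \<longlonglongrightarrow> h i t"
  shows "(\<lambda>n. LINT x|MO. w x * tprod (g n) x) \<longlonglongrightarrow> (LINT x|MO. w x * tprod h x)"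
proof (rule integral_dominated_convergence[where w="\<lambda>x. B ^ CARD(3) * \<bar>w x\<bar>"])
  have [measurable]: "w \<in> borel_measurable MO" using w by simp
  have [measurable]: "tprod (g n) \<in> borel_measurable MO" "tprod h \<in> borel_measurable MO" for n
    using g by (auto intro!: borel_measurable_lebesgue_onI tprod_measurable)
  show "(\<lambda>x. w x * tprod h x) \<in> borel_measurable MO" "(\<lambda>x. w x * tprod (g n) x) \<in> borel_measurable MO" for n
    by measurable
  show "integrable MO (\<lambda>x. B ^ CARD(3) * \<bar>w x\<bar>)" using w by simp
  show "AE x in MO. (\<lambda>n. w x * tprod (g n) x) \<longlonglongrightarrow> w x * tprod h x"
    using lim unfolding tprod_def
    by (intro AE_I2 tendsto_mult tendsto_const tendsto_prod) (simp add: Omega_def)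
  show "AE x in MO. norm (w x * tprod (g n) x) \<le> B ^ CARD(3) * \<bar>w x\<bar>" for n
  proof (rule AE_I2)
    fix x assume "x \<in> space MO"
    then have "\<bar>tprod (g n) x\<bar> \<le> B ^ CARD(3)"
      using bound by (intro tprod_bound) (simp add: Omega_def)
    then have "\<bar>tprod (g n) x\<bar> * \<bar>w x\<bar> \<le> B ^ CARD(3) * \<bar>w x\<bar>" by (rule mult_right_mono) simp
    then show "norm (w x * tprod (g n) x) \<le> B ^ CARD(3) * \<bar>w x\<bar>" by (simp add: abs_mult mult.commute)
  qed
qed

text \<open>The sets over which \<open>f\<close> integrates to zero form a Dynkin system, and boxes
  are stable under intersection. The total integral is treated separately because the whole space is
  not a box; it handles complements.\<close>

lemma AE_zero_if_box_integrals_zero: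
  fixes f :: "'a::euclidean_space \<Rightarrow> real"
  assumes f: "integrable lborel f" and box: "\<And>a b. (LINT x|lborel. indicator (box a b) x * f x) = 0"
    and f0: "(LINT x|lborel. f x) = 0"
  shows "AE x in lborel. f x = 0"
proof -
  have ind: "integrable lborel (\<lambda>x. indicator A x * f x)" if "A \<in> sets borel" for A
    using integrable_mult_indicator[of A lborel f] f that by simp
  have "(LINT x|lborel. indicator A x * f x) = 0" if "A \<in> sets borel" for A
  proof -
    have "Int_stable (range (\<lambda>(a, b). box a b :: 'a set))"
      by (auto simp: Int_stable_def box_Int_box)
    moreover have "range (\<lambda>(a, b). box a b :: 'a set) \<subseteq> Pow UNIV" by simp
    moreover have "A \<in> sigma_sets UNIV (range (\<lambda>(a, b). box a b))"
      using that unfolding borel_eq_box by simp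
    ultimately show ?thesis
    proof (induct rule: sigma_sets_induct_disjoint)
      case (compl A)
      then have A: "A \<in> sets borel" by (simp add: borel_eq_box)
      have "(LINT x|lborel. indicator (UNIV - A) x * f x) = (LINT x|lborel. f x - indicator A x * f x)"
        by (intro Bochner_Integration.integral_cong) (auto simp: indicator_def)
      also have "\<dots> = 0" using f ind[OF A] f0 compl by simp
      finally show ?case .
    next
      case (union A)
      then have A: "A i \<in> sets borel" for i by (auto simp: borel_eq_box)
      have "(\<lambda>x. indicator (\<Union>i. A i) x * f x) = (\<lambda>x. indicator (\<Union>i. A i) x *\<^sub>R f x)" by simp
      moreover have "(LINT x:(\<Union>i. A i)|lborel. f x) = (\<Sum>i. (LINT x:(A i)|lborel. f x))"
      proof (rule lebesgue_integral_countable_add)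
        show "A i \<inter> A j = {}" if "i \<noteq> j" for i j using union(1) that by (auto simp: disjoint_family_on_def)
        show "set_integrable lborel (\<Union> (range A)) f"
          using ind[of "\<Union>(range A)"] A by (simp add: set_integrable_def sets.countable_UN)
      qed (use A in auto)
      moreover have "(LINT x:(A i)|lborel. f x) = 0" for i
        using union(3)[of i] by (simp add: set_lebesgue_integral_def)
      ultimately show ?case by (simp add: set_lebesgue_integral_def)
    qed (auto simp: box)
  qed
  then have "AE x in lborel. f x = (\<lambda>x. 0) x"
    using f by (intro density_unique_real) (auto simp: set_lebesgue_integral_def)
  then show ?thesis by simp
qed

text \<open>Products of bumps converge boundedly to indicators of boxes inside the cube, so the
  integral of \<open>w\<close> over each such box vanishes, and box integrals determine an
  integrable function.\<close>

lemma fundamental_lemma: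
  assumes w: "integrable MO w"
    and zero: "\<And>g. (\<And>i. g i \<in> bumps) \<Longrightarrow> (LINT x|MO. w x * tprod g x) = 0"
  shows "AE x in MO. w x = 0"
proof -
  have ind: "(LINT x|MO. w x * tprod (\<lambda>i. indicator {p i<..<q i}) x) = 0" if "\<And>i. -1 \<le> p i" "\<And>i. q i \<le> 1" for p q
  proof -
    have "(\<lambda>n. LINT x|MO. w x * tprod (\<lambda>i. bump_seq (p i) (q i) n) x)
        \<longlonglongrightarrow> (LINT x|MO. w x * tprod (\<lambda>i. indicator {p i<..<q i}) x)"
      using bump_seq_bounds bump_seq_tendsto bump_seq_bumps[OF that]
      by (intro tprod_limit[where B=1] w) (simp_all add: bumps_smooth smooth_measurable)
    then show ?thesis using zero[of "\<lambda>i. bump_seq (p i) (q i) _"] bump_seq_bumps[OF that]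
      by (simp add: LIMSEQ_const_iff)
  qed
  have OL: "Omega \<in> sets lebesgue" by (simp add: fmeasurableD)
  have w0: "integrable lebesgue (\<lambda>x. if x \<in> Omega then w x else 0)"
    by (rule Lebesgue_Measure.integrable_restrict_UNIV[OF OL, THEN iffD2, OF w])
  then have w0_meas: "(\<lambda>x. if x \<in> Omega then w x else 0) \<in> borel_measurable lebesgue"
    by (rule borel_measurable_integrable)
  \<comment> \<open>The uniqueness from box integrals concerns \<open>lborel\<close>, so the
    extension of \<open>w\<close> by zero is replaced by a Borel function equal to it almost
    everywhere.\<close>
  from completion_ex_borel_measurable_real[OF this] obtain v where v: "v \<in> borel_measurable lborel"
    and v_eq: "AE x in lborel. (if x \<in> Omega then w x else 0) = v x" ..
  have v_leb: "v \<in> borel_measurable lebesgue" using v by (rule measurable_completion)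
  note v [measurable]
  have v_eq': "AE x in lebesgue. (if x \<in> Omega then w x else 0) = v x" by (rule AE_completion[OF v_eq])
  have "integrable lebesgue v"
    by (rule integrable_cong_AE[OF w0_meas v_leb v_eq', THEN iffD1, OF w0])
  then have v_int: "integrable lborel v" by (subst (asm) integrable_completion) simp_all
  have trans: "(LINT x|lborel. v x * f x) = (LINT x|MO. w x * f x)" if [measurable]: "f \<in> borel_measurable borel" for f
  proof -
    have "(LINT x|lborel. v x * f x) = (LINT x|lebesgue. v x * f x)"
      by (subst integral_completion) simp_all
    also have "\<dots> = (LINT x|lebesgue. (if x \<in> Omega then w x * f x else 0))"
    proof (rule integral_cong_AE)
      have "(\<lambda>x. (if x \<in> Omega then w x else 0) * f x) \<in> borel_measurable lebesgue"
        by (intro borel_measurable_times w0_meas measurable_completion) simp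
      then show "(\<lambda>x. if x \<in> Omega then w x * f x else 0) \<in> borel_measurable lebesgue"
        by (rule measurable_cong[THEN iffD1, rotated]) auto
      show "(\<lambda>x. v x * f x) \<in> borel_measurable lebesgue"
        by (intro measurable_completion) simp
      show "AE x in lebesgue. v x * f x = (if x \<in> Omega then w x * f x else 0)"
        using v_eq' by eventually_elim auto
    qed
    also have "\<dots> = (LINT x|MO. w x * f x)"
      by (rule Lebesgue_Measure.integral_restrict_UNIV[OF OL])
    finally show ?thesis .
  qed
  have "AE x in lborel. v x = 0"
  proof (rule AE_zero_if_box_integrals_zero[OF v_int])
    fix a b :: "real^3"
    have "(LINT x|lborel. indicator (box a b) x * v x) = (LINT x|lborel. v x * indicator (box a b) x)"
      by (simp add: mult.commute)
    also have "\<dots> = (LINT x|MO. w x * indicator (box a b) x)" by (rule trans) simp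
    \<comment> \<open>Clipping an arbitrary box to the cube brings its sides into the range covered
      by \<open>ind\<close>.\<close>
    also have "\<dots> = (LINT x|MO. w x * tprod (\<lambda>i. indicator {max (a $ i) (-1)<..<min (b $ i) 1}) x)"
      by (intro Bochner_Integration.integral_cong)
         (auto simp: tprod_indicator Omega_def mem_box_cart indicator_def)
    also have "\<dots> = 0" by (rule ind) auto
    finally show "(LINT x|lborel. indicator (box a b) x * v x) = 0" .
  next
    have "(LINT x|lborel. v x) = (LINT x|MO. w x * tprod (\<lambda>i. indicator {-1<..<1}) x)"
      using trans[of "\<lambda>_. 1"]
      by (simp, intro Bochner_Integration.integral_cong)
         (auto simp: tprod_indicator Omega_def indicator_def)
    then show "(LINT x|lborel. v x) = 0" using ind[of "\<lambda>_. -1" "\<lambda>_. 1"] by simp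
  qed
  then have "AE x in lebesgue. v x = 0" by (rule AE_completion)
  with v_eq' have "AE x in lebesgue. x \<in> Omega \<longrightarrow> w x = 0" by eventually_elim auto
  then show ?thesis using OL by (subst AE_restrict_space_iff) simp_all
qed

lemma C_infinity_DERIV:
  fixes f :: "(real, 'n::finite) vec \<Rightarrow> real"
  assumes "f \<in> C_infinity"
  shows "((\<lambda>t. f (x + t *\<^sub>R axis j 1)) has_real_derivative partial_deriv j f (x + t *\<^sub>R axis j 1)) (at t)"
proof -
  let ?y = "x + t *\<^sub>R axis j 1"
  have f: "(f has_derivative frechet_derivative f (at ?y)) (at ?y)"
    using C_infinity_differentiable[OF assms] frechet_derivative_works by blast
  have "((\<lambda>t. x + t *\<^sub>R axis j 1) has_derivative (\<lambda>h. h *\<^sub>R axis j 1)) (at t)"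
    by (auto intro!: derivative_eq_intros)
  from has_derivative_compose[OF this f]
  have "((\<lambda>t. f (x + t *\<^sub>R axis j 1)) has_derivative (\<lambda>h. frechet_derivative f (at ?y) (h *\<^sub>R axis j 1))) (at t)" .
  moreover have "frechet_derivative f (at ?y) (h *\<^sub>R axis j 1) = partial_deriv j f ?y * h" for h
    using linear_cmul[OF has_derivative_linear[OF f]] by (simp add: partial_deriv_def)
  ultimately show ?thesis by (simp add: has_field_derivative_def)
qed

subsection \<open>Weak derivatives tested against products of bumps\<close>

lemma lborel_integral_translate:
  fixes F :: "'a::euclidean_space \<Rightarrow> real"
  assumes "F \<in> borel_measurable borel"
  shows "(LINT x|lborel. F (x + c)) = (LINT x|lborel. F x)"
proof -
  have "(LINT x|lborel. F x) = (LINT x|distr lborel borel ((+) c). F x)" by (simp add: lborel_distr_plus)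
  also have "\<dots> = (LINT x|lborel. F (c + x))" using assms by (intro integral_distr) simp_all
  finally show ?thesis by (simp add: add.commute)
qed

text \<open>By translation invariance every difference quotient of \<open>F\<close> integrates to
  zero, and dominated convergence carries this over to the derivative. No boundary term occurs
  because \<open>F\<close> vanishes off the cube.\<close>

lemma integral_directional_deriv_zero:
  fixes F D :: "real^3 \<Rightarrow> real"
  assumes F: "continuous_on UNIV F" and D: "continuous_on UNIV D"
    and deriv: "\<And>x t. ((\<lambda>t. F (x + t *\<^sub>R axis j 1)) has_real_derivative D (x + t *\<^sub>R axis j 1)) (at t)"
    and F0: "\<And>x. x \<notin> Omega \<Longrightarrow> F x = 0" and D0: "\<And>x. x \<notin> Omega \<Longrightarrow> D x = 0"
  shows "(LINT x|lborel. D x) = 0"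
proof -
  let ?e = "axis j 1 :: real^3"
  define h where "h n = inverse (real (Suc n))" for n
  have h: "0 < h n" "h n \<le> 1" for n by (simp_all add: h_def inverse_le_1_iff)
  have h0: "h \<longlonglongrightarrow> 0" unfolding h_def[abs_def] by (rule LIMSEQ_inverse_real_of_nat)
  have [measurable]: "F \<in> borel_measurable borel" "D \<in> borel_measurable borel"
    using F D by (simp_all add: borel_measurable_continuous_onI)
  obtain B where B: "\<And>x. x \<in> Omega \<Longrightarrow> \<bar>D x\<bar> \<le> B" using continuous_bounded_Omega[OF D] by blast
  have "\<bar>D x\<bar> \<le> max B 0" for x using B[of x] D0[of x] by (cases "x \<in> Omega") auto
  then obtain B where B: "\<And>x. \<bar>D x\<bar> \<le> B" by blast
  then have B0: "0 \<le> B" using abs_ge_zero order_trans by blast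
  define q where "q n x = (F (x + h n *\<^sub>R ?e) - F x) / h n" for n x
  have [measurable]: "q n \<in> borel_measurable borel" for n
    unfolding q_def[abs_def] by measurable
  \<comment> \<open>Steps of length at most 1 keep the shifted supports inside (-2,2)^3, which
    carries the dominating function.\<close>
  have far: "F (x + t *\<^sub>R ?e) = 0" if "x \<notin> box (-2) 2" "0 \<le> t" "t \<le> 1" for x t
  proof (rule F0, rule notI)
    assume "x + t *\<^sub>R ?e \<in> Omega"
    then have "-1 < x $ i + t * ?e $ i" "x $ i + t * ?e $ i < 1" for i
      by (simp_all add: Omega_def)
    moreover have "0 \<le> t * ?e $ i" "t * ?e $ i \<le> 1" for i using that(2,3) by (simp_all add: axis_def)
    ultimately have "-2 < x $ i \<and> x $ i < 2" for i by (smt (verit))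
    then show False using that(1) by (simp add: mem_box_cart)
  qed
  have Fint: "integrable lborel (\<lambda>x. F (x + t *\<^sub>R ?e))" if "0 \<le> t" "t \<le> 1" for t
  proof -
    have "continuous_on (cbox (-2) 2) (\<lambda>x. F (x + t *\<^sub>R ?e))"
      by (rule continuous_on_compose2[OF F]) (auto intro!: continuous_intros)
    then have "integrable lborel (\<lambda>x. indicator (cbox (-2) 2) x *\<^sub>R F (x + t *\<^sub>R ?e))"
      by (intro borel_integrable_compact compact_cbox)
    moreover have "indicator (cbox (-2) 2) x *\<^sub>R F (x + t *\<^sub>R ?e) = F (x + t *\<^sub>R ?e)" for x
      using far[OF _ that, of x] box_subset_cbox[of "-2" "2 :: real^3"] by (cases "x \<in> box (-2) 2") auto
    ultimately show ?thesis by (simp only:)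
  qed
  have q0: "(LINT x|lborel. q n x) = 0" for n
  proof -
    have "(LINT x|lborel. F (x + h n *\<^sub>R ?e) - F x) = 0"
      using Fint[of 0] Fint[of "h n"] h[of n] lborel_integral_translate[of F "h n *\<^sub>R ?e"] by simp
    then show ?thesis by (simp add: q_def)
  qed
  have "(\<lambda>n. LINT x|lborel. q n x) \<longlonglongrightarrow> (LINT x|lborel. D x)"
  proof (rule integral_dominated_convergence[where w="\<lambda>x. B * indicator (box (-2) 2) x"])
    show "integrable lborel (\<lambda>x::real^3. B * indicator (box (-2) 2) x :: real)"
      by (intro integrable_mult_right integrable_real_indicator emeasure_lborel_box_finite) simp_all
    show "AE x in lborel. (\<lambda>n. q n x) \<longlonglongrightarrow> D x"
    proof (rule AE_I2)
      fix x
      have "((\<lambda>t. (F (x + t *\<^sub>R ?e) - F x) / t) \<longlongrightarrow> D x) (at 0)"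
        using deriv[of x 0] by (simp add: DERIV_def)
      moreover have "filterlim h (at 0) sequentially"
        using h0 h(1) by (auto simp: filterlim_at less_imp_neq[symmetric] intro!: always_eventually)
      ultimately show "(\<lambda>n. q n x) \<longlonglongrightarrow> D x" unfolding q_def by (rule filterlim_compose)
    qed
    show "AE x in lborel. norm (q n x) \<le> B * indicator (box (-2) 2) x" for n
    proof (rule AE_I2)
      fix x
      show "norm (q n x) \<le> B * indicator (box (-2) 2) x"
      proof (cases "x \<in> box (-2) 2")
        case True
        \<comment> \<open>The mean value theorem turns the quotient into a value of
          \<open>D\<close>, which is bounded by \<open>B\<close>.\<close>
        have "\<exists>z>0. z < h n \<and> F (x + h n *\<^sub>R ?e) - F (x + 0 *\<^sub>R ?e) = (h n - 0) * D (x + z *\<^sub>R ?e)"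
          using h(1)[of n] deriv by (intro MVT2) auto
        then obtain z where "F (x + h n *\<^sub>R ?e) - F x = h n * D (x + z *\<^sub>R ?e)" by auto
        then have "q n x = D (x + z *\<^sub>R ?e)" using h(1)[of n] by (simp add: q_def)
        then show ?thesis using True B by simp
      next
        case False
        then show ?thesis using far[of x "h n"] far[of x 0] h[of n] by (simp add: q_def)
      qed
    qed
  qed simp_all
  then show ?thesis by (simp add: q0 LIMSEQ_const_iff)
qed

lemma test_function_zero:
  assumes "\<phi> \<in> test_functions Omega" "x \<notin> Omega"
  shows "\<phi> x = 0" "partial_deriv j \<phi> x = 0"
proof -
  let ?S = "closure {x. \<phi> x \<noteq> 0}"
  have S: "?S \<subseteq> Omega" using assms(1) by (simp add: test_functions_def)
  then have x: "x \<in> - ?S" using assms(2) by auto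
  have zero: "\<phi> y = 0" if "y \<in> - ?S" for y
    using that closure_subset[of "{x. \<phi> x \<noteq> 0}"] by auto
  show "\<phi> x = 0" using x by (rule zero)
  have "((\<lambda>x. 0) has_derivative (\<lambda>h. 0)) (at x)" by simp
  moreover have "open (- ?S)" by (rule open_Compl[OF closed_closure])
  ultimately have "(\<phi> has_derivative (\<lambda>h. 0)) (at x)"
    using x by (rule has_derivative_transform_within_open) (rule zero[symmetric])
  from frechet_derivative_at[OF this, symmetric] show "partial_deriv j \<phi> x = 0"
    by (simp add: partial_deriv_def)
qed

text \<open>The product of \<open>f\<close> and \<open>\<phi>\<close> is differentiable everywhere
  and vanishes off the cube, so its derivative integrates to zero. Classical derivatives of smooth
  functions are thereby weak ones.\<close>

lemma integration_by_parts:
  assumes f: "f \<in> C_infinity" and \<phi>: "\<phi> \<in> test_functions Omega"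
  shows "(LINT x|MO. f x * partial_deriv j \<phi> x) = - (LINT x|MO. partial_deriv j f x * \<phi> x)"
proof -
  have \<phi>': "\<phi> \<in> C_infinity" using \<phi> by (simp add: test_functions_def)
  note cont = C_infinity_continuous[OF f] C_infinity_continuous[OF \<phi>']
    C_infinity_continuous[OF C_infinity_partial_deriv[OF f]] C_infinity_continuous[OF C_infinity_partial_deriv[OF \<phi>']]
  let ?D = "\<lambda>x. partial_deriv j f x * \<phi> x + partial_deriv j \<phi> x * f x"
  have D: "continuous_on UNIV ?D" by (intro continuous_intros cont)
  have "(LINT x|lborel. ?D x) = 0"
    by (rule integral_directional_deriv_zero[where F="\<lambda>x. f x * \<phi> x" and j=j])
       (auto intro!: continuous_intros cont D DERIV_mult C_infinity_DERIV f \<phi>' simp: test_function_zero[OF \<phi>])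
  moreover have "(LINT x|MO. ?D x) = (LINT x|lborel. ?D x)"
    using D by (subst integral_lebesgue_on_borel)
      (auto intro!: Bochner_Integration.integral_cong borel_measurable_continuous_onI
        simp: indicator_def test_function_zero[OF \<phi>])
  moreover have "(LINT x|MO. ?D x) = (LINT x|MO. partial_deriv j f x * \<phi> x) + (LINT x|MO. partial_deriv j \<phi> x * f x)"
    by (intro Bochner_Integration.integral_add continuous_integrable_Omega continuous_intros cont)
  ultimately show ?thesis by (simp add: mult.commute)
qed

lemma C_infinity_has_weak_partial:
  assumes "f \<in> C_infinity"
  shows "has_weak_partial Omega j f (partial_deriv j f)"
  using assms by (simp add: has_weak_partial_def integration_by_parts C_infinity_L2 C_infinity_partial_deriv)

lemma C_infinity_W12: "f \<in> C_infinity \<Longrightarrow> f \<in> W12 Omega"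
  unfolding W12_def using C_infinity_has_weak_partial C_infinity_L2 by blast

section \<open>Calculus of weak derivatives tested on products\<close>

text \<open>A weaker notion than \<open>has_weak_partial\<close>: integrable functions, tested on
  products of bumps. By \<open>fundamental_lemma\<close> it still determines the derivative almost
  everywhere, and it allows each factor of the test function to be varied separately.\<close>

definition pweak :: "3 \<Rightarrow> (real^3 \<Rightarrow> real) \<Rightarrow> (real^3 \<Rightarrow> real) \<Rightarrow> bool" where
  "pweak j f g \<longleftrightarrow> integrable MO f \<and> integrable MO g \<and>
     (\<forall>h. (\<forall>i. h i \<in> bumps) \<longrightarrow>
       (LINT x|MO. f x * tprod (h(j := deriv (h j))) x) = - (LINT x|MO. g x * tprod h x))"

lemma pweakD:
  assumes "pweak j f g" "\<And>i. h i \<in> bumps"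
  shows "(LINT x|MO. f x * tprod (h(j := deriv (h j))) x) = - (LINT x|MO. g x * tprod h x)"
  using assms by (simp add: pweak_def)

lemma pweak_integrable: "pweak j f g \<Longrightarrow> integrable MO f" "pweak j f g \<Longrightarrow> integrable MO g"
  by (simp_all add: pweak_def)

lemma pweak_of_weak:
  assumes "has_weak_partial Omega j f g" shows "pweak j f g"
  unfolding pweak_def
proof (intro conjI allI impI)
  show "integrable MO f" "integrable MO g"
    using assms by (simp_all add: has_weak_partial_def L2_integrable[OF finite_measure_Omega])
  fix h :: "3 \<Rightarrow> real \<Rightarrow> real" assume h: "\<forall>i. h i \<in> bumps"
  then have "(LINT x|MO. f x * partial_deriv j (tprod h) x) = - (LINT x|MO. g x * tprod h x)"
    using assms tprod_test_function[of h] by (simp add: has_weak_partial_def)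
  then show "(LINT x|MO. f x * tprod (h(j := deriv (h j))) x) = - (LINT x|MO. g x * tprod h x)"
    using h by (simp add: tprod_partial_deriv bumps_smooth)
qed

lemma pweak_C_infinity: "f \<in> C_infinity \<Longrightarrow> pweak j f (partial_deriv j f)"
  by (intro pweak_of_weak C_infinity_has_weak_partial)

lemma bumps_integrable_mult_tprod:
  assumes "integrable MO w" "\<And>i. g i \<in> bumps"
  shows "integrable MO (\<lambda>x. w x * tprod g x)"
proof -
  have "\<forall>i. \<exists>B. \<forall>t. \<bar>g i t\<bar> \<le> B" using bumps_bounded[OF assms(2)] by metis
  then obtain B where B: "\<bar>g i t\<bar> \<le> B i" for i t by metis
  have "\<bar>g i t\<bar> \<le> Max (range B)" for i t
    using B[of i t] by (rule order_trans) simp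
  then show ?thesis using assms by (intro integrable_mult_tprod) (simp_all add: smooth_measurable bumps_smooth)
qed

lemma pweak_lincomb:
  assumes "pweak j f g" "pweak j f' g'"
  shows "pweak j (\<lambda>x. f x + c * f' x) (\<lambda>x. g x + c * g' x)"
  unfolding pweak_def
proof (intro conjI allI impI)
  fix h :: "3 \<Rightarrow> real \<Rightarrow> real" assume h: "\<forall>i. h i \<in> bumps"
  have h': "(h(j := deriv (h j))) i \<in> bumps" for i using h by (simp add: bumps_deriv)
  note [simp] = bumps_integrable_mult_tprod[OF pweak_integrable(1)[OF assms(1)] h']
    bumps_integrable_mult_tprod[OF pweak_integrable(1)[OF assms(2)] h']
    bumps_integrable_mult_tprod[OF pweak_integrable(2)[OF assms(1)] h[rule_format]]
    bumps_integrable_mult_tprod[OF pweak_integrable(2)[OF assms(2)] h[rule_format]]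
  show "(LINT x|MO. (f x + c * f' x) * tprod (h(j := deriv (h j))) x) = - (LINT x|MO. (g x + c * g' x) * tprod h x)"
    using pweakD[OF assms(1), of h] pweakD[OF assms(2), of h] h
    by (simp add: distrib_right mult.assoc)
qed (use assms in \<open>auto simp: pweak_def\<close>)

lemma pweak_cong_AE:
  assumes "pweak j f g" "AE x in MO. f x = f' x" "AE x in MO. g x = g' x"
    "f' \<in> borel_measurable MO" "g' \<in> borel_measurable MO"
  shows "pweak j f' g'"
proof -
  have [measurable]: "f \<in> borel_measurable MO" "g \<in> borel_measurable MO"
    "f' \<in> borel_measurable MO" "g' \<in> borel_measurable MO"
    using assms by (auto simp: pweak_def)
  have "integrable MO f'" "integrable MO g'"
    using assms integrable_cong_AE[of f MO f'] integrable_cong_AE[of g MO g'] by (auto simp: pweak_def)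
  moreover have "(LINT x|MO. f' x * tprod h x) = (LINT x|MO. f x * tprod h x)"
    "(LINT x|MO. g' x * tprod h x) = (LINT x|MO. g x * tprod h x)" if "\<And>i. h i \<in> bumps" for h
  proof -
    have [measurable]: "tprod h \<in> borel_measurable MO"
      using that by (intro borel_measurable_lebesgue_onI tprod_measurable smooth_measurable bumps_smooth)
    show "(LINT x|MO. f' x * tprod h x) = (LINT x|MO. f x * tprod h x)"
      using assms(2) by (intro integral_cong_AE) auto
    show "(LINT x|MO. g' x * tprod h x) = (LINT x|MO. g x * tprod h x)"
      using assms(3) by (intro integral_cong_AE) auto
  qed
  ultimately show ?thesis using assms(1) by (simp add: pweak_def bumps_deriv)
qed

lemma AE_eqI_bumps:
  assumes "integrable MO f" "integrable MO g"
    and "\<And>h. (\<And>i. h i \<in> bumps) \<Longrightarrow> (LINT x|MO. f x * tprod h x) = (LINT x|MO. g x * tprod h x)"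
  shows "AE x in MO. f x = g x"
proof -
  have "AE x in MO. f x - g x = 0"
    by (rule fundamental_lemma) (use assms in \<open>auto simp: left_diff_distrib bumps_integrable_mult_tprod\<close>)
  then show ?thesis by simp
qed

lemma pweak_unique:
  assumes "pweak j f g" "pweak j f g'" shows "AE x in MO. g x = g' x"
proof (rule AE_eqI_bumps)
  fix h :: "3 \<Rightarrow> real \<Rightarrow> real" assume "\<And>i. h i \<in> bumps"
  then show "(LINT x|MO. g x * tprod h x) = (LINT x|MO. g' x * tprod h x)"
    using pweakD[OF assms(1), of h] pweakD[OF assms(2), of h] by simp
qed (use assms in \<open>auto simp: pweak_def\<close>)

text \<open>Either order of differentiation puts the same two derivatives on the test function. It
  is applied with \<open>k\<close> and \<open>m\<close> zero: if \<open>f\<close> does not depend on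
  coordinate \<open>i\<close>, neither does its derivative \<open>g\<close>.\<close>

lemma pweak_commute:
  assumes "pweak j f g" "pweak i f k" "pweak j k m" shows "pweak i g m"
  unfolding pweak_def
proof (intro conjI allI impI)
  fix h :: "3 \<Rightarrow> real \<Rightarrow> real" assume h: "\<forall>i. h i \<in> bumps"
  let ?hi = "h(i := deriv (h i))" and ?hj = "h(j := deriv (h j))"
  have "\<forall>l. ?hi l \<in> bumps" "\<forall>l. ?hj l \<in> bumps" using h by (simp_all add: bumps_deriv)
  then have "- (LINT x|MO. g x * tprod ?hi x) = (LINT x|MO. f x * tprod (?hi(j := deriv (?hi j))) x)"
    and "(LINT x|MO. f x * tprod (?hj(i := deriv (?hj i))) x) = - (LINT x|MO. k x * tprod ?hj x)"
    using pweakD[OF assms(1), of ?hi] pweakD[OF assms(2), of ?hj] by simp_all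
  moreover have "?hi(j := deriv (?hi j)) = ?hj(i := deriv (?hj i))"
    by (auto simp: fun_eq_iff)
  moreover have "(LINT x|MO. k x * tprod ?hj x) = - (LINT x|MO. m x * tprod h x)"
    using pweakD[OF assms(3), of h] h by simp
  ultimately show "(LINT x|MO. g x * tprod ?hi x) = - (LINT x|MO. m x * tprod h x)" by simp
qed (use assms in \<open>auto simp: pweak_def\<close>)

section \<open>Bounded limits of bumps as test factors\<close>

text \<open>The factors reached from bumps by dominated convergence. Bound and convergence are
  required on (-1,1) only, which is all the integrals see; otherwise nonzero constants would be
  excluded.\<close>

definition blimit :: "(real \<Rightarrow> real) \<Rightarrow> bool" where
  "blimit h \<longleftrightarrow> h \<in> borel_measurable borel \<and> (\<exists>s B. (\<forall>n. s n \<in> bumps) \<and>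
     (\<forall>t\<in>{-1<..<1}. \<bar>h t\<bar> \<le> B \<and> (\<forall>n. \<bar>s n t\<bar> \<le> B) \<and> (\<lambda>n. s n t) \<longlonglongrightarrow> h t))"

lemma blimit_bumps: assumes "h \<in> bumps" shows "blimit h"
proof -
  obtain B where "\<And>t. \<bar>h t\<bar> \<le> B" using bumps_bounded[OF assms] by blast
  then show ?thesis using assms
    by (auto simp: blimit_def smooth_measurable bumps_smooth intro!: exI[of _ "\<lambda>_. h"] exI[of _ B])
qed

lemma blimit_smooth_indicator:
  assumes h: "h \<in> smooth" and pq: "-1 \<le> p" "q \<le> 1"
  shows "blimit (\<lambda>t. h t * indicator {p<..<q} t)"
proof -
  have [measurable]: "h \<in> borel_measurable borel" using h by (rule smooth_measurable)
  have "compact (h ` {-1..1})" by (intro compact_continuous_image smooth_continuous h compact_Icc)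
  then obtain B where B: "\<And>t. t \<in> {-1..1} \<Longrightarrow> \<bar>h t\<bar> \<le> B"
    by (force dest!: compact_imp_bounded simp: bounded_iff)
  have 1: "\<bar>h t * c\<bar> \<le> B" if "0 \<le> c" "c \<le> 1" "t \<in> {-1<..<1}" for c t
    using B[of t] that mult_mono[of "\<bar>h t\<bar>" B "c" 1] abs_ge_zero[of "h t"]
    by (simp add: abs_mult)
  show ?thesis unfolding blimit_def
  proof (intro conjI exI[of _ "\<lambda>n t. h t * bump_seq p q n t"] exI[of _ B] allI ballI)
    show "(\<lambda>t. h t * bump_seq p q n t) \<in> bumps" for n
      by (rule bumps_mult[OF h bump_seq_bumps[OF pq]])
  qed (use 1 bump_seq_bounds in \<open>auto intro!: tendsto_mult bump_seq_tendsto simp: indicator_le_1\<close>)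
qed

lemma blimit_cong:
  assumes "blimit h" "\<And>t. t \<in> {-1<..<1} \<Longrightarrow> h t = h' t" "h' \<in> borel_measurable borel"
  shows "blimit h'"
  using assms unfolding blimit_def by metis

lemma blimit_smooth: "h \<in> smooth \<Longrightarrow> blimit h"
  by (rule blimit_cong[OF blimit_smooth_indicator[of h "-1" 1]]) (auto intro: smooth_measurable)

lemma blimit_const [simp]: "blimit (\<lambda>_. c)" by (simp add: blimit_smooth)

lemma blimit_indicator: "-1 \<le> p \<Longrightarrow> q \<le> 1 \<Longrightarrow> blimit (indicator {p<..<q})"
  using blimit_smooth_indicator[of "\<lambda>_. 1" p q] by simp

lemma blimit_integrable_mult_tprod:
  assumes "integrable MO w" "\<And>i. blimit (g i)"
  shows "integrable MO (\<lambda>x. w x * tprod g x)"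
proof -
  have "\<forall>i. \<exists>B. \<forall>t\<in>{-1<..<1}. \<bar>g i t\<bar> \<le> B" using assms(2) unfolding blimit_def by blast
  then obtain B where B: "\<And>i t. t \<in> {-1<..<1} \<Longrightarrow> \<bar>g i t\<bar> \<le> B i" by metis
  have "\<bar>g i t\<bar> \<le> Max (range B)" if "t \<in> {-1<..<1}" for i t
    using B[OF that, of i] by (rule order_trans) simp
  then show ?thesis using assms by (intro integrable_mult_tprod) (auto simp: blimit_def)
qed

lemma tprod_limit':
  fixes g :: "nat \<Rightarrow> 3 \<Rightarrow> real \<Rightarrow> real"
  assumes "integrable MO w"
    and "\<And>n i. g n i \<in> borel_measurable borel" "\<And>i. h i \<in> borel_measurable borel"
    and bound: "\<And>n i t. t \<in> {-1<..<1} \<Longrightarrow> \<bar>g n i t\<bar> \<le> B i"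
    and "\<And>i t. t \<in> {-1<..<1} \<Longrightarrow> (\<lambda>n. g n i t) \<longlonglongrightarrow> h i t"
  shows "(\<lambda>n. LINT x|MO. w x * tprod (g n) x) \<longlonglongrightarrow> (LINT x|MO. w x * tprod h x)"
proof (rule tprod_limit[OF assms(1-3)])
  show "\<bar>g n i t\<bar> \<le> Max (range B)" if "t \<in> {-1<..<1}" for n i t
    using bound[OF that, of n i] by (rule order_trans) simp
qed (use assms in auto)

text \<open>Dominated convergence in every factor except the \<open>j\<close>-th. That one is
  differentiated, and without compact support it would produce boundary terms.\<close>

lemma pweak_blimit:
  assumes pw: "pweak j f g" and hj: "h j \<in> bumps" and h: "\<And>i. i \<noteq> j \<Longrightarrow> blimit (h i)"
  shows "(LINT x|MO. f x * tprod (h(j := deriv (h j))) x) = - (LINT x|MO. g x * tprod h x)"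
proof -
  have "\<forall>i. i \<noteq> j \<longrightarrow> (\<exists>s B. (\<forall>n. s n \<in> bumps) \<and>
     (\<forall>t\<in>{-1<..<1}. \<bar>h i t\<bar> \<le> B \<and> (\<forall>n. \<bar>s n t\<bar> \<le> B) \<and> (\<lambda>n. s n t) \<longlonglongrightarrow> h i t))"
    using h unfolding blimit_def by blast
  then obtain s B where s: "\<And>i n. i \<noteq> j \<Longrightarrow> s i n \<in> bumps"
    and sB: "\<And>i n t. i \<noteq> j \<Longrightarrow> t \<in> {-1<..<1} \<Longrightarrow> \<bar>s i n t\<bar> \<le> B i"
    and slim: "\<And>i t. i \<noteq> j \<Longrightarrow> t \<in> {-1<..<1} \<Longrightarrow> (\<lambda>n. s i n t) \<longlonglongrightarrow> h i t"
    by metis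
  obtain C where C: "\<And>t. \<bar>h j t\<bar> \<le> C" using bumps_bounded[OF hj] by blast
  obtain C' where C': "\<And>t. \<bar>deriv (h j) t\<bar> \<le> C'" using bumps_bounded[OF bumps_deriv[OF hj]] by blast
  define G where "G n i = (if i = j then h j else s i n)" for n i
  have G: "G n i \<in> bumps" for n i using s hj by (simp add: G_def)
  have hm: "h i \<in> borel_measurable borel" for i
    using h[of i] hj by (cases "i = j") (auto simp: blimit_def smooth_measurable bumps_smooth)
  note meas = smooth_measurable[OF bumps_smooth]
  have Gj: "G n j = h j" and Gi: "i \<noteq> j \<Longrightarrow> G n i = s i n" for n i by (simp_all add: G_def)
  have 1: "(\<lambda>n. LINT x|MO. g x * tprod (G n) x) \<longlonglongrightarrow> (LINT x|MO. g x * tprod h x)"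
  proof (rule tprod_limit'[where B="B(j := C)"])
    fix n i t assume t: "t \<in> {-1<..<1::real}"
    show "\<bar>G n i t\<bar> \<le> (B(j := C)) i" using sB[OF _ t] C by (cases "i = j") (simp_all add: Gj Gi)
    show "(\<lambda>n. G n i t) \<longlonglongrightarrow> h i t" using slim[OF _ t] by (cases "i = j") (simp_all add: Gj Gi)
  qed (use pweak_integrable[OF pw] meas[OF G] hm in simp_all)
  have 2: "(\<lambda>n. LINT x|MO. f x * tprod ((G n)(j := deriv (G n j))) x)
      \<longlonglongrightarrow> (LINT x|MO. f x * tprod (h(j := deriv (h j))) x)"
  proof (rule tprod_limit'[where B="B(j := C')"])
    fix n i t
    show "((G n)(j := deriv (G n j))) i \<in> borel_measurable borel" "(h(j := deriv (h j))) i \<in> borel_measurable borel"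
      using meas[OF G] meas[OF bumps_deriv[OF hj]] hm by (simp_all add: Gj)
    assume t: "t \<in> {-1<..<1::real}"
    show "\<bar>((G n)(j := deriv (G n j))) i t\<bar> \<le> (B(j := C')) i"
      using sB[OF _ t] C' by (cases "i = j") (simp_all add: Gj Gi)
    show "(\<lambda>n. ((G n)(j := deriv (G n j))) i t) \<longlonglongrightarrow> (h(j := deriv (h j))) i t"
      using slim[OF _ t] by (cases "i = j") (simp_all add: Gj Gi)
  qed (use pweak_integrable[OF pw] in simp_all)
  have "(LINT x|MO. f x * tprod ((G n)(j := deriv (G n j))) x) = - (LINT x|MO. g x * tprod (G n) x)" for n
    by (rule pweakD[OF pw G])
  then show ?thesis using LIMSEQ_unique[OF 2] tendsto_minus[OF 1] by simp
qed

section \<open>Functions independent of a coordinate; zero gradient\<close>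

definition int1 :: "(real \<Rightarrow> real) \<Rightarrow> real" where
  "int1 h = (LINT t|lebesgue_on {-1<..<1}. h t)"

interpretation I1: finite_measure "lebesgue_on {-1<..<1::real}"
  by (rule finite_measure_lebesgue_on) simp

lemma blimit_integrable: assumes "blimit h" shows "integrable (lebesgue_on {-1<..<1}) h"
proof -
  obtain B where "\<And>t. t \<in> {-1<..<1} \<Longrightarrow> \<bar>h t\<bar> \<le> B" using assms unfolding blimit_def by blast
  then show ?thesis using assms
    by (intro I1.integrable_const_bound[where B=B] AE_I2) (auto simp: blimit_def borel_measurable_lebesgue_onI)
qed

lemma int1_eq_integral: assumes "h \<in> smooth" shows "int1 h = integral {-1..1} h"
  using lebesgue_integral_eq_integral[OF blimit_integrable[OF blimit_smooth[OF assms]]]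
  by (simp add: int1_def fmeasurableD integral_open_interval_real)

lemma int1_const: "int1 (\<lambda>_. c) = 2 * c"
  using int1_eq_integral[of "\<lambda>_. c"] by simp

lemma normalised_bump: obtains a where "a \<in> bumps" "int1 a = 1"
proof -
  let ?b = "bump_seq (-1) 1 1"
  have b: "?b \<in> bumps" by (rule bump_seq_bumps) simp_all
  have "int1 ?b \<noteq> 0"
  proof
    assume "int1 ?b = 0"
    then have "integral {-1..1} ?b = 0" using int1_eq_integral[OF bumps_smooth[OF b]] by simp
    then have "?b 0 = 0"
      using integral_eq_0_iff[of "-1" 1 ?b] smooth_continuous[OF bumps_smooth[OF b]] bump_seq_bounds by auto
    then show False by (simp add: bump_seq_def flat_fun_def)
  qed
  moreover have "int1 (\<lambda>t. (1 / int1 ?b) * ?b t) = (1 / int1 ?b) * int1 ?b"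
    unfolding int1_def by (rule integral_mult_right_zero)
  ultimately have "int1 (\<lambda>t. (1 / int1 ?b) * ?b t) = 1" by simp
  moreover have "(\<lambda>t. (1 / int1 ?b) * ?b t) \<in> bumps" by (rule bumps_mult[OF smooth_const b])
  ultimately show ?thesis using that by blast
qed

lemma tprod_upd_lincomb:
  "tprod (h(j := \<lambda>t. a t + c * b t)) x = tprod (h(j := a)) x + c * tprod (h(j := b)) x"
  by (simp add: tprod_upd distrib_right)

text \<open>Subtracting from a bump the multiple of a fixed normalised bump with the same integral
  leaves mean zero, hence the derivative of a bump, against which \<open>w\<close> integrates to
  zero. The pairing is therefore proportional to the integral of the factor; comparison with the
  constant 1, of integral 2, gives the constant of proportionality. This is the working form of
  "\<open>w\<close> does not depend on \<open>x $ j\<close>".\<close>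

lemma pweak_zero_average:
  assumes pw: "pweak j w (\<lambda>_. 0)" and h: "\<And>i. blimit (h i)"
  shows "(LINT x|MO. w x * tprod h x) = int1 (h j) / 2 * (LINT x|MO. w x * tprod (h(j := \<lambda>_. 1)) x)"
proof -
  note w = pweak_integrable(1)[OF pw]
  obtain a0 where a0: "a0 \<in> bumps" "int1 a0 = 1" using normalised_bump by blast
  define W where "W a = (LINT x|MO. w x * tprod (h(j := a)) x)" for a
  have W_bump: "W a = int1 a * W a0" if a: "a \<in> bumps" for a
  proof -
    let ?d = "\<lambda>t. a t + (- int1 a) * a0 t"
    have d: "?d \<in> bumps" by (intro bumps_add bumps_mult smooth_const a a0)
    have "int1 ?d = int1 a + (- int1 a) * int1 a0"
      unfolding int1_def using blimit_integrable blimit_bumps a a0(1)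
      by (subst Bochner_Integration.integral_add) auto
    then have "integral {-1..1} ?d = 0"
      using int1_eq_integral[OF bumps_smooth[OF d]] a0 by simp
    then obtain A where A: "A \<in> bumps" "deriv A = ?d" using bumps_primitive[OF d] by blast
    have "W ?d = 0"
      using pweak_blimit[OF pw, of "h(j := A)"] A h by (simp add: W_def)
    moreover have "W ?d = W a + (- int1 a) * W a0"
    proof -
      have int: "integrable MO (\<lambda>x. w x * tprod (h(j := b)) x)" if "b \<in> bumps" for b
        using h that by (intro blimit_integrable_mult_tprod w) (simp add: blimit_bumps)
      have "W ?d = (LINT x|MO. w x * tprod (h(j := a)) x + (- int1 a) * (w x * tprod (h(j := a0)) x))"
        unfolding W_def tprod_upd_lincomb by (simp only: distrib_left mult.left_commute)
      also have "\<dots> = W a + (- int1 a) * W a0"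
        unfolding W_def using int[OF a] int[OF a0(1)]
        by (subst Bochner_Integration.integral_add) simp_all
      finally show ?thesis .
    qed
    ultimately show ?thesis by simp
  qed
  \<comment> \<open>Pairing and integral both pass to bounded limits, so the proportionality extends
    beyond bumps.\<close>
  have W_blimit: "W b = int1 b * W a0" if b: "blimit b" for b
  proof -
    obtain s B where s: "\<And>n. s n \<in> bumps" and B: "\<And>t n. t \<in> {-1<..<1} \<Longrightarrow> \<bar>s n t\<bar> \<le> B"
      and lim: "\<And>t. t \<in> {-1<..<1} \<Longrightarrow> (\<lambda>n. s n t) \<longlonglongrightarrow> b t"
      using b unfolding blimit_def by blast
    have "\<exists>B. \<forall>t\<in>{-1<..<1}. \<bar>h i t\<bar> \<le> B" for i using h unfolding blimit_def by blast
    then obtain C where C: "\<And>i t. t \<in> {-1<..<1} \<Longrightarrow> \<bar>h i t\<bar> \<le> C i" by metis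
    have bm: "b \<in> borel_measurable borel" "\<And>i. h i \<in> borel_measurable borel"
      using b h by (simp_all add: blimit_def)
    have 1: "(\<lambda>n. W (s n)) \<longlonglongrightarrow> W b" unfolding W_def
    proof (rule tprod_limit'[where B="C(j := B)"])
      fix n i t
      show "(h(j := s n)) i \<in> borel_measurable borel" "(h(j := b)) i \<in> borel_measurable borel"
        using bm s by (simp_all add: smooth_measurable bumps_smooth)
      assume t: "t \<in> {-1<..<1::real}"
      show "\<bar>(h(j := s n)) i t\<bar> \<le> (C(j := B)) i" using B[OF t] C[OF t] by simp
      show "(\<lambda>n. (h(j := s n)) i t) \<longlonglongrightarrow> (h(j := b)) i t" using lim[OF t] by simp
    qed (rule w)
    have "(\<lambda>n. int1 (s n)) \<longlonglongrightarrow> int1 b" unfolding int1_def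
    proof (rule integral_dominated_convergence[where w="\<lambda>_. B"])
      show "b \<in> borel_measurable (lebesgue_on {-1<..<1})" "s n \<in> borel_measurable (lebesgue_on {-1<..<1})" for n
        using bm s by (simp_all add: borel_measurable_lebesgue_onI smooth_measurable bumps_smooth)
    qed (use B lim in \<open>auto intro!: AE_I2\<close>)
    then have "(\<lambda>n. int1 (s n) * W a0) \<longlonglongrightarrow> int1 b * W a0" by (intro tendsto_intros)
    then show ?thesis using LIMSEQ_unique[OF 1] W_bump[OF s] by simp
  qed
  have "W (\<lambda>_. 1) = 2 * W a0" using W_blimit[of "\<lambda>_. 1"] by (simp add: int1_const)
  moreover have "(LINT x|MO. w x * tprod h x) = W (h j)" by (simp add: W_def)
  ultimately show ?thesis using W_blimit[OF h[of j]] by (simp add: W_def)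
qed

definition t3 :: "'a \<Rightarrow> 'a \<Rightarrow> 'a \<Rightarrow> 3 \<Rightarrow> 'a" where
  "t3 a b c i = (if i = 1 then a else if i = 2 then b else c)"

lemma t3_simps [simp]: "t3 a b c 1 = a" "t3 a b c 2 = b" "t3 a b c 3 = c"
  by (simp_all add: t3_def)

lemma t3_collapse: "t3 (h 1) (h 2) (h 3) = h"
  by (simp add: fun_eq_iff forall_3)

lemma t3_upd [simp]:
  "(t3 a b c)(1 := d) = t3 d b c" "(t3 a b c)(2 := d) = t3 a d c" "(t3 a b c)(3 := d) = t3 a b d"
  by (simp_all add: fun_eq_iff forall_3)

lemma tprod_t3: "tprod (t3 a b c) x = a (x $ 1) * b (x $ 2) * c (x $ 3)"
  unfolding tprod_def UNIV_3 by (simp add: mult.assoc)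

lemma pweak_const: "pweak j (\<lambda>_. c) (\<lambda>_. 0)"
proof -
  have "t3 (\<lambda>_. c) (\<lambda>_. 1) (\<lambda>_. 1) i \<in> smooth" for i by (simp add: t3_def)
  then have "tprod (t3 (\<lambda>_. c) (\<lambda>_. 1) (\<lambda>_. 1)) \<in> C_infinity" by (rule tprod_C_infinity)
  moreover have "tprod (t3 (\<lambda>_. c) (\<lambda>_. 1) (\<lambda>_. 1)) = (\<lambda>_. c)" by (simp add: tprod_t3 fun_eq_iff)
  ultimately have "(\<lambda>_::real^3. c) \<in> C_infinity" by simp
  from pweak_C_infinity[OF this, of j]
  show ?thesis by (simp add: partial_deriv_def[abs_def])
qed

text \<open>Each direction contributes half the integral of its factor; the total 1/8 is the
  reciprocal of the volume of the cube.\<close>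

lemma all_pweak_zero_integral:
  assumes w: "\<And>j. pweak j w (\<lambda>_. 0)" and h: "\<And>i. blimit (h i)"
  shows "(LINT x|MO. w x * tprod h x) = (int1 (h 1) * int1 (h 2) * int1 (h 3)) / 8 * (LINT x|MO. w x)"
proof -
  obtain a b c where h_eq: "h = t3 a b c" using t3_collapse by metis
  have abc: "blimit a" "blimit b" "blimit c"
    using h[of 1] h[of 2] h[of 3] by (simp_all add: h_eq)
  have t3: "blimit (t3 f g k i)" if "blimit f" "blimit g" "blimit k" for f g k i
    using that by (simp add: t3_def)
  have "(LINT x|MO. w x * tprod (t3 a b c) x) = int1 a / 2 * (LINT x|MO. w x * tprod (t3 (\<lambda>_. 1) b c) x)"
    using pweak_zero_average[OF w[of 1], of "t3 a b c"] t3 abc by simp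
  also have "(LINT x|MO. w x * tprod (t3 (\<lambda>_. 1) b c) x) = int1 b / 2 * (LINT x|MO. w x * tprod (t3 (\<lambda>_. 1) (\<lambda>_. 1) c) x)"
    using pweak_zero_average[OF w[of 2], of "t3 (\<lambda>_. 1) b c"] t3 abc by simp
  also have "(LINT x|MO. w x * tprod (t3 (\<lambda>_. 1) (\<lambda>_. 1) c) x) = int1 c / 2 * (LINT x|MO. w x * tprod (t3 (\<lambda>_. 1) (\<lambda>_. 1) (\<lambda>_. 1)) x)"
    using pweak_zero_average[OF w[of 3], of "t3 (\<lambda>_. 1) (\<lambda>_. 1) c"] t3 abc by simp
  finally show ?thesis by (simp add: h_eq tprod_t3)
qed

lemma measure_Omega: "measure MO Omega = 8"
proof -
  have "measure MO Omega = measure lborel (box (-1) (1::real^3))"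
    by (simp add: measure_restrict_space fmeasurableD Omega_eq measure_completion)
  also have "\<dots> = measure lborel (cbox (-1) (1::real^3))"
    by (simp add: measure_lborel_box_eq measure_lborel_cbox_eq)
  also have "\<dots> = 8" by (simp add: content_cbox_if_cart interval_eq_empty_cart)
  finally show ?thesis .
qed

text \<open>The constant 1 has zero gradient, so the factorisation of the integral is an instance of
  the preceding averaging.\<close>

lemma tprod_integral:
  assumes "\<And>i. blimit (h i)"
  shows "(LINT x|MO. tprod h x) = int1 (h 1) * int1 (h 2) * int1 (h 3)"
  using all_pweak_zero_integral[OF pweak_const[of _ 1] assms] measure_Omega by simp

text \<open>The function and its mean value have the same pairing with every product of
  bumps.\<close>

lemma all_pweak_zero_const:
  assumes "\<And>j. pweak j w (\<lambda>_. 0)" obtains c where "AE x in MO. w x = c"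
proof -
  have "AE x in MO. w x = (LINT x|MO. w x) / 8"
  proof (rule AE_eqI_bumps)
    fix h :: "3 \<Rightarrow> real \<Rightarrow> real" assume h: "\<And>i. h i \<in> bumps"
    show "(LINT x|MO. w x * tprod h x) = (LINT x|MO. (LINT x|MO. w x) / 8 * tprod h x)"
      using all_pweak_zero_integral[OF assms blimit_bumps[OF h]] tprod_integral[OF blimit_bumps[OF h]] by simp
  qed (use pweak_integrable[OF assms] in auto)
  then show ?thesis by (rule that)
qed

subsection \<open>Traces on opposite faces\<close>

abbreviation "square \<equiv> {-1<..<1} \<times> {-1<..<1::real} :: (real \<times> real) set"

text \<open>The coordinates on the pair of faces \<open>x $ j = \<plusminus>1\<close>, moved along the \<open>j\<close>-th axis, sweep out the cube.\<close>

definition face_param :: "3 \<Rightarrow> (real \<Rightarrow> real \<times> real \<Rightarrow> real^3) \<Rightarrow> bool" where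
  "face_param j P \<longleftrightarrow> continuous_on UNIV (\<lambda>(y, t). P t y) \<and>
     distr lborel borel (\<lambda>(y, t). P t y) = lborel \<and>
     (\<forall>t y. P t y \<in> Omega \<longleftrightarrow> y \<in> square \<and> t \<in> {-1<..<1}) \<and>
     (\<forall>t y. P t y = P 0 y + t *\<^sub>R axis j 1) \<and> (\<forall>y. P 0 y $ j = 0)"

lemma prod_Basis_cart3: "(\<Prod>b\<in>Basis. (x::real^3) \<bullet> b) = x $ 1 * x $ 2 * x $ 3"
proof -
  have "(Basis :: (real^3) set) = {axis 1 1, axis 2 1, axis 3 1}"
    unfolding Basis_vec_def by (auto simp: UNIV_3)
  then have "(\<Prod>b\<in>Basis. x \<bullet> b) = (\<Prod>b\<in>{axis 1 1, axis 2 1, axis 3 1}. x \<bullet> b)" by (rule arg_cong)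
  moreover have "axis 1 1 \<noteq> (axis 2 1 :: real^3)" "axis 1 1 \<noteq> (axis 3 1 :: real^3)" "axis 2 1 \<noteq> (axis 3 1 :: real^3)"
    by (simp_all add: axis_eq_axis)
  ultimately have "(\<Prod>b\<in>Basis. x \<bullet> b) = x \<bullet> axis 1 1 * (x \<bullet> axis 2 1 * (x \<bullet> axis 3 1))"
    by simp
  then show ?thesis by (simp add: inner_axis mult.assoc)
qed

lemma emeasure_lborel_box3:
  "l1 \<le> u1 \<Longrightarrow> l2 \<le> u2 \<Longrightarrow> l3 \<le> u3 \<Longrightarrow>
    emeasure lborel (box ((l1, l2), l3) ((u1, u2), u3 :: real) :: ((real \<times> real) \<times> real) set)
    = ennreal ((u1 - l1) * (u2 - l2) * (u3 - l3))"
proof -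
  assume le: "l1 \<le> u1" "l2 \<le> u2" "l3 \<le> u3"
  have "box ((l1, l2), l3) ((u1, u2), u3) = (box l1 u1 \<times> box l2 u2) \<times> box l3 u3"
    by (simp add: box_prod)
  then have "emeasure lborel (box ((l1, l2), l3) ((u1, u2), u3)) =
      emeasure lborel (box l1 u1) * emeasure lborel (box l2 u2) * emeasure lborel (box l3 u3)"
    by (simp add: lborel_prod[symmetric] lborel.emeasure_pair_measure_Times del: box_real)
  then show ?thesis using le by (simp add: ennreal_mult)
qed

lemma continuous_on_t3:
  "continuous_on S f \<Longrightarrow> continuous_on S g \<Longrightarrow> continuous_on S k \<Longrightarrow> continuous_on S (\<lambda>x. t3 (f x) (g x) (k x) i)"
  using exhaust_3[of i] by auto

lemma face_param_face1: "face_param 1 face1"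
  unfolding face_param_def
proof (intro conjI)
  have eq: "(\<lambda>(y, t). face1 t y) = (\<lambda>p. \<chi> i. t3 (snd p) (fst (fst p)) (snd (fst p)) i)"
    by (auto simp: face1_def fun_eq_iff vec_eq_iff forall_3 vector_3)
  show cont: "continuous_on UNIV (\<lambda>(y, t). face1 t y)"
    unfolding eq by (intro continuous_on_vec_lambda continuous_on_t3 continuous_intros)
  show "distr lborel borel (\<lambda>(y, t). face1 t y) = lborel"
  proof (rule lborel_eqI[symmetric])
    fix l u :: "real^3" assume "\<And>b. b \<in> Basis \<Longrightarrow> l \<bullet> b \<le> u \<bullet> b"
    then have le: "l $ i \<le> u $ i" for i by (simp add: cart_eq_inner_axis)
    have "(\<lambda>(y, t). face1 t y) -` box l u = box ((l $ 2, l $ 3), l $ 1) ((u $ 2, u $ 3), u $ 1)"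
      by (auto simp: face1_def mem_box_cart forall_3 vector_3 box_prod)
    then show "emeasure (distr lborel borel (\<lambda>(y, t). face1 t y)) (box l u) = ennreal (prod ((\<bullet>) (u - l)) Basis)"
      using le emeasure_lborel_box3[of "l $ 2" "u $ 2" "l $ 3" "u $ 3" "l $ 1" "u $ 1"]
      by (subst emeasure_distr) (auto simp: prod_Basis_cart3 mult_ac intro!: borel_measurable_continuous_onI cont)
  qed simp
qed (auto simp: face1_def Omega_def forall_3 vector_3 vec_eq_iff axis_def)

lemma face_param_face3: "face_param 3 face3"
  unfolding face_param_def
proof (intro conjI)
  have eq: "(\<lambda>(y, t). face3 t y) = (\<lambda>p. \<chi> i. t3 (fst (fst p)) (snd (fst p)) (snd p) i)"
    by (auto simp: face3_def fun_eq_iff vec_eq_iff forall_3 vector_3)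
  show cont: "continuous_on UNIV (\<lambda>(y, t). face3 t y)"
    unfolding eq by (intro continuous_on_vec_lambda continuous_on_t3 continuous_intros)
  show "distr lborel borel (\<lambda>(y, t). face3 t y) = lborel"
  proof (rule lborel_eqI[symmetric])
    fix l u :: "real^3" assume "\<And>b. b \<in> Basis \<Longrightarrow> l \<bullet> b \<le> u \<bullet> b"
    then have le: "l $ i \<le> u $ i" for i by (simp add: cart_eq_inner_axis)
    have "(\<lambda>(y, t). face3 t y) -` box l u = box ((l $ 1, l $ 2), l $ 3) ((u $ 1, u $ 2), u $ 3)"
      by (auto simp: face3_def mem_box_cart forall_3 vector_3 box_prod)
    then show "emeasure (distr lborel borel (\<lambda>(y, t). face3 t y)) (box l u) = ennreal (prod ((\<bullet>) (u - l)) Basis)"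
      using le emeasure_lborel_box3[of "l $ 1" "u $ 1" "l $ 2" "u $ 2" "l $ 3" "u $ 3"]
      by (subst emeasure_distr) (auto simp: prod_Basis_cart3 mult_ac intro!: borel_measurable_continuous_onI cont)
  qed simp
qed (auto simp: face3_def Omega_def forall_3 vector_3 vec_eq_iff axis_def)

text \<open>The parametrisation preserves Lebesgue measure, so Fubini applies in face coordinates,
  with the fundamental theorem of calculus along each line parallel to the \<open>j\<close>-th
  axis.\<close>

lemma integral_deriv_cube:
  assumes P: "face_param j P" and F: "continuous_on UNIV F" and D: "continuous_on UNIV D"
    and deriv: "\<And>x t. ((\<lambda>t. F (x + t *\<^sub>R axis j 1)) has_real_derivative D (x + t *\<^sub>R axis j 1)) (at t)"
  shows "(LINT x|MO. D x) = (LINT y|lebesgue_on square. F (P 1 y) - F (P (-1) y))"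
proof -
  let ?T = "\<lambda>(y, t). P t y"
  have T: "continuous_on UNIV ?T" and TL: "distr lborel borel ?T = lborel"
    and inO: "\<And>t y. P t y \<in> Omega \<longleftrightarrow> y \<in> square \<and> t \<in> {-1<..<1}"
    and PP: "\<And>t y. P t y = P 0 y + t *\<^sub>R axis j 1"
    using P unfolding face_param_def by blast+
  have Tm: "?T \<in> borel_measurable borel" using T by (rule borel_measurable_continuous_onI)
  have Dm [measurable]: "D \<in> borel_measurable borel" using D by (rule borel_measurable_continuous_onI)
  have Pt: "continuous_on UNIV (P t)" for t
  proof -
    have "continuous_on UNIV (\<lambda>y. (\<lambda>(y, t). P t y) (y, t))"
      by (rule continuous_on_compose2[OF T]) (intro continuous_intros, simp)
    then show ?thesis by simp
  qed
  have Py: "continuous_on UNIV (\<lambda>t. P t y)" for y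
  proof -
    have "continuous_on UNIV (\<lambda>t. (\<lambda>(y, t). P t y) (y, t))"
      by (rule continuous_on_compose2[OF T]) (intro continuous_intros, simp)
    then show ?thesis by simp
  qed
  have "integrable lborel (\<lambda>x. indicator Omega x * D x)"
    using continuous_integrable_Omega[OF D] by (simp add: integrable_lebesgue_on_borel)
  then have "integrable (distr lborel borel ?T) (\<lambda>x. indicator Omega x * D x)" by (simp only: TL)
  then have int: "integrable (lborel \<Otimes>\<^sub>M lborel) (\<lambda>p. indicator Omega (?T p) * D (?T p))"
    using Tm by (subst (asm) integrable_distr_eq) (simp_all add: lborel_prod)
  have "(LINT x|MO. D x) = (LINT x|distr lborel borel ?T. indicator Omega x * D x)"
    by (simp add: integral_lebesgue_on_borel TL)
  also have "\<dots> = (LINT p|(lborel \<Otimes>\<^sub>M lborel). indicator Omega (?T p) * D (?T p))"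
    using Tm by (subst integral_distr) (simp_all add: lborel_prod)
  also have "\<dots> = (LINT y|lborel. LINT t|lborel. indicator Omega (?T (y, t)) * D (?T (y, t)))"
    by (rule lborel_pair.integral_fst'[OF int, symmetric])
  also have "\<dots> = (LINT y|lborel. indicator square y * (F (P 1 y) - F (P (-1) y)))"
  proof (intro Bochner_Integration.integral_cong refl)
    fix y
    have "(LINT t|lborel. indicator {-1..1} t *\<^sub>R D (P t y)) = F (P 1 y) - F (P (-1) y)"
    proof (rule integral_FTC_atLeastAtMost)
      show "((\<lambda>t. F (P t y)) has_vector_derivative D (P t y)) (at t within {-1..1})" for t
        using deriv[of "P 0 y" t] unfolding PP[of _ y, symmetric]
        by (simp add: has_real_derivative_iff_has_vector_derivative has_vector_derivative_at_within)
      show "continuous_on {-1..1} (\<lambda>t. D (P t y))"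
        by (rule continuous_on_compose2[OF D continuous_on_subset[OF Py]]) auto
    qed simp
    moreover have "(LINT t|lborel. indicator Omega (?T (y, t)) * D (?T (y, t)))
        = (LINT t|lborel. indicator square y * (indicator {-1..1} t *\<^sub>R D (P t y)))"
    proof (rule integral_cong_AE)
      \<comment> \<open>The cube is open while the fundamental theorem uses the closed interval; the
        end points are null.\<close>
      have "AE t in lborel. t \<noteq> (-1::real)" "AE t in lborel. t \<noteq> (1::real)" by (rule AE_lborel_singleton)+
      then show "AE t in lborel. indicator Omega (?T (y, t)) * D (?T (y, t))
          = indicator square y * (indicator {-1..1} t *\<^sub>R D (P t y))"
        by eventually_elim (auto simp: indicator_def inO)
      have [measurable]: "(\<lambda>t. P t y) \<in> borel_measurable borel" using Py by (rule borel_measurable_continuous_onI)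
      show "(\<lambda>t. indicator Omega (?T (y, t)) * D (?T (y, t))) \<in> borel_measurable lborel"
        "(\<lambda>t. indicator square y * (indicator {-1..1} t *\<^sub>R D (P t y))) \<in> borel_measurable lborel"
        by simp_all
    qed
    ultimately show "(LINT t|lborel. indicator Omega (?T (y, t)) * D (?T (y, t)))
        = indicator square y * (F (P 1 y) - F (P (-1) y))" by simp
  qed
  also have "\<dots> = (LINT y|lebesgue_on square. F (P 1 y) - F (P (-1) y))"
    by (rule integral_lebesgue_on_borel[symmetric])
       (intro borel_measurable_continuous_onI continuous_intros continuous_on_compose2[OF F Pt], simp_all add: borel_open open_Times)
  finally show ?thesis .
qed

lemma weak_partial_works:
  assumes "f \<in> W12 S" shows "has_weak_partial S j f (weak_partial S j f)"
proof -
  have "\<exists>g. has_weak_partial S j f g" using assms by (simp add: W12_def)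
  then show ?thesis unfolding weak_partial_def by (rule someI_ex)
qed

lemma weak_partial_AE_eq:
  assumes "f \<in> W12 Omega" "pweak j f g"
  shows "AE x in MO. weak_partial Omega j f x = g x"
  using pweak_unique[OF pweak_of_weak[OF weak_partial_works[OF assms(1)]] assms(2)] .

text \<open>The divergence identity for \<open>v\<close> times a product whose \<open>j\<close>-th
  factor is 1 on the face \<open>s\<close> and 0 on the opposite one, so that a single face integral
  remains, with the outward sign \<open>s\<close>. For the smooth approximations this is calculus;
  each term is an integral against a bounded function and therefore survives L2 convergence.\<close>

lemma face_trace_identity:
  fixes h :: "3 \<Rightarrow> real \<Rightarrow> real"
  assumes P: "face_param j P" and tr: "has_face_trace (P s) v g" and s: "s = 1 \<or> s = -1"
    and D: "pweak j v D" and h: "\<And>i. h i \<in> smooth"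
  shows "(LINT x|MO. D x * tprod (h(j := \<lambda>t. (1 + s * t) / 2)) x) + (LINT x|MO. v x * tprod (h(j := \<lambda>_. s / 2)) x)
    = s * (LINT y|lebesgue_on square. g y * tprod (h(j := \<lambda>_. 1)) (P 0 y))"
proof -
  obtain \<phi> where \<phi>: "\<And>n. \<phi> n \<in> C_infinity" and conv: "W12_converges Omega \<phi> v"
    and convg: "L2_converges (lebesgue_on square) (\<lambda>n. \<phi> n \<circ> P s) g"
    using tr unfolding has_face_trace_def by blast
  have T: "continuous_on UNIV (\<lambda>(y, t). P t y)"
    and inO: "\<And>t y. P t y \<in> Omega \<longleftrightarrow> y \<in> square \<and> t \<in> {-1<..<1}"
    and PP: "\<And>t y. P t y = P 0 y + t *\<^sub>R axis j 1" and P0: "\<And>y. P 0 y $ j = 0"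
    using P unfolding face_param_def by blast+
  have Pt: "continuous_on UNIV (P t)" for t
  proof -
    have "continuous_on UNIV (\<lambda>y. (\<lambda>(y, t). P t y) (y, t))"
      by (rule continuous_on_compose2[OF T]) (intro continuous_intros, simp)
    then show ?thesis by simp
  qed
  define a where "a t = (1 + s * t) / 2" for t
  have "((\<lambda>t. (1 + s * t) / 2) has_real_derivative s / 2) (at t)" for t
    by (auto intro!: derivative_eq_intros)
  then have a: "(a has_real_derivative s / 2) (at t)" for t by (simp add: a_def[abs_def])
  have a_smooth: "a \<in> smooth" by (rule smoothI[OF a]) simp
  have da: "deriv a = (\<lambda>_. s / 2)" using a by (auto intro: DERIV_imp_deriv)
  define q where "q = tprod (h(j := a))"
  define q' where "q' = tprod (h(j := \<lambda>_. s / 2))"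
  define Q where "Q y = tprod (h(j := \<lambda>_. 1)) (P 0 y)" for y
  have "(h(j := a)) i \<in> smooth" for i using h a_smooth by simp
  then have q: "q \<in> C_infinity" unfolding q_def by (rule tprod_C_infinity)
  have q': "partial_deriv j q = q'"
    using h a_smooth unfolding q_def q'_def by (subst tprod_partial_deriv) (simp_all add: da)
  note qc = C_infinity_continuous[OF q] C_infinity_continuous[OF C_infinity_partial_deriv[OF q], of _ j, unfolded q']
  have "(h(j := \<lambda>_. 1)) i \<in> smooth" for i using h by simp
  then have Qc: "continuous_on UNIV (tprod (h(j := \<lambda>_. 1)))"
    by (intro C_infinity_continuous tprod_C_infinity)
  then have Q_cont: "continuous_on UNIV Q" unfolding Q_def
    by (rule continuous_on_compose2[OF _ Pt]) simp
  have q_face: "q (P t y) = a t * Q y" for t y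
    using PP[of t y] P0[of y] by (simp add: q_def Q_def tprod_upd axis_def)
  have key: "(LINT x|MO. partial_deriv j (\<phi> n) x * q x) + (LINT x|MO. \<phi> n x * q' x)
      = s * (LINT y|lebesgue_on square. (\<phi> n \<circ> P s) y * Q y)" for n
  proof -
    note pc = C_infinity_continuous[OF \<phi>[of n]] C_infinity_continuous[OF C_infinity_partial_deriv[OF \<phi>[of n]], of _ j]
    have "(LINT x|MO. partial_deriv j (\<phi> n) x * q x) + (LINT x|MO. \<phi> n x * q' x)
        = (LINT x|MO. partial_deriv j (\<phi> n) x * q x + q' x * \<phi> n x)"
      by (subst Bochner_Integration.integral_add)
         (auto intro!: continuous_integrable_Omega continuous_intros pc qc simp: mult.commute)
    also have "\<dots> = (LINT y|lebesgue_on square. \<phi> n (P 1 y) * q (P 1 y) - \<phi> n (P (-1) y) * q (P (-1) y))"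
    proof (rule integral_deriv_cube[OF P, where F="\<lambda>x. \<phi> n x * q x"])
      show "((\<lambda>t. \<phi> n (x + t *\<^sub>R axis j 1) * q (x + t *\<^sub>R axis j 1)) has_real_derivative
        partial_deriv j (\<phi> n) (x + t *\<^sub>R axis j 1) * q (x + t *\<^sub>R axis j 1) +
        q' (x + t *\<^sub>R axis j 1) * \<phi> n (x + t *\<^sub>R axis j 1)) (at t)" for x t
        using DERIV_mult[OF C_infinity_DERIV[OF \<phi>[of n], where x=x and j=j and t=t] C_infinity_DERIV[OF q, where x=x and j=j and t=t]] by (simp add: q')
    qed (intro continuous_intros pc qc)+
    also have "\<dots> = (LINT y|lebesgue_on square. s * ((\<phi> n \<circ> P s) y * Q y))"
      using s by (intro Bochner_Integration.integral_cong refl) (auto simp: q_face a_def)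
    finally show ?thesis by simp
  qed
  obtain B1 where B1: "\<And>x. x \<in> Omega \<Longrightarrow> \<bar>q x\<bar> \<le> B1" using continuous_bounded_Omega[OF qc(1)] by blast
  obtain B2 where B2: "\<And>x. x \<in> Omega \<Longrightarrow> \<bar>q' x\<bar> \<le> B2" using continuous_bounded_Omega[OF qc(2)] by blast
  obtain B3 where "\<And>x. x \<in> Omega \<Longrightarrow> \<bar>tprod (h(j := \<lambda>_. 1)) x\<bar> \<le> B3" using continuous_bounded_Omega[OF Qc] by blast
  then have B3: "\<And>y. y \<in> square \<Longrightarrow> \<bar>Q y\<bar> \<le> B3" unfolding Q_def using inO[of 0] by auto
  have v: "v \<in> W12 Omega" and "\<And>n. \<phi> n \<in> W12 Omega" 
    and c0: "L2_converges MO \<phi> v"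
    and c1: "L2_converges MO (\<lambda>n. weak_partial Omega j (\<phi> n)) (weak_partial Omega j v)"
    using conv unfolding W12_converges_def by blast+
  have qm: "q \<in> borel_measurable MO" "q' \<in> borel_measurable MO" "Q \<in> borel_measurable (lebesgue_on square)"
    using qc Q_cont by (auto intro!: borel_measurable_lebesgue_onI borel_measurable_continuous_onI)
  have "lebesgue_on square = lebesgue_on (box (-1, -1) (1, 1))" by (simp add: box_prod)
  then have fm: "finite_measure (lebesgue_on square)"
    using finite_measure_lebesgue_on[of "box (-1, -1) (1, 1) :: (real \<times> real) set"] by simp
  \<comment> \<open>Convergence of the derivatives is given for the chosen representatives
    \<open>weak_partial\<close>. Uniqueness replaces them by the classical derivatives of the
    approximations and by \<open>D\<close>.\<close>
  have wp: "(LINT x|MO. weak_partial Omega j f x * q x) = (LINT x|MO. g x * q x)" if "f \<in> W12 Omega" "pweak j f g" for f g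
  proof (rule integral_cong_AE)
    show "AE x in MO. weak_partial Omega j f x * q x = g x * q x"
      using weak_partial_AE_eq[OF that] by eventually_elim simp
    have "integrable MO (weak_partial Omega j f)" "integrable MO g"
      using pweak_integrable(2)[OF pweak_of_weak[OF weak_partial_works[OF that(1)]]] pweak_integrable(2)[OF that(2)] by auto
    then show "(\<lambda>x. weak_partial Omega j f x * q x) \<in> borel_measurable MO" "(\<lambda>x. g x * q x) \<in> borel_measurable MO"
      using qm by auto
  qed
  have l1: "(\<lambda>n. LINT x|MO. partial_deriv j (\<phi> n) x * q x) \<longlonglongrightarrow> (LINT x|MO. D x * q x)"
    using L2_converges_integral[OF finite_measure_Omega c1 qm(1), of B1] B1
    by (simp add: wp[OF v D] wp[OF C_infinity_W12[OF \<phi>] pweak_C_infinity[OF \<phi>]])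
  have l2: "(\<lambda>n. LINT x|MO. \<phi> n x * q' x) \<longlonglongrightarrow> (LINT x|MO. v x * q' x)"
    using L2_converges_integral[OF finite_measure_Omega c0 qm(2), of B2] B2 by simp
  have l3: "(\<lambda>n. LINT y|lebesgue_on square. (\<phi> n \<circ> P s) y * Q y) \<longlonglongrightarrow> (LINT y|lebesgue_on square. g y * Q y)"
    using L2_converges_integral[OF fm convg qm(3), of B3] B3 by simp
  have "(LINT x|MO. D x * q x) + (LINT x|MO. v x * q' x) = s * (LINT y|lebesgue_on square. g y * Q y)"
    using LIMSEQ_unique[OF tendsto_add[OF l1 l2]] tendsto_mult[OF tendsto_const l3, of s] by (simp add: key)
  then show ?thesis by (simp add: q_def q'_def Q_def a_def[abs_def])
qed

lemma pweak_diff: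
  assumes "pweak j f g" "pweak j f' g'"
  shows "pweak j (\<lambda>x. f x - f' x) (\<lambda>x. g x - g' x)"
  using pweak_lincomb[OF assms, of "-1"] by simp

text \<open>The difference \<open>?w\<close> has zero trace on both faces, and its derivative
  \<open>?E\<close> does not depend on the \<open>j\<close>-th coordinate. The identities for
  \<open>s = 1\<close> and \<open>s = -1\<close> are then two linear equations in averages of
  \<open>?E\<close> and \<open>?w\<close>: their sum leaves the average of \<open>?E\<close>
  alone.\<close>

lemma eq_if_face_traces_eq:
  assumes P: "face_param j P"
    and tr: "\<And>s. s \<in> {-1, 1} \<Longrightarrow> has_face_trace (P s) v (g s)" "\<And>s. s \<in> {-1, 1} \<Longrightarrow> has_face_trace (P s) v0 (g s)"
    and D: "pweak j v D" "pweak j D (\<lambda>_. 0)" and D0: "pweak j v0 D0" "pweak j D0 (\<lambda>_. 0)"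
  shows "AE x in MO. v x = v0 x"
proof -
  let ?w = "\<lambda>x. v x - v0 x" and ?E = "\<lambda>x. D x - D0 x"
  have w: "pweak j ?w ?E" by (rule pweak_diff[OF D(1) D0(1)])
  have E: "pweak j ?E (\<lambda>_. 0)" using pweak_diff[OF D(2) D0(2)] by simp
  define E1 Et W where "E1 h = (LINT x|MO. ?E x * tprod (h(j := \<lambda>_. 1)) x)"
    and "Et h = (LINT x|MO. ?E x * tprod (h(j := \<lambda>t. t)) x)"
    and "W h = (LINT x|MO. ?w x * tprod (h(j := \<lambda>_. 1)) x)" for h
  have id: "E1 h + s * Et h + s * W h = 0"
    if s: "s \<in> {-1, 1}" and h: "\<And>i. h i \<in> smooth" for s h
  proof -
    have "(\<lambda>t. (1/2) * (1 + s * t)) \<in> smooth"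
      by (intro smooth_mult smooth_add smooth_const smooth_ident)
    then have sm: "blimit ((h(j := \<lambda>t. (1 + s * t) / 2)) i)" "blimit ((h(j := \<lambda>_. s / 2)) i)" for i
      using h by (simp_all add: blimit_smooth)
    have int: "integrable MO (\<lambda>x. f x * tprod (h(j := \<lambda>t. (1 + s * t) / 2)) x)"
      "integrable MO (\<lambda>x. f x * tprod (h(j := \<lambda>_. s / 2)) x)" if "integrable MO f" for f
      by (intro blimit_integrable_mult_tprod that sm)+
    note int = int(1)[OF pweak_integrable(2)[OF D(1)]] int(1)[OF pweak_integrable(2)[OF D0(1)]]
      int(2)[OF pweak_integrable(1)[OF D(1)]] int(2)[OF pweak_integrable(1)[OF D0(1)]]
    have s': "s = 1 \<or> s = -1" using s by auto
    have *: "(LINT x|MO. ?E x * tprod (h(j := \<lambda>t. (1 + s * t) / 2)) x) + (LINT x|MO. ?w x * tprod (h(j := \<lambda>_. s / 2)) x) = 0"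
      using face_trace_identity[OF P tr(1)[OF s] s' D(1), of h]  face_trace_identity[OF P tr(2)[OF s] s' D0(1), of h] h int
      by (simp add: left_diff_distrib)
    have bl: "blimit ((h(j := \<lambda>_. 1)) i)" "blimit ((h(j := \<lambda>t. t)) i)" for i
      using h by (simp_all add: blimit_smooth)
    have intE: "integrable MO (\<lambda>x. ?E x * tprod (h(j := \<lambda>_. 1)) x)" "integrable MO (\<lambda>x. ?E x * tprod (h(j := \<lambda>t. t)) x)"
      by (intro blimit_integrable_mult_tprod pweak_integrable(1)[OF E] bl)+
    have "(LINT x|MO. ?E x * tprod (h(j := \<lambda>t. (1 + s * t) / 2)) x)
        = (LINT x|MO. (1/2) * (?E x * tprod (h(j := \<lambda>_. 1)) x) + (s/2) * (?E x * tprod (h(j := \<lambda>t. t)) x))"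
      by (intro Bochner_Integration.integral_cong) (simp_all add: tprod_upd field_simps)
    also have "\<dots> = 1/2 * E1 h + s/2 * Et h"
      using intE unfolding E1_def Et_def by (subst Bochner_Integration.integral_add) simp_all
    finally have 1: "(LINT x|MO. ?E x * tprod (h(j := \<lambda>t. (1 + s * t) / 2)) x) = 1/2 * E1 h + s/2 * Et h" .
    have "(LINT x|MO. ?w x * tprod (h(j := \<lambda>_. s / 2)) x) = (LINT x|MO. s/2 * (?w x * tprod (h(j := \<lambda>_. 1)) x))"
      by (intro Bochner_Integration.integral_cong) (simp_all add: tprod_upd field_simps)
    also have "\<dots> = s/2 * W h" unfolding W_def by (rule integral_mult_right_zero)
    finally show ?thesis using * 1 by simp
  qed
  have E0: "AE x in MO. ?E x = 0"
  proof (rule fundamental_lemma[OF pweak_integrable(1)[OF E]])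
    fix h :: "3 \<Rightarrow> real \<Rightarrow> real" assume h: "\<And>i. h i \<in> bumps"
    then have "E1 h = 0" using id[of 1 h] id[of "-1" h] by (simp add: bumps_smooth)
    then show "(LINT x|MO. ?E x * tprod h x) = 0"
      using pweak_zero_average[OF E, of h] h blimit_bumps by (simp add: E1_def)
  qed
  then have w0: "pweak j ?w (\<lambda>_. 0)"
    using pweak_integrable[OF w] by (intro pweak_cong_AE[OF w]) auto
  \<comment> \<open>Once \<open>?E\<close> is zero, \<open>?w\<close> does not depend on the
    \<open>j\<close>-th coordinate either, and the terms \<open>E1 h\<close> and \<open>Et h\<close>
    vanish, so each identity reduces to \<open>W h = 0\<close>.\<close>
  have "AE x in MO. ?w x = 0"
  proof (rule fundamental_lemma[OF pweak_integrable(1)[OF w]])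
    fix h :: "3 \<Rightarrow> real \<Rightarrow> real" assume h: "\<And>i. h i \<in> bumps"
    have "Et h = (LINT x|MO. 0)" unfolding Et_def
    proof (rule integral_cong_AE)
      have "(h(j := \<lambda>t. t)) i \<in> smooth" for i using h by (simp add: bumps_smooth)
      then have "tprod (h(j := \<lambda>t. t)) \<in> borel_measurable MO"
        by (intro borel_measurable_lebesgue_onI tprod_measurable smooth_measurable)
      then show "(\<lambda>x. ?E x * tprod (h(j := \<lambda>t. t)) x) \<in> borel_measurable MO"
        using pweak_integrable(1)[OF E] by auto
    qed (use E0 in auto)
    then have "W h = 0" using id[of 1 h] id[of "-1" h] h by (simp add: bumps_smooth)
    then show "(LINT x|MO. ?w x * tprod h x) = 0"
      using pweak_zero_average[OF w0, of h] h blimit_bumps by (simp add: W_def)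
  qed
  then show ?thesis by simp
qed

subsection \<open>Functions of the last coordinate\<close>

lemma AE_coord_neq: "AE x in MO. x $ i \<noteq> (c::real)"
proof -
  have "{x::real^3. x $ i = c} \<in> null_sets lebesgue"
    using negligible_standard_hyperplane[of "axis i 1 :: real^3" c] by (simp add: negligible_iff_null_sets inner_axis)
  then have "AE x in lebesgue. x \<notin> {x::real^3. x $ i = c}" by (rule AE_not_in)
  then show ?thesis by (subst AE_restrict_space_iff) (auto simp: fmeasurableD)
qed

lemma coord_measurable [measurable]: "(\<lambda>x::real^3. x $ i) \<in> borel_measurable borel"
  by (intro borel_measurable_continuous_onI continuous_intros)

lemma coord_measurable_MO [measurable]: "(\<lambda>x. x $ i) \<in> borel_measurable MO"
  by (intro borel_measurable_lebesgue_onI coord_measurable)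

lemma blimit_t3: "blimit a \<Longrightarrow> blimit b \<Longrightarrow> blimit c \<Longrightarrow> blimit (t3 a b c i)"
  by (simp add: t3_def)

lemma int1_FTC:
  assumes g: "\<And>t. (g has_real_derivative g' t) (at t)" "g' \<in> smooth" and p: "-1 \<le> p" "p \<le> 1"
  shows "int1 (\<lambda>t. g' t * indicator {p<..<1} t) = g 1 - g p"
proof -
  have [measurable]: "g' \<in> borel_measurable borel" using g(2) by (rule smooth_measurable)
  have "int1 (\<lambda>t. g' t * indicator {p<..<1} t) = (LINT t|lborel. indicator {-1<..<1} t * (g' t * indicator {p<..<1} t))"
    unfolding int1_def by (rule integral_lebesgue_on_borel) auto
  also have "\<dots> = (LINT t|lborel. indicator {p..1} t *\<^sub>R g' t)"
  proof (rule integral_cong_AE)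
    have "AE t in lborel. t \<noteq> p" "AE t in lborel. t \<noteq> (1::real)" by (rule AE_lborel_singleton)+
    then show "AE t in lborel. indicator {-1<..<1} t * (g' t * indicator {p<..<1} t) = indicator {p..1} t *\<^sub>R g' t"
    proof eventually_elim
      case (elim t)
      then show ?case using p by (auto simp: indicator_def)
    qed
  qed auto
  also have "\<dots> = g 1 - g p"
  proof (rule integral_FTC_atLeastAtMost[OF p(2)])
    show "(g has_vector_derivative g' t) (at t within {p..1})" for t
      using g(1)[of t] by (simp add: has_real_derivative_iff_has_vector_derivative has_vector_derivative_at_within)
  qed (rule smooth_continuous[OF g(2)])
  finally show ?thesis .
qed

lemma int1_indicator:
  assumes "-1 \<le> p" "p \<le> q" "q \<le> 1" shows "int1 (indicator {p<..<q}) = q - p"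
proof -
  have "int1 (indicator {p<..<q}) = (LINT t|lborel. indicator {-1<..<1} t * indicator {p<..<q} t)"
    unfolding int1_def by (rule integral_lebesgue_on_borel) auto
  also have "\<dots> = (LINT t|lborel. indicator {p<..<q} t)"
    using assms by (intro Bochner_Integration.integral_cong) (auto simp: indicator_def)
  also have "\<dots> = q - p" using assms by simp
  finally show ?thesis .
qed

lemma bumps_vanish: assumes "h \<in> bumps" "1 \<le> \<bar>t\<bar>" shows "h t = 0"
  using assms by (auto simp: bumps_def)

lemma int1_deriv_bumps:
  assumes "h \<in> bumps" "-1 \<le> p" "p \<le> 1"
  shows "int1 (\<lambda>t. deriv h t * indicator {p<..<1} t) = - h p"
  using int1_FTC[OF smooth_DERIV[OF bumps_smooth[OF assms(1)]] smooth_deriv[OF bumps_smooth[OF assms(1)]] assms(2,3)]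
    bumps_vanish[OF assms(1), of 1] by simp

lemma int1_deriv_bumps':
  assumes "h \<in> bumps" shows "int1 (deriv h) = 0"
proof -
  have "int1 (deriv h) = int1 (\<lambda>t. deriv h t * indicator {-1<..<1} t)"
    unfolding int1_def by (intro Bochner_Integration.integral_cong) auto
  then show ?thesis using int1_deriv_bumps[OF assms, of "-1"] bumps_vanish[OF assms, of "-1"] by simp
qed

section \<open>Primitives in the last coordinate and the sharp Lipschitz bound\<close>

text \<open>For \<open>\<eta>\<close> depending on the third coordinate only, this is its primitive
  starting at -1: the cross-section has area 4. Integrating over the cube gives a value at every
  \<open>s\<close> without choosing slices of \<open>\<eta>\<close>.\<close>

definition ramp :: "(real^3 \<Rightarrow> real) \<Rightarrow> real \<Rightarrow> real" where
  "ramp \<eta> s = (LINT y|MO. \<eta> y * indicator {..<s} (y $ 3)) / 4"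

interpretation MO2: pair_sigma_finite MO MO ..

lemma ramp_measurable:
  assumes \<eta> [measurable]: "\<eta> \<in> borel_measurable MO"
  shows "(\<lambda>x. ramp \<eta> (x $ 3)) \<in> borel_measurable MO"
proof -
  have "(\<lambda>(x :: real^3, y). \<eta> y * indicator {..<x $ 3} (y $ 3) :: real) = (\<lambda>(x, y). \<eta> y * (if y $ 3 < x $ 3 then 1 else 0))"
    by (auto simp: fun_eq_iff)
  moreover have "(\<lambda>(x :: real^3, y). \<eta> y * (if y $ 3 < x $ 3 then 1 else 0)) \<in> borel_measurable (MO \<Otimes>\<^sub>M MO)"
    by measurable
  ultimately have "(\<lambda>x. LINT y|MO. \<eta> y * indicator {..<x $ 3} (y $ 3)) \<in> borel_measurable MO"
    by (intro MO.borel_measurable_lebesgue_integral) simp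
  then show ?thesis unfolding ramp_def by simp
qed

lemma ramp_bound:
  assumes "integrable MO \<eta>" shows "\<bar>ramp \<eta> s\<bar> \<le> (LINT y|MO. \<bar>\<eta> y\<bar>)"
proof -
  have [measurable]: "\<eta> \<in> borel_measurable MO" using assms by simp
  have int: "integrable MO (\<lambda>y. \<eta> y * indicator {..<s} (y $ 3))"
    by (rule integrable_mult_bounded[OF assms, where B=1]) auto
  have "\<bar>LINT y|MO. \<eta> y * indicator {..<s} (y $ 3)\<bar> \<le> (LINT y|MO. \<bar>\<eta> y * indicator {..<s} (y $ 3)\<bar>)"
    using integral_norm_bound[of MO "\<lambda>y. \<eta> y * indicator {..<s} (y $ 3)"] by simp
  also have "\<dots> \<le> (LINT y|MO. \<bar>\<eta> y\<bar>)"
    using int assms by (intro integral_mono) (auto simp: indicator_def)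
  finally have "\<bar>LINT y|MO. \<eta> y * indicator {..<s} (y $ 3)\<bar> \<le> (LINT y|MO. \<bar>\<eta> y\<bar>)" .
  moreover have "0 \<le> (LINT y|MO. \<bar>\<eta> y\<bar>)" by simp
  ultimately show ?thesis by (simp add: ramp_def)
qed

lemma ramp_integrable:
  assumes "integrable MO \<eta>" shows "integrable MO (\<lambda>x. ramp \<eta> (x $ 3))"
  using ramp_bound[OF assms] ramp_measurable[OF borel_measurable_integrable[OF assms]]
  by (intro MO.integrable_const_bound[where B="LINT y|MO. \<bar>\<eta> y\<bar>"]) auto

text \<open>After exchanging the integrals, the condition \<open>y $ 3 < x $ 3\<close> is an
  indicator on the third factor of the integral in x, which then splits into one-dimensional
  integrals.\<close>

lemma ramp_Fubini:
  assumes \<eta>: "integrable MO \<eta>" and f: "\<And>i. f i \<in> bumps"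
  shows "(LINT x|MO. ramp \<eta> (x $ 3) * tprod f x)
    = (LINT y|MO. \<eta> y * (int1 (f 1) * int1 (f 2) * int1 (\<lambda>t. f 3 t * indicator {y $ 3<..<1} t))) / 4"
proof -
  have [measurable]: "\<eta> \<in> borel_measurable MO" using \<eta> by simp
  have \<Phi>: "integrable MO (tprod f)" using bumps_integrable_mult_tprod[of "\<lambda>_. 1" f] f by simp
  then have [measurable]: "tprod f \<in> borel_measurable MO" by simp
  let ?k = "\<lambda>x y. \<eta> y * (if y $ 3 < x $ 3 then 1 else 0) * tprod f x"
  have "integrable (MO \<Otimes>\<^sub>M MO) (\<lambda>(x, y). tprod f x * \<eta> y)"
    using MO2.Fubini_integrable[of "\<lambda>(x, y). tprod f x * \<eta> y"] \<Phi> \<eta>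
    by (auto simp: abs_mult)
  from integrable_mult_bounded[OF this, of "\<lambda>(x, y). if y $ 3 < x $ 3 then 1 else 0" 1]
  have "integrable (MO \<Otimes>\<^sub>M MO) (\<lambda>p. (case p of (x, y) \<Rightarrow> tprod f x * \<eta> y) * (case p of (x, y) \<Rightarrow> if y $ 3 < x $ 3 then 1 else 0))"
    by (auto simp: split_beta')
  then have int: "integrable (MO \<Otimes>\<^sub>M MO) (\<lambda>(x, y). ?k x y)"
    by (rule Bochner_Integration.integrable_cong[THEN iffD1, rotated -1]) auto
  have "(LINT x|MO. ramp \<eta> (x $ 3) * tprod f x) = (LINT x|MO. (LINT y|MO. ?k x y) / 4)"
  proof (intro Bochner_Integration.integral_cong refl)
    fix x :: "real^3"
    have "ramp \<eta> (x $ 3) = (LINT y|MO. \<eta> y * (if y $ 3 < x $ 3 then 1 else 0)) / 4"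
      unfolding ramp_def by (intro arg_cong[where f="\<lambda>z. z / 4"] Bochner_Integration.integral_cong) auto
    then show "ramp \<eta> (x $ 3) * tprod f x = (LINT y|MO. ?k x y) / 4" by simp
  qed
  also have "\<dots> = (LINT x|MO. LINT y|MO. ?k x y) / 4" by simp
  also have "(LINT x|MO. LINT y|MO. ?k x y) = (LINT y|MO. LINT x|MO. ?k x y)"
    by (rule MO2.Fubini_integral[OF int, symmetric])
  also have "\<dots> = (LINT y|MO. \<eta> y * (int1 (f 1) * int1 (f 2) * int1 (\<lambda>t. f 3 t * indicator {y $ 3<..<1} t)))"
  proof (intro Bochner_Integration.integral_cong refl)
    fix y assume "y \<in> space MO"
    then have y: "-1 \<le> y $ 3" "y $ 3 \<le> 1" by (auto simp: Omega_def less_imp_le)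
    let ?f = "t3 (f 1) (f 2) (\<lambda>t. f 3 t * indicator {y $ 3<..<1} t)"
    have bl: "blimit (?f i)" for i
      using f y by (intro blimit_t3 blimit_bumps blimit_smooth_indicator bumps_smooth) auto
    have "tprod f x = f 1 (x $ 1) * f 2 (x $ 2) * f 3 (x $ 3)" for x
      using tprod_t3[of "f 1" "f 2" "f 3"] by (simp add: t3_collapse)
    then have "(LINT x|MO. ?k x y) = (LINT x|MO. \<eta> y * tprod ?f x)"
      by (intro Bochner_Integration.integral_cong) (auto simp: tprod_t3 Omega_def indicator_def)
    then show "(LINT x|MO. ?k x y) = \<eta> y * (int1 (f 1) * int1 (f 2) * int1 (\<lambda>t. f 3 t * indicator {y $ 3<..<1} t))"
      using tprod_integral[OF bl] by simp
  qed
  finally show ?thesis .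
qed

text \<open>In directions 1 and 2 the integral of the derivative of a bump appears and vanishes. In
  direction 3 the integral of h' over (y_3,1) is -h(y_3), which restores the third factor;
  \<open>h 1\<close> and \<open>h 2\<close> return because \<open>\<eta>\<close> is independent of
  the first two coordinates. Each costs a factor 1/2, matching the division by 4 in
  \<open>ramp\<close>.\<close>

lemma ramp_pweak:
  assumes \<eta>1: "pweak 1 \<eta> (\<lambda>_. 0)" and \<eta>2: "pweak 2 \<eta> (\<lambda>_. 0)"
  shows "pweak 1 (\<lambda>x. ramp \<eta> (x $ 3)) (\<lambda>_. 0)" "pweak 2 (\<lambda>x. ramp \<eta> (x $ 3)) (\<lambda>_. 0)"
    "pweak 3 (\<lambda>x. ramp \<eta> (x $ 3)) \<eta>"
proof -
  note \<eta> = pweak_integrable(1)[OF \<eta>1]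
  note int = ramp_integrable[OF \<eta>]
  have fub: "(LINT x|MO. ramp \<eta> (x $ 3) * tprod (h(j := deriv (h j))) x) = (LINT y|MO. \<eta> y *
      (int1 ((h(j := deriv (h j))) 1) * int1 ((h(j := deriv (h j))) 2) *
        int1 (\<lambda>t. (h(j := deriv (h j))) 3 t * indicator {y $ 3<..<1} t))) / 4"
    if "\<And>i. h i \<in> bumps" for h :: "3 \<Rightarrow> real \<Rightarrow> real" and j
    by (rule ramp_Fubini[OF \<eta>]) (simp add: that bumps_deriv)
  show "pweak 1 (\<lambda>x. ramp \<eta> (x $ 3)) (\<lambda>_. 0)" "pweak 2 (\<lambda>x. ramp \<eta> (x $ 3)) (\<lambda>_. 0)"
    unfolding pweak_def using int by (simp_all add: fub int1_deriv_bumps')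
  have "(LINT x|MO. ramp \<eta> (x $ 3) * tprod (h(3 := deriv (h 3))) x) = - (LINT x|MO. \<eta> x * tprod h x)"
    if h: "\<And>i. h i \<in> bumps" for h
  proof -
    have "(LINT x|MO. ramp \<eta> (x $ 3) * tprod (h(3 := deriv (h 3))) x)
      = (LINT y|MO. \<eta> y * (int1 (h 1) * int1 (h 2) * int1 (\<lambda>t. deriv (h 3) t * indicator {y $ 3<..<1} t))) / 4"
      using fub[OF h, where j=3] by simp
    also have "\<dots> = (LINT y|MO. - (int1 (h 1) * int1 (h 2) / 4) * (\<eta> y * h 3 (y $ 3)))"
      by (subst integral_divide_zero[symmetric], intro Bochner_Integration.integral_cong)
         (auto simp: int1_deriv_bumps[OF h] Omega_def less_imp_le)
    also have "\<dots> = - (int1 (h 1) / 2 * (int1 (h 2) / 2 * (LINT y|MO. \<eta> y * h 3 (y $ 3))))"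
      by (subst integral_mult_right_zero) simp
    also have "int1 (h 2) / 2 * (LINT y|MO. \<eta> y * h 3 (y $ 3)) = (LINT y|MO. \<eta> y * tprod (t3 (\<lambda>_. 1) (h 2) (h 3)) y)"
      using pweak_zero_average[OF \<eta>2, of "t3 (\<lambda>_. 1) (h 2) (h 3)"] h
      by (simp add: blimit_t3 blimit_bumps tprod_t3)
    also have "int1 (h 1) / 2 * (LINT y|MO. \<eta> y * tprod (t3 (\<lambda>_. 1) (h 2) (h 3)) y) = (LINT y|MO. \<eta> y * tprod h y)"
    proof -
      have "h(1 := \<lambda>_. 1) = t3 (\<lambda>_. 1) (h 2) (h 3)" by (simp add: fun_eq_iff forall_3)
      then show ?thesis using pweak_zero_average[OF \<eta>1, of h] h by (simp add: blimit_bumps)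
    qed
    finally show ?thesis .
  qed
  then show "pweak 3 (\<lambda>x. ramp \<eta> (x $ 3)) \<eta>" using int \<eta> by (simp add: pweak_def)
qed

text \<open>Averaging over a thin slab near the face where \<open>\<alpha> * x $ 1\<close> is largest gives the sharp slope.\<close>

lemma slab_bound:
  assumes \<eta>1: "pweak 1 \<eta> (\<lambda>_. 0)" and bound: "AE x in MO. \<eta> x + 2 * \<alpha> * x $ 1 \<le> 2"
    and pq: "-1 \<le> p" "p \<le> q" "q \<le> 1"
  shows "(LINT x|MO. \<eta> x * indicator {p<..<q} (x $ 3)) \<le> 8 * (1 - \<bar>\<alpha>\<bar>) * (q - p)"
proof -
  define X where "X = (LINT x|MO. \<eta> x * indicator {p<..<q} (x $ 3))"
  note \<eta> = pweak_integrable(1)[OF \<eta>1]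
  have X\<delta>: "X \<le> 8 * (1 - \<bar>\<alpha>\<bar>) * (q - p) + \<delta> * (8 * \<bar>\<alpha>\<bar> * (q - p))" if \<delta>: "0 < \<delta>" "\<delta> < 1" for \<delta>
  proof -
    \<comment> \<open>The slab of width \<delta> touches x_1 = 1 or x_1 = -1 according to the sign
      of \<alpha>, so \<alpha> * x_1 is close to |\<alpha>| on it.\<close>
    define l where "l = (if \<alpha> \<ge> 0 then 1 - \<delta> else -1)"
    define u where "u = (if \<alpha> \<ge> 0 then 1 else \<delta> - 1)"
    have lu: "-1 \<le> l" "l \<le> u" "u \<le> 1" "u - l = \<delta>" using \<delta> by (auto simp: l_def u_def)
    have \<alpha>t: "\<bar>\<alpha>\<bar> * (1 - \<delta>) \<le> \<alpha> * t" if "t \<in> {l<..<u}" for t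
    proof (cases "\<alpha> \<ge> 0")
      case True
      then show ?thesis using that by (auto simp: l_def u_def intro!: mult_left_mono)
    next
      case False
      then have "(- \<alpha>) * (1 - \<delta>) \<le> (- \<alpha>) * (- t)" using that by (intro mult_left_mono) (auto simp: l_def u_def)
      then show ?thesis using False by simp
    qed
    let ?h = "t3 (indicator {l<..<u}) (\<lambda>_. 1) (indicator {p<..<q}) :: 3 \<Rightarrow> real \<Rightarrow> real"
    have bl: "blimit (?h i)" for i using lu pq by (intro blimit_t3 blimit_indicator) auto
    define c where "c = 2 - 2 * \<bar>\<alpha>\<bar> * (1 - \<delta>)"
    have "(LINT x|MO. \<eta> x * tprod ?h x) \<le> (LINT x|MO. c * tprod ?h x)"
    proof (rule integral_mono_AE)
      show "integrable MO (\<lambda>x. \<eta> x * tprod ?h x)" "integrable MO (\<lambda>x. c * tprod ?h x)"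
        using blimit_integrable_mult_tprod[OF \<eta> bl] blimit_integrable_mult_tprod[of "\<lambda>_. c", OF _ bl] by simp_all
      show "AE x in MO. \<eta> x * tprod ?h x \<le> c * tprod ?h x"
        using bound
      proof eventually_elim
        case (elim x)
        then show ?case using \<alpha>t[of "x $ 1"] by (auto simp: tprod_t3 c_def indicator_def)
      qed
    qed
    also have "\<dots> = c * (\<delta> * 2 * (q - p))"
      using tprod_integral[OF bl] lu pq int1_const[of 1] by (simp add: int1_indicator)
    \<comment> \<open>As \<open>\<eta>\<close> does not depend on x_1, the slab carries the fraction
      \<delta>/2 of the full integral. The width cancels, and only an error of order \<delta>
      remains.\<close>
    also have "(LINT x|MO. \<eta> x * tprod ?h x) = \<delta> / 2 * X"
      using pweak_zero_average[OF \<eta>1, of ?h] bl lu by (simp add: int1_indicator X_def tprod_t3)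
    finally have "\<delta> * X \<le> \<delta> * (4 * c * (q - p))" by (simp add: mult_ac)
    then have "X \<le> 4 * c * (q - p)" using \<delta> by simp
    then show ?thesis by (simp add: c_def algebra_simps)
  qed
  have "X \<le> 8 * (1 - \<bar>\<alpha>\<bar>) * (q - p)"
  proof (rule tendsto_lowerbound)
    show "((\<lambda>\<delta>. 8 * (1 - \<bar>\<alpha>\<bar>) * (q - p) + \<delta> * (8 * \<bar>\<alpha>\<bar> * (q - p))) \<longlongrightarrow> 8 * (1 - \<bar>\<alpha>\<bar>) * (q - p)) (at_right 0)"
      by (auto intro!: tendsto_eq_intros)
    show "\<forall>\<^sub>F \<delta> in at_right 0. X \<le> 8 * (1 - \<bar>\<alpha>\<bar>) * (q - p) + \<delta> * (8 * \<bar>\<alpha>\<bar> * (q - p))"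
      using X\<delta> by (auto simp: eventually_at_right[of 0 1] intro!: exI[of _ 1])
  qed simp
  then show ?thesis by (simp add: X_def)
qed

text \<open>Increments of the ramp are slab integrals divided by 4, which turns the 8 of
  \<open>slab_bound\<close> into 2. The lower bound is the upper bound for the pair of
  \<open>- \<eta>\<close> and \<open>- \<alpha>\<close>, that is, taken near the opposite
  face.\<close>

lemma ramp_lipschitz:
  assumes \<eta>1: "pweak 1 \<eta> (\<lambda>_. 0)" and bound: "AE x in MO. \<bar>\<eta> x + 2 * \<alpha> * x $ 1\<bar> \<le> 2" and \<alpha>: "\<bar>\<alpha>\<bar> \<le> 1"
  shows "(2 * (1 - \<bar>\<alpha>\<bar>))-lipschitz_on {-1<..<1} (ramp \<eta>)"
proof -
  note \<eta> = pweak_integrable(1)[OF \<eta>1]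
  have [measurable]: "\<eta> \<in> borel_measurable MO" using \<eta> by simp
  have neg: "pweak 1 (\<lambda>x. - \<eta> x) (\<lambda>_. 0)" using pweak_diff[OF pweak_const[of 1 0] \<eta>1] by simp
  have le: "\<bar>ramp \<eta> q - ramp \<eta> p\<bar> \<le> 2 * (1 - \<bar>\<alpha>\<bar>) * (q - p)" if pq: "-1 \<le> p" "p \<le> q" "q \<le> 1" for p q
  proof -
    have int: "integrable MO (\<lambda>y. \<eta> y * indicator S (y $ 3))" if [measurable]: "S \<in> sets borel" for S
      by (rule integrable_mult_bounded[OF \<eta>, where B=1]) auto
    have "4 * (ramp \<eta> q - ramp \<eta> p) = (LINT y|MO. \<eta> y * indicator {..<q} (y $ 3) - \<eta> y * indicator {..<p} (y $ 3))"
      using int by (simp add: ramp_def)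
    \<comment> \<open>The difference of the two indicators lives on the half-open interval from
      \<open>p\<close> to \<open>q\<close>; the hyperplane at \<open>p\<close> is null.\<close>
    also have "\<dots> = (LINT y|MO. \<eta> y * indicator {p<..<q} (y $ 3))"
    proof (rule integral_cong_AE)
      show "AE y in MO. \<eta> y * indicator {..<q} (y $ 3) - \<eta> y * indicator {..<p} (y $ 3) = \<eta> y * indicator {p<..<q} (y $ 3)"
        using AE_coord_neq[of 3 p] by eventually_elim (use pq in \<open>auto simp: indicator_def\<close>)
    qed auto
    finally have eq: "4 * (ramp \<eta> q - ramp \<eta> p) = (LINT y|MO. \<eta> y * indicator {p<..<q} (y $ 3))" .
    have "AE x in MO. \<eta> x + 2 * \<alpha> * x $ 1 \<le> 2" "AE x in MO. - \<eta> x + 2 * (- \<alpha>) * x $ 1 \<le> 2"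
      using bound by (eventually_elim, simp add: abs_le_iff)+
    note b = slab_bound[OF \<eta>1 this(1) pq] slab_bound[OF neg this(2) pq]
    define c where "c = (1 - \<bar>\<alpha>\<bar>) * (q - p)"
    have "\<bar>4 * (ramp \<eta> q - ramp \<eta> p)\<bar> \<le> 8 * c"
      unfolding eq using b by (simp add: abs_le_iff c_def algebra_simps)
    then have "\<bar>ramp \<eta> q - ramp \<eta> p\<bar> \<le> 2 * c" by auto
    then show ?thesis by (simp only: c_def mult.assoc)
  qed
  show ?thesis
  proof (rule lipschitz_onI)
    fix s t :: real assume "s \<in> {-1<..<1}" "t \<in> {-1<..<1}"
    then show "dist (ramp \<eta> s) (ramp \<eta> t) \<le> 2 * (1 - \<bar>\<alpha>\<bar>) * dist s t"
      using le[of s t] le[of t s] by (cases "s \<le> t") (auto simp: dist_real_def abs_minus_commute)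
  qed (use \<alpha> in simp)
qed

text \<open>Commuting derivatives makes \<open>\<eta>\<close> independent of the first two
  coordinates, so \<open>ramp \<eta>\<close> has the same gradient as \<open>w\<close>. The two
  differ by a constant, which is absorbed into \<open>\<psi>\<close>.\<close>

lemma lipschitz_representation:
  assumes w: "pweak 1 w (\<lambda>_. 0)" "pweak 2 w (\<lambda>_. 0)" "pweak 3 w \<eta>"
    and bound: "AE x in MO. \<bar>\<eta> x + 2 * \<alpha> * x $ 1\<bar> \<le> 2" and \<alpha>: "\<bar>\<alpha>\<bar> \<le> 1"
  obtains \<psi> where "(2 * (1 - \<bar>\<alpha>\<bar>))-lipschitz_on {-1<..<1} \<psi>" "AE x in MO. w x = \<psi> (x $ 3)"
proof -
  have \<eta>: "pweak 1 \<eta> (\<lambda>_. 0)" "pweak 2 \<eta> (\<lambda>_. 0)"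
    using pweak_commute[OF w(3,1) pweak_const] pweak_commute[OF w(3,2) pweak_const] by blast+
  have "pweak j (\<lambda>x. w x - ramp \<eta> (x $ 3)) (\<lambda>_. 0)" for j
    using pweak_diff[OF w(1) ramp_pweak(1)[OF \<eta>]] pweak_diff[OF w(2) ramp_pweak(2)[OF \<eta>]]
      pweak_diff[OF w(3) ramp_pweak(3)[OF \<eta>]] exhaust_3[of j] by auto
  then obtain k where k: "AE x in MO. w x - ramp \<eta> (x $ 3) = k" using all_pweak_zero_const by blast
  show ?thesis
  proof (rule that)
    show "(2 * (1 - \<bar>\<alpha>\<bar>))-lipschitz_on {-1<..<1} (\<lambda>s. ramp \<eta> s + k)"
      using ramp_lipschitz[OF \<eta>(1) bound \<alpha>] by (simp add: lipschitz_on_def dist_real_def)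
    show "AE x in MO. w x = ramp \<eta> (x $ 3) + k" using k by eventually_elim simp
  qed
qed

subsection \<open>Fields of zero energy\<close>

text \<open>With distinct indices the monomial is itself a product of functions of one coordinate,
  so smoothness comes from \<open>tprod\<close>.\<close>

lemma quad_C_infinity: "i \<noteq> k \<Longrightarrow> (\<lambda>x::real^3. c * (x $ i * x $ k)) \<in> C_infinity"
proof -
  assume ik: "i \<noteq> k"
  define h :: "3 \<Rightarrow> real \<Rightarrow> real" where "h = (\<lambda>l t. if l = i then c * t else if l = k then t else 1)"
  have "h l \<in> smooth" for l
    by (cases "l = i"; cases "l = k") (simp_all add: h_def smooth_mult)
  then have "tprod h \<in> C_infinity" by (rule tprod_C_infinity)
  moreover have "tprod h = (\<lambda>x. c * (x $ i * x $ k))"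
  proof
    fix x :: "real^3"
    have "tprod h x = h i (x $ i) * (\<Prod>l\<in>UNIV - {i}. h l (x $ l))" by (rule tprod_split)
    also have "(\<Prod>l\<in>UNIV - {i}. h l (x $ l)) = h k (x $ k) * (\<Prod>l\<in>UNIV - {i} - {k}. h l (x $ l))"
      using ik by (intro prod.remove) auto
    also have "(\<Prod>l\<in>UNIV - {i} - {k}. h l (x $ l)) = 1" by (rule prod.neutral) (simp add: h_def)
    finally show "tprod h x = c * (x $ i * x $ k)" using ik by (simp add: h_def)
  qed
  ultimately show ?thesis by simp
qed

lemma lin_C_infinity: "(\<lambda>x::real^3. c * x $ i) \<in> C_infinity"
proof -
  define h :: "3 \<Rightarrow> real \<Rightarrow> real" where "h = (\<lambda>l t. if l = i then c * t else 1)"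
  have "h l \<in> smooth" for l
    by (cases "l = i") (simp_all add: h_def smooth_mult)
  then have "tprod h \<in> C_infinity" by (rule tprod_C_infinity)
  moreover have "tprod h = (\<lambda>x. c * x $ i)"
  proof
    fix x :: "real^3"
    have "tprod h x = h i (x $ i) * (\<Prod>l\<in>UNIV - {i}. h l (x $ l))" by (rule tprod_split)
    also have "(\<Prod>l\<in>UNIV - {i}. h l (x $ l)) = 1" by (rule prod.neutral) (simp add: h_def)
    finally show "tprod h x = c * x $ i" by (simp add: h_def)
  qed
  ultimately show ?thesis by simp
qed

lemma partial_deriv_quad:
  "partial_deriv j (\<lambda>x::real^3. c * (x $ i * x $ k)) = (\<lambda>x. c * (axis j 1 $ i * x $ k + x $ i * axis j 1 $ k))"
proof
  fix x :: "real^3"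
  have "((\<lambda>x. x $ l) has_derivative (\<lambda>h. h $ l)) (at x)" for l
    by (intro bounded_linear_imp_has_derivative bounded_linear_vec_nth)
  then have "((\<lambda>x. c * (x $ i * x $ k)) has_derivative (\<lambda>h. c * (x $ i * h $ k + h $ i * x $ k))) (at x)"
    by (intro has_derivative_mult_right has_derivative_mult)
  from frechet_derivative_at[OF this, symmetric]
  show "partial_deriv j (\<lambda>x. c * (x $ i * x $ k)) x = c * (axis j 1 $ i * x $ k + x $ i * axis j 1 $ k)"
    by (simp add: partial_deriv_def)
qed

lemma partial_deriv_lin: "partial_deriv j (\<lambda>x::real^3. c * x $ i) = (\<lambda>x. c * axis j 1 $ i)"
proof
  fix x :: "real^3"
  have "((\<lambda>x. c * x $ i) has_derivative (\<lambda>h. c * h $ i)) (at x)"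
    by (intro has_derivative_mult_right bounded_linear_imp_has_derivative bounded_linear_vec_nth)
  from frechet_derivative_at[OF this, symmetric]
  show "partial_deriv j (\<lambda>x. c * x $ i) x = c * axis j 1 $ i"
    by (simp add: partial_deriv_def)
qed

lemma pweak_quad:
  "i \<noteq> k \<Longrightarrow> pweak j (\<lambda>x. c * (x $ i * x $ k)) (\<lambda>x. c * (axis j 1 $ i * x $ k + x $ i * axis j 1 $ k))"
  using pweak_C_infinity[OF quad_C_infinity] by (simp add: partial_deriv_quad)

lemma pweak_lin: "pweak j (\<lambda>x. c * x $ i) (\<lambda>x. c * axis j 1 $ i)"
  using pweak_C_infinity[OF lin_C_infinity, of j c i] by (simp add: partial_deriv_lin)

lemma pweak_add: "pweak j f g \<Longrightarrow> pweak j f' g' \<Longrightarrow> pweak j (\<lambda>x. f x + f' x) (\<lambda>x. g x + g' x)"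
  using pweak_lincomb[of j f g f' g' 1] by simp

lemma pweak_uminus: "pweak j f g \<Longrightarrow> pweak j (\<lambda>x. - f x) (\<lambda>x. - g x)"
  using pweak_diff[OF pweak_const[of j 0], of f g] by simp

lemma pweak_cong_deriv:
  assumes "pweak j f g" "AE x in MO. g x = g' x" "integrable MO g'" shows "pweak j f g'"
  using assms pweak_integrable[OF assms(1)] by (intro pweak_cong_AE[OF assms(1) _ assms(2)]) auto

text \<open>Weak derivatives ignore null sets. Once the traces have identified a component of the
  field, its derivatives can be read off by this.\<close>

lemma pweak_AE_unique:
  assumes "pweak j f g" "pweak j f' g'" "AE x in MO. f x = f' x" shows "AE x in MO. g x = g' x"
proof -
  have "pweak j f' g"
    using assms(3) pweak_integrable[OF assms(1)] pweak_integrable[OF assms(2)]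
    by (intro pweak_cong_AE[OF assms(1)]) auto
  then show ?thesis using assms(2) by (rule pweak_unique)
qed

text \<open>The constant sequence is an admissible approximation; what needs proof is square
  integrability on the face.\<close>

lemma C_infinity_face_trace:
  assumes f: "f \<in> C_infinity" and P: "continuous_on UNIV P"
  shows "has_face_trace P f (f \<circ> P)"
proof -
  have c: "continuous_on UNIV (f \<circ> P)"
    unfolding comp_def by (rule continuous_on_compose2[OF C_infinity_continuous[OF f, of UNIV] P]) simp
  let ?C = "cbox (-1, -1) (1, 1) :: (real \<times> real) set"
  have sq: "square \<in> sets borel" by (intro borel_open open_Times) simp_all
  have [measurable]: "f \<circ> P \<in> borel_measurable borel" using c by (rule borel_measurable_continuous_onI)
  have "continuous_on ?C (\<lambda>y. ((f \<circ> P) y)\<^sup>2)"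
    by (rule continuous_on_power[OF continuous_on_subset[OF c]]) simp
  then have "integrable lborel (\<lambda>y. indicator ?C y *\<^sub>R ((f \<circ> P) y)\<^sup>2)"
    by (intro borel_integrable_compact compact_cbox)
  from integrable_mult_indicator[OF _ this, of square]
  have "integrable lborel (\<lambda>y. indicator square y *\<^sub>R (indicator ?C y *\<^sub>R ((f \<circ> P) y)\<^sup>2))" using sq by simp
  moreover have "indicator square y *\<^sub>R (indicator ?C y *\<^sub>R ((f \<circ> P) y)\<^sup>2) = indicator square y * ((f \<circ> P) y)\<^sup>2" for y
    by (auto simp: indicator_def cbox_Pair_eq)
  ultimately have "integrable lborel (\<lambda>y. indicator square y * ((f \<circ> P) y)\<^sup>2)" by (simp only:)
  moreover have "(\<lambda>y. ((f \<circ> P) y)\<^sup>2) \<in> borel_measurable borel" by (rule borel_measurable_power) measurable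
  ultimately have "integrable (lebesgue_on square) (\<lambda>y. ((f \<circ> P) y)\<^sup>2)"
    using sq by (simp only: integrable_lebesgue_on_borel)
  then have L2: "f \<circ> P \<in> L2 (lebesgue_on square)"
    by (simp add: L2_def borel_measurable_lebesgue_onI)
  have "weak_partial Omega j f \<in> L2 MO" for j
    using weak_partial_works[OF C_infinity_W12[OF f]] by (auto simp: has_weak_partial_def)
  then show ?thesis unfolding has_face_trace_def
    using f L2 by (intro exI[of _ "\<lambda>_. f"])
      (simp add: W12_converges_def L2_converges_def C_infinity_W12 C_infinity_L2)
qed

lemma face_continuous: "face_param j P \<Longrightarrow> continuous_on UNIV (P s)"
proof -
  assume "face_param j P"
  then have "continuous_on UNIV (\<lambda>(y, t). P t y)" by (simp add: face_param_def)
  then have "continuous_on UNIV (\<lambda>y. (\<lambda>(y, t). P t y) (y, s))"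
    by (rule continuous_on_compose2) (intro continuous_intros, simp)
  then show ?thesis by simp
qed

section \<open>Zero energy, the competitor and rigidity\<close>

text \<open>A nonnegative integrand has zero integral iff it vanishes almost everywhere; here it is
  infinite where |e_23| > 1 and a sum of squares with positive weights elsewhere.\<close>

lemma E_rel_eq_0_iff:
  assumes u: "u \<in> W12_vec Omega"
  shows "E_rel u = 0 \<longleftrightarrow> (AE x in MO. \<bar>sym_grad u x $ 2 $ 3\<bar> \<le> 1 \<and> sym_grad u x $ 1 $ 1 = 0 \<and>
    sym_grad u x $ 2 $ 2 = 0 \<and> sym_grad u x $ 3 $ 3 = 0 \<and> sym_grad u x $ 1 $ 2 = 0 \<and> sym_grad u x $ 1 $ 3 = 0)"
proof -
  have [measurable]: "weak_partial Omega j (\<lambda>x. u x $ i) \<in> borel_measurable MO" for i j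
    using u weak_partial_works[of "\<lambda>x. u x $ i" Omega j]
    by (auto simp: W12_vec_def has_weak_partial_def L2_def)
  have [measurable]: "(\<lambda>x. sym_grad u x $ i $ j) \<in> borel_measurable MO" for i j
    by (simp add: sym_grad_def)
  have "(\<lambda>x. W_qc (sym_grad u x)) \<in> borel_measurable MO"
    unfolding W_qc_def by measurable
  then have "E_rel u = 0 \<longleftrightarrow> (AE x in MO. W_qc (sym_grad u x) = 0)"
    unfolding E_rel_def by (rule nn_integral_0_iff_AE)
  moreover have "W_qc \<xi> = 0 \<longleftrightarrow> \<bar>\<xi> $ 2 $ 3\<bar> \<le> 1 \<and> \<xi> $ 1 $ 1 = 0 \<and> \<xi> $ 2 $ 2 = 0 \<and> \<xi> $ 3 $ 3 = 0 \<and> \<xi> $ 1 $ 2 = 0 \<and> \<xi> $ 1 $ 3 = 0" for \<xi>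
  proof -
    have "a\<^sup>2 + b\<^sup>2 + c\<^sup>2 + 2 * d\<^sup>2 + 2 * e\<^sup>2 \<le> 0 \<longleftrightarrow> a = 0 \<and> b = 0 \<and> c = 0 \<and> d = 0 \<and> e = 0" for a b c d e :: real
    proof
      assume "a\<^sup>2 + b\<^sup>2 + c\<^sup>2 + 2 * d\<^sup>2 + 2 * e\<^sup>2 \<le> 0"
      moreover have "0 \<le> a\<^sup>2" "0 \<le> b\<^sup>2" "0 \<le> c\<^sup>2" "0 \<le> d\<^sup>2" "0 \<le> e\<^sup>2" by simp_all
      ultimately have "a\<^sup>2 = 0" "b\<^sup>2 = 0" "c\<^sup>2 = 0" "d\<^sup>2 = 0" "e\<^sup>2 = 0" by linarith+
      then show "a = 0 \<and> b = 0 \<and> c = 0 \<and> d = 0 \<and> e = 0" by simp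
    qed simp
    then show ?thesis by (simp add: W_qc_def ennreal_eq_0_iff)
  qed
  ultimately show ?thesis by simp
qed

lemma scaled_u_star_nth:
  "(\<alpha> *\<^sub>R u_star x) $ 1 = (- \<alpha>) * (x $ 2 * x $ 3)"
  "(\<alpha> *\<^sub>R u_star x) $ 2 = \<alpha> * (x $ 1 * x $ 3)"
  "(\<alpha> *\<^sub>R u_star x) $ 3 = \<alpha> * (x $ 1 * x $ 2)"
  by (simp_all add: u_star_def vector_3)

lemma scaled_u_star_C_infinity: "(\<lambda>x. (\<alpha> *\<^sub>R u_star x) $ i) \<in> C_infinity"
  using exhaust_3[of i]
proof (elim disjE)
  assume "i = 1" then show ?thesis unfolding \<open>i = 1\<close> scaled_u_star_nth by (intro quad_C_infinity) simp
next
  assume "i = 2" then show ?thesis unfolding \<open>i = 2\<close> scaled_u_star_nth by (intro quad_C_infinity) simp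
next
  assume "i = 3" then show ?thesis unfolding \<open>i = 3\<close> scaled_u_star_nth by (intro quad_C_infinity) simp
qed

lemma scaled_u_star_W12: "(\<lambda>x. \<alpha> *\<^sub>R u_star x) \<in> W12_vec Omega"
  using C_infinity_W12[OF scaled_u_star_C_infinity] by (simp add: W12_vec_def)

lemma E_rel_scaled_u_star:
  assumes "\<bar>\<alpha>\<bar> \<le> 1" shows "E_rel (\<lambda>x. \<alpha> *\<^sub>R u_star x) = 0"
proof -
  let ?u = "\<lambda>x. \<alpha> *\<^sub>R u_star x"
  have wp: "AE x in MO. weak_partial Omega j (\<lambda>x. ?u x $ i) x = partial_deriv j (\<lambda>x. ?u x $ i) x" for i j
    by (intro weak_partial_AE_eq C_infinity_W12 pweak_C_infinity scaled_u_star_C_infinity)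
  have wp': "AE x in MO. \<forall>i j. weak_partial Omega j (\<lambda>x. ?u x $ i) x = partial_deriv j (\<lambda>x. ?u x $ i) x"
    using wp by (simp add: AE_all_countable)
  have inO: "AE x in MO. x \<in> Omega" by (rule AE_I2) simp
  have pd: "partial_deriv j (\<lambda>x. ?u x $ 1) = (\<lambda>x. (- \<alpha>) * (axis j 1 $ 2 * x $ 3 + x $ 2 * axis j 1 $ 3))"
    "partial_deriv j (\<lambda>x. ?u x $ 2) = (\<lambda>x. \<alpha> * (axis j 1 $ 1 * x $ 3 + x $ 1 * axis j 1 $ 3))"
    "partial_deriv j (\<lambda>x. ?u x $ 3) = (\<lambda>x. \<alpha> * (axis j 1 $ 1 * x $ 2 + x $ 1 * axis j 1 $ 2))" for j
    unfolding scaled_u_star_nth by (rule partial_deriv_quad)+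
  from wp' inO have "AE x in MO. \<bar>sym_grad ?u x $ 2 $ 3\<bar> \<le> 1 \<and> sym_grad ?u x $ 1 $ 1 = 0 \<and>
    sym_grad ?u x $ 2 $ 2 = 0 \<and> sym_grad ?u x $ 3 $ 3 = 0 \<and> sym_grad ?u x $ 1 $ 2 = 0 \<and> sym_grad ?u x $ 1 $ 3 = 0"
  proof eventually_elim
    case (elim x)
    have "\<bar>\<alpha>\<bar> * \<bar>x $ 1\<bar> \<le> 1 * 1" using assms elim(2) by (intro mult_mono) (auto simp: Omega_def abs_le_iff less_imp_le minus_le_iff)
    then show ?case
      using elim(1) unfolding sym_grad_def
      by (simp add: pd axis_def abs_mult del: vector_scaleR_component)
  qed
  then show ?thesis using E_rel_eq_0_iff[OF scaled_u_star_W12, of \<alpha>] by simp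
qed

lemma scaled_u_star_A_LR: "(\<lambda>x. \<alpha> *\<^sub>R u_star x) \<in> A_LR \<alpha>"
proof -
  have "has_face_trace (face3 s) (\<lambda>x. (\<alpha> *\<^sub>R u_star x) $ 3) (\<lambda>(x1, x2). \<alpha> * x1 * x2)" for s
  proof -
    have "(\<lambda>x. (\<alpha> *\<^sub>R u_star x) $ 3) \<circ> face3 s = (\<lambda>(x1, x2). \<alpha> * x1 * x2)"
      by (auto simp: fun_eq_iff face3_def u_star_def vector_3)
    then show ?thesis
      using C_infinity_face_trace[OF scaled_u_star_C_infinity[of \<alpha> 3] face_continuous[OF face_param_face3, of s]] by simp
  qed
  then show ?thesis using scaled_u_star_W12 by (simp add: A_LR_def)
qed

lemma u_star_A_TB: "u_star \<in> A_TB"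
proof -
  have C: "(\<lambda>x. u_star x $ i) \<in> C_infinity" for i using scaled_u_star_C_infinity[of 1 i] by simp
  have "(\<lambda>x. u_star x $ 2) \<circ> face1 s = (\<lambda>(x2, x3). s * x3)" "(\<lambda>x. u_star x $ 3) \<circ> face1 s = (\<lambda>(x2, x3). s * x2)" for s
    by (auto simp: fun_eq_iff face1_def u_star_def vector_3)
  then have "has_face_trace (face1 s) (\<lambda>x. u_star x $ 2) (\<lambda>(x2, x3). s * x3)"
    "has_face_trace (face1 s) (\<lambda>x. u_star x $ 3) (\<lambda>(x2, x3). s * x2)" for s
    using C_infinity_face_trace[OF C[of 2] face_continuous[OF face_param_face1, of s]]
      C_infinity_face_trace[OF C[of 3] face_continuous[OF face_param_face1, of s]] by simp_all
  moreover have "u_star \<in> W12_vec Omega" using scaled_u_star_W12[of 1] by simp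
  ultimately show ?thesis unfolding A_TB_def by blast
qed

text \<open>Here \<open>a\<close> and \<open>b\<close> are the derivatives of u_1 in directions 2
  and 3, while \<open>c\<close> and \<open>d\<close> are the two contributions to e_23. The shear
  conditions express the first derivatives of u_2 and u_3 by \<open>a\<close> and \<open>b\<close>;
  the bound is 2 because e_23 is half the sum.\<close>

lemma zero_energyE:
  assumes u: "u \<in> W12_vec Omega" and E: "E_rel u = 0"
  obtains a b c d where
    "pweak 1 (\<lambda>x. u x $ 1) (\<lambda>_. 0)" "pweak 2 (\<lambda>x. u x $ 2) (\<lambda>_. 0)" "pweak 3 (\<lambda>x. u x $ 3) (\<lambda>_. 0)"
    "pweak 2 (\<lambda>x. u x $ 1) a" "pweak 1 (\<lambda>x. u x $ 2) (\<lambda>x. - a x)"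
    "pweak 3 (\<lambda>x. u x $ 1) b" "pweak 1 (\<lambda>x. u x $ 3) (\<lambda>x. - b x)"
    "pweak 3 (\<lambda>x. u x $ 2) c" "pweak 2 (\<lambda>x. u x $ 3) d" "AE x in MO. \<bar>c x + d x\<bar> \<le> 2"
proof -
  let ?w = "\<lambda>i j. weak_partial Omega j (\<lambda>x. u x $ i)"
  have w: "pweak j (\<lambda>x. u x $ i) (?w i j)" for i j
    using u by (intro pweak_of_weak weak_partial_works) (simp add: W12_vec_def)
  have AE: "AE x in MO. \<bar>?w 2 3 x + ?w 3 2 x\<bar> \<le> 2 \<and> ?w 1 1 x = 0 \<and> ?w 2 2 x = 0 \<and> ?w 3 3 x = 0 \<and>
      ?w 2 1 x = - ?w 1 2 x \<and> ?w 3 1 x = - ?w 1 3 x"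
    using E[unfolded E_rel_eq_0_iff[OF u]]
    by eventually_elim (simp add: sym_grad_def eq_neg_iff_add_eq_0 add.commute)
  note int = pweak_integrable(2)[OF w]
  show ?thesis
  proof (rule that[of "?w 1 2" "?w 1 3" "?w 2 3" "?w 3 2"])
    show "pweak 1 (\<lambda>x. u x $ 1) (\<lambda>_. 0)" "pweak 2 (\<lambda>x. u x $ 2) (\<lambda>_. 0)" "pweak 3 (\<lambda>x. u x $ 3) (\<lambda>_. 0)"
      using AE by (intro pweak_cong_deriv[OF w]; auto)+
    show "pweak 1 (\<lambda>x. u x $ 2) (\<lambda>x. - ?w 1 2 x)" "pweak 1 (\<lambda>x. u x $ 3) (\<lambda>x. - ?w 1 3 x)"
      using AE int by (intro pweak_cong_deriv[OF w]; auto)+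
    show "AE x in MO. \<bar>?w 2 3 x + ?w 3 2 x\<bar> \<le> 2" using AE by auto
  qed (rule w)+
qed

lemma A_TB_zero_energy:
  assumes u: "u \<in> A_TB" and E: "E_rel u = 0"
  obtains c where "AE x in MO. u x = u_star x + c *\<^sub>R axis 1 1"
proof -
  have W: "u \<in> W12_vec Omega"
    and tr2: "\<And>s. s \<in> {-1, 1} \<Longrightarrow> has_face_trace (face1 s) (\<lambda>x. u x $ 2) (\<lambda>(x2, x3). s * x3)"
    and tr3: "\<And>s. s \<in> {-1, 1} \<Longrightarrow> has_face_trace (face1 s) (\<lambda>x. u x $ 3) (\<lambda>(x2, x3). s * x2)"
    using u by (auto simp: A_TB_def)
  have tr2': "\<And>s. s \<in> {-1, 1} \<Longrightarrow> has_face_trace (face1 s) (\<lambda>x. u_star x $ 2) (\<lambda>(x2, x3). s * x3)"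
    and tr3': "\<And>s. s \<in> {-1, 1} \<Longrightarrow> has_face_trace (face1 s) (\<lambda>x. u_star x $ 3) (\<lambda>(x2, x3). s * x2)"
    using u_star_A_TB by (auto simp: A_TB_def)
  obtain a b c d where
    p1: "pweak 1 (\<lambda>x. u x $ 1) (\<lambda>_. 0)" and q2: "pweak 2 (\<lambda>x. u x $ 2) (\<lambda>_. 0)" and r3: "pweak 3 (\<lambda>x. u x $ 3) (\<lambda>_. 0)"
    and p2: "pweak 2 (\<lambda>x. u x $ 1) a" and q1: "pweak 1 (\<lambda>x. u x $ 2) (\<lambda>x. - a x)"
    and p3: "pweak 3 (\<lambda>x. u x $ 1) b" and r1: "pweak 1 (\<lambda>x. u x $ 3) (\<lambda>x. - b x)"
    and q3: "pweak 3 (\<lambda>x. u x $ 2) c" and r2: "pweak 2 (\<lambda>x. u x $ 3) d" and cd: "AE x in MO. \<bar>c x + d x\<bar> \<le> 2"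
    by (rule zero_energyE[OF W E])
  \<comment> \<open>D_1 a = D_2 D_1 u_1 = 0, and likewise for \<open>b\<close>.\<close>
  have a1: "pweak 1 (\<lambda>x. - a x) (\<lambda>_. 0)" and b1: "pweak 1 (\<lambda>x. - b x) (\<lambda>_. 0)"
    using pweak_uminus[OF pweak_commute[OF p2 p1 pweak_const]] pweak_uminus[OF pweak_commute[OF p3 p1 pweak_const]] by simp_all
  have s1: "u_star x $ 1 = (- 1) * (x $ 2 * x $ 3)" and s2: "u_star x $ 2 = 1 * (x $ 1 * x $ 3)"
    and s3: "u_star x $ 3 = 1 * (x $ 1 * x $ 2)" for x
    by (simp_all add: u_star_def vector_3)
  have v2: "pweak 1 (\<lambda>x. u_star x $ 2) (\<lambda>x. 1 * x $ 3)" and v3: "pweak 1 (\<lambda>x. u_star x $ 3) (\<lambda>x. 1 * x $ 2)"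
    unfolding s2 s3 using pweak_quad[of 1 3 1 1] pweak_quad[of 1 2 1 1] by (simp_all add: axis_def)
  have d2: "pweak 1 (\<lambda>x. 1 * x $ 3) (\<lambda>_. 0)" and d3: "pweak 1 (\<lambda>x. 1 * x $ 2) (\<lambda>_. 0)"
    using pweak_lin[of 1 1 3] pweak_lin[of 1 1 2] by (simp_all add: axis_def)
  have u2: "AE x in MO. u x $ 2 = u_star x $ 2"
    by (rule eq_if_face_traces_eq[OF face_param_face1 tr2 tr2' q1 a1 v2 d2])
  have u3: "AE x in MO. u x $ 3 = u_star x $ 3"
    by (rule eq_if_face_traces_eq[OF face_param_face1 tr3 tr3' r1 b1 v3 d3])
  \<comment> \<open>Knowing u_2 and u_3 fixes their derivatives in x_1, hence by the shear
    conditions the remaining derivatives of u_1.\<close>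
  have a: "AE x in MO. - a x = 1 * x $ 3" by (rule pweak_AE_unique[OF q1 v2 u2])
  have b: "AE x in MO. - b x = 1 * x $ 2" by (rule pweak_AE_unique[OF r1 v3 u3])
  have "pweak j (\<lambda>x. u x $ 1 - u_star x $ 1) (\<lambda>_. 0)" for j
  proof -
    have w: "pweak j (\<lambda>x. u_star x $ 1) (\<lambda>x. (- 1) * (axis j 1 $ 2 * x $ 3 + x $ 2 * axis j 1 $ 3))"
      unfolding s1 by (rule pweak_quad) simp
    consider "j = 1" | "j = 2" | "j = 3" using exhaust_3 by blast
    then show ?thesis
    proof cases
      case 1 then show ?thesis using pweak_diff[OF p1 w[unfolded 1]] by (simp add: axis_def)
    next
      case 2 then show ?thesis using a
        by (intro pweak_cong_deriv[OF pweak_diff[OF p2 w[unfolded 2], folded 2]]) (auto simp: axis_def)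
    next
      case 3 then show ?thesis using b
        by (intro pweak_cong_deriv[OF pweak_diff[OF p3 w[unfolded 3], folded 3]]) (auto simp: axis_def)
    qed
  qed
  then obtain c where "AE x in MO. u x $ 1 - u_star x $ 1 = c" using all_pweak_zero_const by blast
  then have "AE x in MO. u x = u_star x + c *\<^sub>R axis 1 1"
    using u2 u3 by eventually_elim (auto simp: vec_eq_iff forall_3 axis_def)
  then show ?thesis by (rule that)
qed

lemma A_LR_zero_energy:
  assumes \<alpha>: "\<bar>\<alpha>\<bar> \<le> 1" and u: "u \<in> A_LR \<alpha>" and E: "E_rel u = 0"
  obtains c d :: real and \<psi> where "(2 * (1 - \<bar>\<alpha>\<bar>))-lipschitz_on {-1<..<1} \<psi>"
    "AE x in MO. u x = \<alpha> *\<^sub>R u_star x + vector [d * x$2 + c, - (d * x$1) + \<psi> (x$3), 0]"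
proof -
  let ?v = "\<lambda>x. \<alpha> *\<^sub>R u_star x"
  have W: "u \<in> W12_vec Omega"
    and tr: "\<And>s. s \<in> {-1, 1} \<Longrightarrow> has_face_trace (face3 s) (\<lambda>x. u x $ 3) (\<lambda>(x1, x2). \<alpha> * x1 * x2)"
    using u by (auto simp: A_LR_def)
  have tr': "\<And>s. s \<in> {-1, 1} \<Longrightarrow> has_face_trace (face3 s) (\<lambda>x. ?v x $ 3) (\<lambda>(x1, x2). \<alpha> * x1 * x2)"
    using scaled_u_star_A_LR[of \<alpha>] by (auto simp: A_LR_def)
  obtain a b c d where
    p1: "pweak 1 (\<lambda>x. u x $ 1) (\<lambda>_. 0)" and q2: "pweak 2 (\<lambda>x. u x $ 2) (\<lambda>_. 0)" and r3: "pweak 3 (\<lambda>x. u x $ 3) (\<lambda>_. 0)"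
    and p2: "pweak 2 (\<lambda>x. u x $ 1) a" and q1: "pweak 1 (\<lambda>x. u x $ 2) (\<lambda>x. - a x)"
    and p3: "pweak 3 (\<lambda>x. u x $ 1) b" and r1: "pweak 1 (\<lambda>x. u x $ 3) (\<lambda>x. - b x)"
    and q3: "pweak 3 (\<lambda>x. u x $ 2) c" and r2: "pweak 2 (\<lambda>x. u x $ 3) d" and cd: "AE x in MO. \<bar>c x + d x\<bar> \<le> 2"
    by (rule zero_energyE[OF W E])
  have v1: "pweak j (\<lambda>x. ?v x $ 1) (\<lambda>x. (- \<alpha>) * (axis j 1 $ 2 * x $ 3 + x $ 2 * axis j 1 $ 3))" for j
    unfolding scaled_u_star_nth by (rule pweak_quad) simp
  have v2: "pweak j (\<lambda>x. ?v x $ 2) (\<lambda>x. \<alpha> * (axis j 1 $ 1 * x $ 3 + x $ 1 * axis j 1 $ 3))" for j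
    unfolding scaled_u_star_nth by (rule pweak_quad) simp
  have v3: "pweak j (\<lambda>x. ?v x $ 3) (\<lambda>x. \<alpha> * (axis j 1 $ 1 * x $ 2 + x $ 1 * axis j 1 $ 2))" for j
    unfolding scaled_u_star_nth by (rule pweak_quad) simp
  have v33: "pweak 3 (\<lambda>x. ?v x $ 3) (\<lambda>_. 0)" using v3[of 3] by (simp add: axis_def)
  have u3: "AE x in MO. u x $ 3 = ?v x $ 3"
    by (rule eq_if_face_traces_eq[OF face_param_face3 tr tr' r3 pweak_const v33 pweak_const])
  \<comment> \<open>Knowing u_3 fixes D_3 u_1 through e_13 = 0, and leaves D_3 u_2 as the only free
    part of e_23.\<close>
  have b: "AE x in MO. - b x = \<alpha> * x $ 2" using pweak_AE_unique[OF r1 v3 u3] by (simp add: axis_def)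
  have d: "AE x in MO. d x = \<alpha> * x $ 1" using pweak_AE_unique[OF r2 v3 u3] by (simp add: axis_def)
  define w1 where "w1 x = u x $ 1 - ?v x $ 1" for x
  define w2 where "w2 x = u x $ 2 - ?v x $ 2" for x
  define g where "g x = a x + \<alpha> * x $ 3" for x
  define \<eta> where "\<eta> x = c x - \<alpha> * x $ 1" for x
  have w11: "pweak 1 w1 (\<lambda>_. 0)" using pweak_diff[OF p1 v1] by (simp add: w1_def[abs_def] axis_def)
  have w12: "pweak 2 w1 g" using pweak_diff[OF p2 v1] by (simp add: w1_def[abs_def] g_def[abs_def] axis_def)
  have w13: "pweak 3 w1 (\<lambda>_. 0)"
  proof -
    have "pweak 3 w1 (\<lambda>x. b x + \<alpha> * x $ 2)" using pweak_diff[OF p3 v1] by (simp add: w1_def[abs_def] axis_def)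
    then show ?thesis by (rule pweak_cong_deriv) (use b in auto)
  qed
  have w21: "pweak 1 w2 (\<lambda>x. - g x)" using pweak_diff[OF q1 v2] by (simp add: w2_def[abs_def] g_def[abs_def] axis_def)
  have w22: "pweak 2 w2 (\<lambda>_. 0)" using pweak_diff[OF q2 v2] by (simp add: w2_def[abs_def] axis_def)
  have w23: "pweak 3 w2 \<eta>" using pweak_diff[OF q3 v2] by (simp add: w2_def[abs_def] \<eta>_def[abs_def] axis_def)
  \<comment> \<open>Each time the order is exchanged so that the inner derivative vanishes: D_1 g =
    D_2 D_1 w1, D_3 g = D_2 D_3 w1 and D_2 g = - D_1 D_2 w2.\<close>
  have "pweak j g (\<lambda>_. 0)" for j
    using pweak_commute[OF w12 w11 pweak_const] pweak_commute[OF w12 w13 pweak_const]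
      pweak_uminus[OF pweak_commute[OF w21 w22 pweak_const]] exhaust_3[of j] by auto
  then obtain k where k: "AE x in MO. g x = k" using all_pweak_zero_const by blast
  have l: "pweak j (\<lambda>x. k * x $ i) (\<lambda>_. k * axis j 1 $ i)" for i j by (rule pweak_lin)
  have "pweak j (\<lambda>x. w1 x - k * x $ 2) (\<lambda>_. 0)" for j
  proof -
    have "pweak 1 (\<lambda>x. w1 x - k * x $ 2) (\<lambda>_. 0)" "pweak 3 (\<lambda>x. w1 x - k * x $ 2) (\<lambda>_. 0)"
      using pweak_diff[OF w11 l[of 1 2]] pweak_diff[OF w13 l[of 3 2]] by (simp_all add: axis_def)
    moreover have "pweak 2 (\<lambda>x. w1 x - k * x $ 2) (\<lambda>_. 0)"
      by (rule pweak_cong_deriv[OF pweak_diff[OF w12 l[of 2 2]]]) (use k in \<open>auto simp: axis_def\<close>)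
    ultimately show ?thesis using exhaust_3[of j] by auto
  qed
  then obtain e where e: "AE x in MO. w1 x - k * x $ 2 = e" using all_pweak_zero_const by blast
  \<comment> \<open>Since D_1 w2 = -k, adding \<open>k * x $ 1\<close> leaves a function of the
    third coordinate alone.\<close>
  let ?w3 = "\<lambda>x. w2 x + k * x $ 1"
  have w31: "pweak 1 ?w3 (\<lambda>_. 0)"
    by (rule pweak_cong_deriv[OF pweak_add[OF w21 l[of 1 1]]]) (use k in \<open>auto simp: axis_def\<close>)
  have w32: "pweak 2 ?w3 (\<lambda>_. 0)" and w33: "pweak 3 ?w3 \<eta>"
    using pweak_add[OF w22 l[of 2 1]] pweak_add[OF w23 l[of 3 1]] by (simp_all add: axis_def)
  \<comment> \<open>Both contributions to e_23 contain \<alpha> * x_1: \<open>d\<close> equals it,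
    and \<open>c\<close> is \<open>\<eta>\<close> plus it. This produces the factor 2.\<close>
  have \<eta>: "AE x in MO. \<bar>\<eta> x + 2 * \<alpha> * x $ 1\<bar> \<le> 2"
    using cd d by eventually_elim (simp add: \<eta>_def)
  obtain \<psi> where \<psi>: "(2 * (1 - \<bar>\<alpha>\<bar>))-lipschitz_on {-1<..<1} \<psi>" "AE x in MO. ?w3 x = \<psi> (x $ 3)"
    using lipschitz_representation[OF w31 w32 w33 \<eta> \<alpha>] by blast
  have "AE x in MO. u x = \<alpha> *\<^sub>R u_star x + vector [k * x$2 + e, - (k * x$1) + \<psi> (x$3), 0]"
    using u3 e \<psi>(2) by eventually_elim (auto simp: vec_eq_iff forall_3 vector_3 w1_def w2_def)
  with \<psi>(1) show ?thesis by (rule that)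
qed

text \<open>Values in \<open>ennreal\<close> are nonnegative, so one competitor of value zero makes
  the minimisers exactly the admissible fields of zero energy.\<close>

lemma is_arg_min_zero:
  fixes f :: "'a \<Rightarrow> ennreal"
  assumes "P x" "f x = 0"
  shows "is_arg_min f P x" and "is_arg_min f P y \<Longrightarrow> P y \<and> f y = 0"
  using assms by (auto simp: is_arg_min_def not_less)

theorem proposition2p1:
  shows "(is_arg_min E_rel (\<lambda>u. u \<in> A_TB) u_star \<and>
          (\<forall>u. is_arg_min E_rel (\<lambda>u. u \<in> A_TB) u \<longrightarrow>
             (\<exists>c::real. AE x in lebesgue_on Omega. u x = u_star x + c *\<^sub>R axis 1 1)))
       \<and> (\<forall>\<alpha>\<in>{-1..1::real}.
            is_arg_min E_rel (\<lambda>u. u \<in> A_LR \<alpha>) (\<lambda>x. \<alpha> *\<^sub>R u_star x) \<and>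
            (\<forall>u. is_arg_min E_rel (\<lambda>u. u \<in> A_LR \<alpha>) u \<longrightarrow>
               (\<exists>(c::real) (d::real) (\<psi>::real \<Rightarrow> real).
                  (2 * (1 - \<bar>\<alpha>\<bar>))-lipschitz_on {-1<..<1} \<psi> \<and>
                  (AE x in lebesgue_on Omega.
                     u x = \<alpha> *\<^sub>R u_star x + vector [d * x$2 + c, - (d * x$1) + \<psi> (x$3), 0]))))"
proof (intro conjI ballI allI impI)
  have E1: "E_rel u_star = 0" using E_rel_scaled_u_star[of 1] by simp
  note TB = is_arg_min_zero[of "\<lambda>u. u \<in> A_TB" u_star E_rel, OF u_star_A_TB E1]
  show "is_arg_min E_rel (\<lambda>u. u \<in> A_TB) u_star" by (rule TB(1))
  show "\<exists>c::real. AE x in MO. u x = u_star x + c *\<^sub>R axis 1 1"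
    if "is_arg_min E_rel (\<lambda>u. u \<in> A_TB) u" for u
    using TB(2)[OF that] A_TB_zero_energy[of u] by blast
  fix \<alpha> :: real assume "\<alpha> \<in> {-1..1}"
  then have \<alpha>: "\<bar>\<alpha>\<bar> \<le> 1" by auto
  note LR = is_arg_min_zero[of "\<lambda>u. u \<in> A_LR \<alpha>" "\<lambda>x. \<alpha> *\<^sub>R u_star x" E_rel, OF scaled_u_star_A_LR E_rel_scaled_u_star[OF \<alpha>]]
  show "is_arg_min E_rel (\<lambda>u. u \<in> A_LR \<alpha>) (\<lambda>x. \<alpha> *\<^sub>R u_star x)" by (rule LR(1))
  show "\<exists>(c::real) (d::real) (\<psi>::real \<Rightarrow> real). (2 * (1 - \<bar>\<alpha>\<bar>))-lipschitz_on {-1<..<1} \<psi> \<and>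
      (AE x in MO. u x = \<alpha> *\<^sub>R u_star x + vector [d * x$2 + c, - (d * x$1) + \<psi> (x$3), 0])"
    if "is_arg_min E_rel (\<lambda>u. u \<in> A_LR \<alpha>) u" for u
    using LR(2)[OF that] A_LR_zero_energy[OF \<alpha>, of u] by blast
qed

end
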